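(* Let $\mathcal C$ be a pre-modular tensor category, let $\mathcal D$ be a pivotal monoidal category and let $\mathcal M\colon\mathcal C\to\mathcal D$ be a pivotal monoidal functor. Then for all objects $X,Y$ of $\mathcal C$ there is an isomorphism $$\mathrm{Hom}^{\sigma}_{\mathcal M}(X,Y^\vee)\cong\mathcal{TM}_X^Y .$$
   Context: $K$ is an algebraically closed field; all categories are $K$-linear with finite-dimensional Hom-spaces and all functors are $K$-linear. A pre-modular tensor category $\mathcal C$ is a spherical fusion category over $K$ with a (balanced) braiding $c_{X,Y}\colon XY\to YX$; $\mathcal I$ is a complete set of simple objects containing the unit $\mathbf 1$. The symbol $\otimes$ is omitted in $\mathcal C$, and associators, unit isomorphisms, pivotal structures and the monoidal structure isomorphisms of $\mathcal M$ are suppressed. $X^\vee$ is a dual of $X$, with $\mathrm{ev}_X\colon X^\vee X\to\mathbf 1$ and (using the pivotal structure) $\widetilde{\mathrm{coev}}_X\colon\mathbf 1\to X^\vee X$. $d(X)$ is the dimension of $X$ and $d(\mathcal C)=\sum_{S\in\mathcal I}d(S)^2$, taken to be nonzero. $\mathrm{Hom}^\sigma_{\mathcal M}(X,Y)$ is the subspace of $\mathrm{Hom}_{\mathcal D}(\mathcal M(X),\mathcal M(Y))$ of those $\beta$ satisfying, for all $Z$ in $\mathcal C$, the equality $(\mathrm{id}_{\mathcal M(Z)}\otimes\beta)\circ\mathcal M(c_{Z,X}^{-1})=\mathcal M(c_{Y,Z})\circ(\beta\otimes\mathrm{id}_{\mathcal M(Z)})$ of morphisms $\mathcal M(X)\otimes\mathcal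 M(Z)\to\mathcal M(Z)\otimes\mathcal M(Y)$ (one side uses the braiding and the other the opposite braiding). Tube category $\mathcal{T}\mathcal{C}$: its objects are those of $\mathcal C$, and $\mathrm{Hom}_{\mathcal{TC}}(X,Y)=\bigoplus_{S\in\mathcal I}\mathrm{Hom}_{\mathcal C}(SX,YS)$. For any object $G$ and $\alpha\in\mathrm{Hom}_{\mathcal C}(GX,YG)$, $\alpha_G\in\mathrm{Hom}_{\mathcal{TC}}(X,Y)$ is the morphism with $S$-component $\sum_b(\mathrm{id}_Y\otimes b^* )\circ\alpha\circ(b\otimes\mathrm{id}_X)$, where $\{b\}$ is a basis of $\mathrm{Hom}_{\mathcal C}(S,G)$ and $\{b^*\}\subset\mathrm{Hom}_{\mathcal C}(G,S)$ the dual basis ($b_i^*\circ b_j=\delta_{ij}\mathrm{id}_S$). Composition is determined by $\beta_H\circ\alpha_G=\big((\beta\otimes\mathrm{id}_G)\circ(\mathrm{id}_H\otimes\alpha)\big)_{HG}$. $\mathcal{T}\mathcal{M}$ is the contravariant functor from $\mathcal{T}\mathcal{C}$ to finite-dimensional vector spaces with $\mathcal{TM}(X)=\mathrm{Hom}_{\mathcal D}(\mathcal M(X),\mathbf 1)$ and, for $\alpha\in\mathrm{Hom}_{\mathcal C}(GX,YG)$ and $\beta\in\mathrm{Hom}_{\mathcal D}(\mathcal M(Y),\mathbf 1)$, $\mathcal{TM}(\alpha_G)(\beta)=\mathcal M(\mathrm{ev}_G)\circ(\mathrm{id}\otimes\beta\otimes\mathrm{id})\circ\mathcal M(\mathrm{id}_{G^\vee}\otimes\alpha)\circ\mathcal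 M(\widetilde{\mathrm{coev}}_G\otimes\mathrm{id}_X)$. $\epsilon_X^Y\in\mathrm{End}_{\mathcal{TC}}(XY)$ is the idempotent with $S$-component $\frac{d(S)}{d(\mathcal C)}(\mathrm{id}_X\otimes c_{Y,S}^{-1})\circ(c_{S,X}\otimes\mathrm{id}_Y)$, and $\mathcal{TM}_X^Y=\{\alpha\in\mathcal{TM}(XY)\mid\mathcal{TM}(\epsilon_X^Y)(\alpha)=\alpha\}$. *)

theory Defs
  imports "HOL-Computational_Algebra.Polynomial"
begin

section \<open>Linear categories\<close>

text \<open>
  Objects form a type \<open>'o\<close>; the Hom spaces \<open>hom C X Y\<close> are subspaces of one ambient
  \<open>'k\<close>-vector space \<open>'m\<close>. Every small linear category is of this form up to isomorphism
  (let \<open>'m\<close> contain the direct sum of the Hom spaces), and zero morphisms and sums of morphisms are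
  the zero and sums of \<open>'m\<close>. All axioms concern morphisms in specified Hom spaces only; the
  values of the operations on other elements of \<open>'m\<close> are irrelevant.
\<close>

record ('k, 'o, 'm) lincat =
  scl :: "'k \<Rightarrow> 'm \<Rightarrow> 'm"
  hom :: "'o \<Rightarrow> 'o \<Rightarrow> 'm set"
  cmp :: "'m \<Rightarrow> 'm \<Rightarrow> 'm"  (infixl \<open>\<cdot>\<index>\<close> 70)
  idn :: "'o \<Rightarrow> 'm"  (\<open>\<iota>\<index>\<close>)

locale linear_category = vector_space "scl C"
  for C :: "('k::field, 'o, 'm::ab_group_add, 'z) lincat_scheme" (structure) +
  assumes hom_subspace: "subspace (hom C X Y)"
    and hom_finite_dim: "\<exists>B. finite B \<and> span B = hom C X Y"
    and id_hom: "\<iota> X \<in> hom C X X"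
    and cmp_hom: "\<lbrakk>f \<in> hom C X Y; g \<in> hom C Y Z\<rbrakk> \<Longrightarrow> g \<cdot> f \<in> hom C X Z"
    and id_left: "f \<in> hom C X Y \<Longrightarrow> \<iota> Y \<cdot> f = f"
    and id_right: "f \<in> hom C X Y \<Longrightarrow> f \<cdot> \<iota> X = f"
    and cmp_assoc: "\<lbrakk>f \<in> hom C W X; g \<in> hom C X Y; h \<in> hom C Y Z\<rbrakk>
      \<Longrightarrow> h \<cdot> (g \<cdot> f) = (h \<cdot> g) \<cdot> f"
    and cmp_add_left: "\<lbrakk>f \<in> hom C X Y; g \<in> hom C Y Z; g' \<in> hom C Y Z\<rbrakk>
      \<Longrightarrow> (g + g') \<cdot> f = g \<cdot> f + g' \<cdot> f"
    and cmp_add_right: "\<lbrakk>f \<in> hom C X Y; f' \<in> hom C X Y; g \<in> hom C Y Z\<rbrakk>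
      \<Longrightarrow> g \<cdot> (f + f') = g \<cdot> f + g \<cdot> f'"
    and cmp_scl_left: "\<lbrakk>f \<in> hom C X Y; g \<in> hom C Y Z\<rbrakk> \<Longrightarrow> scl C a g \<cdot> f = scl C a (g \<cdot> f)"
    and cmp_scl_right: "\<lbrakk>f \<in> hom C X Y; g \<in> hom C Y Z\<rbrakk> \<Longrightarrow> g \<cdot> scl C a f = scl C a (g \<cdot> f)"

definition inverses :: "('k, 'o, 'm, 'z) lincat_scheme \<Rightarrow> 'o \<Rightarrow> 'o \<Rightarrow> 'm \<Rightarrow> 'm \<Rightarrow> bool" where
  "inverses C X Y f g \<longleftrightarrow> f \<in> hom C X Y \<and> g \<in> hom C Y X
     \<and> g \<cdot>\<^bsub>C\<^esub> f = \<iota>\<^bsub>C\<^esub> X \<and> f \<cdot>\<^bsub>C\<^esub> g = \<iota>\<^bsub>C\<^esub> Y"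

definition iso_mor :: "('k, 'o, 'm, 'z) lincat_scheme \<Rightarrow> 'o \<Rightarrow> 'o \<Rightarrow> 'm \<Rightarrow> bool" where
  "iso_mor C X Y f \<longleftrightarrow> (\<exists>g. inverses C X Y f g)"

definition inv_mor :: "('k, 'o, 'm, 'z) lincat_scheme \<Rightarrow> 'o \<Rightarrow> 'o \<Rightarrow> 'm \<Rightarrow> 'm" where
  "inv_mor C X Y f = (THE g. inverses C X Y f g)"

definition isomorphic :: "('k, 'o, 'm, 'z) lincat_scheme \<Rightarrow> 'o \<Rightarrow> 'o \<Rightarrow> bool" where
  "isomorphic C X Y \<longleftrightarrow> (\<exists>f. iso_mor C X Y f)"


subsection \<open>Abelian and semisimple categories\<close>

definition mono_mor :: "('k, 'o, 'm, 'z) lincat_scheme \<Rightarrow> 'o \<Rightarrow> 'o \<Rightarrow> 'm \<Rightarrow> bool" where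
  "mono_mor C X Y f \<longleftrightarrow> f \<in> hom C X Y
     \<and> (\<forall>W. \<forall>g\<in>hom C W X. \<forall>h\<in>hom C W X. f \<cdot>\<^bsub>C\<^esub> g = f \<cdot>\<^bsub>C\<^esub> h \<longrightarrow> g = h)"

definition epi_mor :: "('k, 'o, 'm, 'z) lincat_scheme \<Rightarrow> 'o \<Rightarrow> 'o \<Rightarrow> 'm \<Rightarrow> bool" where
  "epi_mor C X Y f \<longleftrightarrow> f \<in> hom C X Y
     \<and> (\<forall>Z. \<forall>g\<in>hom C Y Z. \<forall>h\<in>hom C Y Z. g \<cdot>\<^bsub>C\<^esub> f = h \<cdot>\<^bsub>C\<^esub> f \<longrightarrow> g = h)"

definition is_kernel ::
  "('k, 'o, 'm::zero, 'z) lincat_scheme \<Rightarrow> 'o \<Rightarrow> 'm \<Rightarrow> 'o \<Rightarrow> 'o \<Rightarrow> 'm \<Rightarrow> bool" where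
  "is_kernel C W k X Y f \<longleftrightarrow> k \<in> hom C W X \<and> f \<cdot>\<^bsub>C\<^esub> k = 0
     \<and> (\<forall>V. \<forall>g\<in>hom C V X. f \<cdot>\<^bsub>C\<^esub> g = 0 \<longrightarrow> (\<exists>!u. u \<in> hom C V W \<and> k \<cdot>\<^bsub>C\<^esub> u = g))"

definition is_cokernel ::
  "('k, 'o, 'm::zero, 'z) lincat_scheme \<Rightarrow> 'o \<Rightarrow> 'm \<Rightarrow> 'o \<Rightarrow> 'o \<Rightarrow> 'm \<Rightarrow> bool" where
  "is_cokernel C W q X Y f \<longleftrightarrow> q \<in> hom C Y W \<and> q \<cdot>\<^bsub>C\<^esub> f = 0
     \<and> (\<forall>V. \<forall>g\<in>hom C Y V. g \<cdot>\<^bsub>C\<^esub> f = 0 \<longrightarrow> (\<exists>!u. u \<in> hom C W V \<and> u \<cdot>\<^bsub>C\<^esub> q = g))"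

locale abelian_category = linear_category +
  assumes zero_object: "\<exists>Z. \<iota> Z = 0"
    and biproducts: "\<exists>P. \<exists>i\<^sub>1\<in>hom C X P. \<exists>i\<^sub>2\<in>hom C Y P. \<exists>p\<^sub>1\<in>hom C P X. \<exists>p\<^sub>2\<in>hom C P Y.
      p\<^sub>1 \<cdot> i\<^sub>1 = \<iota> X \<and> p\<^sub>2 \<cdot> i\<^sub>2 = \<iota> Y \<and> p\<^sub>1 \<cdot> i\<^sub>2 = 0 \<and> p\<^sub>2 \<cdot> i\<^sub>1 = 0
      \<and> i\<^sub>1 \<cdot> p\<^sub>1 + i\<^sub>2 \<cdot> p\<^sub>2 = \<iota> P"
    and kernels: "f \<in> hom C X Y \<Longrightarrow> \<exists>W k. is_kernel C W k X Y f"
    and cokernels: "f \<in> hom C X Y \<Longrightarrow> \<exists>W q. is_cokernel C W q X Y f"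
    and mono_kernel: "mono_mor C X Y f \<Longrightarrow> \<exists>Z. \<exists>g\<in>hom C Y Z. is_kernel C X f Y Z g"
    and epi_cokernel: "epi_mor C X Y f \<Longrightarrow> \<exists>W. \<exists>g\<in>hom C W X. is_cokernel C Y f W X g"

definition simple_object :: "('k, 'o, 'm::zero, 'z) lincat_scheme \<Rightarrow> 'o \<Rightarrow> bool" where
  "simple_object C S \<longleftrightarrow> \<iota>\<^bsub>C\<^esub> S \<noteq> 0
     \<and> (\<forall>W f. mono_mor C W S f \<longrightarrow> \<iota>\<^bsub>C\<^esub> W = 0 \<or> iso_mor C W S f)"

locale semisimple_category = abelian_category +
  assumes semisimple: "\<exists>(n::nat) S i p.
      (\<forall>j<n. simple_object C (S j) \<and> i j \<in> hom C (S j) X \<and> p j \<in> hom C X (S j))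
      \<and> (\<forall>j<n. \<forall>l<n. p j \<cdot> i l = (if j = l then \<iota> (S j) else 0))
      \<and> (\<Sum>j<n. i j \<cdot> p j) = \<iota> X"


section \<open>Monoidal, pivotal and braided categories\<close>

text \<open>
  Monoidal categories are not assumed strict: \<open>asc X Y Z : (X \<otimes> Y) \<otimes> Z \<rightarrow> X \<otimes> (Y \<otimes> Z)\<close>,
  \<open>lun X : \<one> \<otimes> X \<rightarrow> X\<close> and \<open>run X : X \<otimes> \<one> \<rightarrow> X\<close>. The tensor product of objects is \<open>\<otimes>\<close>,
  that of morphisms \<open>\<boxtimes>\<close>.
\<close>

record ('k, 'o, 'm) moncat = "('k, 'o, 'm) lincat" +
  tob :: "'o \<Rightarrow> 'o \<Rightarrow> 'o"  (infixr \<open>\<otimes>\<index>\<close> 75)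
  tmo :: "'m \<Rightarrow> 'm \<Rightarrow> 'm"  (infixr \<open>\<boxtimes>\<index>\<close> 75)
  unt :: 'o  (\<open>\<one>\<index>\<close>)
  asc :: "'o \<Rightarrow> 'o \<Rightarrow> 'o \<Rightarrow> 'm"
  lun :: "'o \<Rightarrow> 'm"
  run :: "'o \<Rightarrow> 'm"

locale monoidal_category = linear_category C
  for C :: "('k::field, 'o, 'm::ab_group_add, 'z) moncat_scheme" (structure) +
  assumes tmo_hom: "\<lbrakk>f \<in> hom C X Y; f' \<in> hom C X' Y'\<rbrakk>
      \<Longrightarrow> f \<boxtimes> f' \<in> hom C (X \<otimes> X') (Y \<otimes> Y')"
    and tmo_id: "\<iota> X \<boxtimes> \<iota> Y = \<iota> (X \<otimes> Y)"
    and tmo_cmp: "\<lbrakk>f \<in> hom C X Y; g \<in> hom C Y Z; f' \<in> hom C X' Y'; g' \<in> hom C Y' Z'\<rbrakk>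
      \<Longrightarrow> (g \<cdot> f) \<boxtimes> (g' \<cdot> f') = (g \<boxtimes> g') \<cdot> (f \<boxtimes> f')"
    and tmo_add_left: "\<lbrakk>f \<in> hom C X Y; g \<in> hom C X Y; h \<in> hom C X' Y'\<rbrakk>
      \<Longrightarrow> (f + g) \<boxtimes> h = f \<boxtimes> h + g \<boxtimes> h"
    and tmo_add_right: "\<lbrakk>f \<in> hom C X Y; g \<in> hom C X' Y'; h \<in> hom C X' Y'\<rbrakk>
      \<Longrightarrow> f \<boxtimes> (g + h) = f \<boxtimes> g + f \<boxtimes> h"
    and tmo_scl_left: "\<lbrakk>f \<in> hom C X Y; h \<in> hom C X' Y'\<rbrakk>
      \<Longrightarrow> scl C a f \<boxtimes> h = scl C a (f \<boxtimes> h)"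
    and tmo_scl_right: "\<lbrakk>f \<in> hom C X Y; h \<in> hom C X' Y'\<rbrakk>
      \<Longrightarrow> f \<boxtimes> scl C a h = scl C a (f \<boxtimes> h)"
    and asc_iso: "iso_mor C ((X \<otimes> Y) \<otimes> Z) (X \<otimes> (Y \<otimes> Z)) (asc C X Y Z)"
    and asc_natural: "\<lbrakk>f \<in> hom C X X'; g \<in> hom C Y Y'; h \<in> hom C Z Z'\<rbrakk>
      \<Longrightarrow> asc C X' Y' Z' \<cdot> ((f \<boxtimes> g) \<boxtimes> h) = (f \<boxtimes> (g \<boxtimes> h)) \<cdot> asc C X Y Z"
    and lun_iso: "iso_mor C (\<one> \<otimes> X) X (lun C X)"
    and lun_natural: "f \<in> hom C X Y \<Longrightarrow> lun C Y \<cdot> (\<iota> \<one> \<boxtimes> f) = f \<cdot> lun C X"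
    and run_iso: "iso_mor C (X \<otimes> \<one>) X (run C X)"
    and run_natural: "f \<in> hom C X Y \<Longrightarrow> run C Y \<cdot> (f \<boxtimes> \<iota> \<one>) = f \<cdot> run C X"
    and pentagon: "asc C W X (Y \<otimes> Z) \<cdot> asc C (W \<otimes> X) Y Z
      = (\<iota> W \<boxtimes> asc C X Y Z) \<cdot> asc C W (X \<otimes> Y) Z \<cdot> (asc C W X Y \<boxtimes> \<iota> Z)"
    and triangle: "(\<iota> X \<boxtimes> lun C Y) \<cdot> asc C X \<one> Y = run C X \<boxtimes> \<iota> Y"

text \<open>
  \<open>dual C X\<close> with \<open>ev C X : dual C X \<otimes> X \<rightarrow> \<one>\<close> and \<open>coev C X : \<one> \<rightarrow> X \<otimes> dual C X\<close> is a chosen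
  dual of \<open>X\<close>; \<open>piv C X : X \<rightarrow> dual C (dual C X)\<close> is the pivotal structure.
\<close>

record ('k, 'o, 'm) pivcat = "('k, 'o, 'm) moncat" +
  dual :: "'o \<Rightarrow> 'o"
  ev :: "'o \<Rightarrow> 'm"
  coev :: "'o \<Rightarrow> 'm"
  piv :: "'o \<Rightarrow> 'm"

text \<open>The morphism \<open>A \<rightarrow> dual C X\<close> corresponding to a pairing \<open>e : A \<otimes> X \<rightarrow> \<one>\<close>.\<close>

definition mate :: "('k, 'o, 'm, 'z) pivcat_scheme \<Rightarrow> 'o \<Rightarrow> 'o \<Rightarrow> 'm \<Rightarrow> 'm" where
  "mate C A X e =
     lun C (dual C X)
     \<cdot>\<^bsub>C\<^esub> (e \<boxtimes>\<^bsub>C\<^esub> \<iota>\<^bsub>C\<^esub> (dual C X))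
     \<cdot>\<^bsub>C\<^esub> inv_mor C ((A \<otimes>\<^bsub>C\<^esub> X) \<otimes>\<^bsub>C\<^esub> dual C X) (A \<otimes>\<^bsub>C\<^esub> (X \<otimes>\<^bsub>C\<^esub> dual C X)) (asc C A X (dual C X))
     \<cdot>\<^bsub>C\<^esub> (\<iota>\<^bsub>C\<^esub> A \<boxtimes>\<^bsub>C\<^esub> coev C X)
     \<cdot>\<^bsub>C\<^esub> inv_mor C (A \<otimes>\<^bsub>C\<^esub> \<one>\<^bsub>C\<^esub>) A (run C A)"

definition dual_mor :: "('k, 'o, 'm, 'z) pivcat_scheme \<Rightarrow> 'o \<Rightarrow> 'o \<Rightarrow> 'm \<Rightarrow> 'm" where
  "dual_mor C X Y f = mate C (dual C Y) X (ev C Y \<cdot>\<^bsub>C\<^esub> (\<iota>\<^bsub>C\<^esub> (dual C Y) \<boxtimes>\<^bsub>C\<^esub> f))"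

text \<open>The structure isomorphisms \<open>dual C Y \<otimes> dual C X \<rightarrow> dual C (X \<otimes> Y)\<close> and \<open>\<one> \<rightarrow> dual C \<one>\<close> of
  the contravariant monoidal functor \<open>dual C\<close>.\<close>

definition dual_tensor :: "('k, 'o, 'm, 'z) pivcat_scheme \<Rightarrow> 'o \<Rightarrow> 'o \<Rightarrow> 'm" where
  "dual_tensor C X Y = mate C (dual C Y \<otimes>\<^bsub>C\<^esub> dual C X) (X \<otimes>\<^bsub>C\<^esub> Y)
     (ev C Y
      \<cdot>\<^bsub>C\<^esub> (\<iota>\<^bsub>C\<^esub> (dual C Y) \<boxtimes>\<^bsub>C\<^esub>
          (lun C Y \<cdot>\<^bsub>C\<^esub> (ev C X \<boxtimes>\<^bsub>C\<^esub> \<iota>\<^bsub>C\<^esub> Y)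
           \<cdot>\<^bsub>C\<^esub> inv_mor C ((dual C X \<otimes>\<^bsub>C\<^esub> X) \<otimes>\<^bsub>C\<^esub> Y) (dual C X \<otimes>\<^bsub>C\<^esub> (X \<otimes>\<^bsub>C\<^esub> Y))
               (asc C (dual C X) X Y)))
      \<cdot>\<^bsub>C\<^esub> asc C (dual C Y) (dual C X) (X \<otimes>\<^bsub>C\<^esub> Y))"

definition dual_unit :: "('k, 'o, 'm, 'z) pivcat_scheme \<Rightarrow> 'm" where
  "dual_unit C = mate C \<one>\<^bsub>C\<^esub> \<one>\<^bsub>C\<^esub> (lun C \<one>\<^bsub>C\<^esub>)"

text \<open>The pivotal structure is a monoidal natural isomorphism from the identity to the double dual;
  both monoidality axioms are stated after moving the contravariant constraint to the other side.\<close>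

locale pivotal_category = monoidal_category C
  for C :: "('k::field, 'o, 'm::ab_group_add, 'z) pivcat_scheme" (structure) +
  assumes ev_hom: "ev C X \<in> hom C (dual C X \<otimes> X) \<one>"
    and coev_hom: "coev C X \<in> hom C \<one> (X \<otimes> dual C X)"
    and zigzag: "run C X \<cdot> (\<iota> X \<boxtimes> ev C X) \<cdot> asc C X (dual C X) X \<cdot> (coev C X \<boxtimes> \<iota> X)
      \<cdot> inv_mor C (\<one> \<otimes> X) X (lun C X) = \<iota> X"
    and zigzag_dual: "mate C (dual C X) X (ev C X) = \<iota> (dual C X)"
    and piv_iso: "iso_mor C X (dual C (dual C X)) (piv C X)"
    and piv_natural: "f \<in> hom C X Y \<Longrightarrow>
      piv C Y \<cdot> f = dual_mor C (dual C Y) (dual C X) (dual_mor C X Y f) \<cdot> piv C X"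
    and piv_tensor:
      "dual_mor C (dual C Y \<otimes> dual C X) (dual C (X \<otimes> Y)) (dual_tensor C X Y) \<cdot> piv C (X \<otimes> Y)
       = dual_tensor C (dual C Y) (dual C X) \<cdot> (piv C X \<boxtimes> piv C Y)"
    and piv_unit: "dual_mor C \<one> (dual C \<one>) (dual_unit C) \<cdot> piv C \<one> = dual_unit C"

definition coev' :: "('k, 'o, 'm, 'z) pivcat_scheme \<Rightarrow> 'o \<Rightarrow> 'm" where
  "coev' C X = (\<iota>\<^bsub>C\<^esub> (dual C X) \<boxtimes>\<^bsub>C\<^esub> inv_mor C X (dual C (dual C X)) (piv C X))
     \<cdot>\<^bsub>C\<^esub> coev C (dual C X)"

definition ev' :: "('k, 'o, 'm, 'z) pivcat_scheme \<Rightarrow> 'o \<Rightarrow> 'm" where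
  "ev' C X = ev C (dual C X) \<cdot>\<^bsub>C\<^esub> (piv C X \<boxtimes>\<^bsub>C\<^esub> \<iota>\<^bsub>C\<^esub> (dual C X))"

definition left_trace :: "('k, 'o, 'm, 'z) pivcat_scheme \<Rightarrow> 'o \<Rightarrow> 'm \<Rightarrow> 'm" where
  "left_trace C X f = ev C X \<cdot>\<^bsub>C\<^esub> (\<iota>\<^bsub>C\<^esub> (dual C X) \<boxtimes>\<^bsub>C\<^esub> f) \<cdot>\<^bsub>C\<^esub> coev' C X"

definition right_trace :: "('k, 'o, 'm, 'z) pivcat_scheme \<Rightarrow> 'o \<Rightarrow> 'm \<Rightarrow> 'm" where
  "right_trace C X f = ev' C X \<cdot>\<^bsub>C\<^esub> (f \<boxtimes>\<^bsub>C\<^esub> \<iota>\<^bsub>C\<^esub> (dual C X)) \<cdot>\<^bsub>C\<^esub> coev C X"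

locale spherical_fusion_category = pivotal_category + semisimple_category +
  assumes finitely_many_simples:
      "\<exists>F. finite F \<and> (\<forall>S. simple_object C S \<longrightarrow> (\<exists>T\<in>F. isomorphic C S T))"
    and unit_simple: "simple_object C \<one>"
    and spherical: "f \<in> hom C X X \<Longrightarrow> left_trace C X f = right_trace C X f"

record ('k, 'o, 'm) brcat = "('k, 'o, 'm) pivcat" +
  brd :: "'o \<Rightarrow> 'o \<Rightarrow> 'm"

text \<open>A braiding on a pivotal category is automatically balanced: the twist is the composite of the
  pivotal structure with the inverse of the Drinfeld isomorphism from \<open>X\<close> to its double dual.\<close>

locale premodular_category = spherical_fusion_category C
  for C :: "('k::alg_closed_field, 'o, 'm::ab_group_add, 'z) brcat_scheme" (structure) +
  assumes brd_iso: "iso_mor C (X \<otimes> Y) (Y \<otimes> X) (brd C X Y)"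
    and brd_natural: "\<lbrakk>f \<in> hom C X X'; g \<in> hom C Y Y'\<rbrakk>
      \<Longrightarrow> brd C X' Y' \<cdot> (f \<boxtimes> g) = (g \<boxtimes> f) \<cdot> brd C X Y"
    and hexagon: "asc C Y Z X \<cdot> brd C X (Y \<otimes> Z) \<cdot> asc C X Y Z
      = (\<iota> Y \<boxtimes> brd C X Z) \<cdot> asc C Y X Z \<cdot> (brd C X Y \<boxtimes> \<iota> Z)"
    and hexagon':
      "inv_mor C ((Z \<otimes> X) \<otimes> Y) (Z \<otimes> (X \<otimes> Y)) (asc C Z X Y) \<cdot> brd C (X \<otimes> Y) Z
         \<cdot> inv_mor C ((X \<otimes> Y) \<otimes> Z) (X \<otimes> (Y \<otimes> Z)) (asc C X Y Z)
       = (brd C X Z \<boxtimes> \<iota> Y) \<cdot> inv_mor C ((X \<otimes> Z) \<otimes> Y) (X \<otimes> (Z \<otimes> Y)) (asc C X Z Y)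
         \<cdot> (\<iota> X \<boxtimes> brd C Y Z)"

definition inv_brd :: "('k, 'o, 'm, 'z) brcat_scheme \<Rightarrow> 'o \<Rightarrow> 'o \<Rightarrow> 'm" where
  "inv_brd C X Y = inv_mor C (X \<otimes>\<^bsub>C\<^esub> Y) (Y \<otimes>\<^bsub>C\<^esub> X) (brd C X Y)"

text \<open>A complete set of representatives of the simple objects, containing the unit.\<close>

definition complete_simples :: "('k, 'o, 'm::zero, 'z) moncat_scheme \<Rightarrow> 'o set \<Rightarrow> bool" where
  "complete_simples C I \<longleftrightarrow> \<one>\<^bsub>C\<^esub> \<in> I \<and> (\<forall>S\<in>I. simple_object C S)
     \<and> (\<forall>S. simple_object C S \<longrightarrow> (\<exists>!T. T \<in> I \<and> isomorphic C S T))"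

text \<open>\<open>d(X)\<close> as a scalar, via \<open>End(\<one>) = 'k\<close>, and \<open>d(C)\<close>.\<close>

definition qdim :: "('k, 'o, 'm, 'z) pivcat_scheme \<Rightarrow> 'o \<Rightarrow> 'k" where
  "qdim C X = (THE a. scl C a (\<iota>\<^bsub>C\<^esub> \<one>\<^bsub>C\<^esub>) = left_trace C X (\<iota>\<^bsub>C\<^esub> X))"

definition cat_dim :: "('k::comm_ring_1, 'o, 'm, 'z) pivcat_scheme \<Rightarrow> 'o set \<Rightarrow> 'k" where
  "cat_dim C I = (\<Sum>S\<in>I. (qdim C S)\<^sup>2)"


section \<open>Pivotal monoidal functors\<close>

text \<open>\<open>fmu M X Y : M X \<otimes> M Y \<rightarrow> M (X \<otimes> Y)\<close> and \<open>fun1 M : \<one> \<rightarrow> M \<one>\<close> are the monoidal structure.\<close>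

record ('o, 'm, 'p, 'n) monfun =
  fob :: "'o \<Rightarrow> 'p"
  fmo :: "'m \<Rightarrow> 'n"
  fmu :: "'o \<Rightarrow> 'o \<Rightarrow> 'n"
  fun1 :: 'n

locale monoidal_functor = C: monoidal_category C + D: monoidal_category D
  for C :: "('k::field, 'o, 'm::ab_group_add, 'y) moncat_scheme"
    and D :: "('k, 'p, 'n::ab_group_add, 'z) moncat_scheme" +
  fixes M :: "('o, 'm, 'p, 'n) monfun"
  assumes fmo_hom: "f \<in> hom C X Y \<Longrightarrow> fmo M f \<in> hom D (fob M X) (fob M Y)"
    and fmo_id: "fmo M (\<iota>\<^bsub>C\<^esub> X) = \<iota>\<^bsub>D\<^esub> (fob M X)"
    and fmo_cmp: "\<lbrakk>f \<in> hom C X Y; g \<in> hom C Y Z\<rbrakk> \<Longrightarrow> fmo M (g \<cdot>\<^bsub>C\<^esub> f) = fmo M g \<cdot>\<^bsub>D\<^esub> fmo M f"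
    and fmo_add: "\<lbrakk>f \<in> hom C X Y; g \<in> hom C X Y\<rbrakk> \<Longrightarrow> fmo M (f + g) = fmo M f + fmo M g"
    and fmo_scl: "f \<in> hom C X Y \<Longrightarrow> fmo M (scl C a f) = scl D a (fmo M f)"
    and fmu_iso: "iso_mor D (fob M X \<otimes>\<^bsub>D\<^esub> fob M Y) (fob M (X \<otimes>\<^bsub>C\<^esub> Y)) (fmu M X Y)"
    and fmu_natural: "\<lbrakk>f \<in> hom C X X'; g \<in> hom C Y Y'\<rbrakk>
      \<Longrightarrow> fmu M X' Y' \<cdot>\<^bsub>D\<^esub> (fmo M f \<boxtimes>\<^bsub>D\<^esub> fmo M g) = fmo M (f \<boxtimes>\<^bsub>C\<^esub> g) \<cdot>\<^bsub>D\<^esub> fmu M X Y"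
    and fun1_iso: "iso_mor D \<one>\<^bsub>D\<^esub> (fob M \<one>\<^bsub>C\<^esub>) (fun1 M)"
    and fmu_asc:
      "fmu M X (Y \<otimes>\<^bsub>C\<^esub> Z) \<cdot>\<^bsub>D\<^esub> (\<iota>\<^bsub>D\<^esub> (fob M X) \<boxtimes>\<^bsub>D\<^esub> fmu M Y Z)
         \<cdot>\<^bsub>D\<^esub> asc D (fob M X) (fob M Y) (fob M Z)
       = fmo M (asc C X Y Z) \<cdot>\<^bsub>D\<^esub> fmu M (X \<otimes>\<^bsub>C\<^esub> Y) Z \<cdot>\<^bsub>D\<^esub> (fmu M X Y \<boxtimes>\<^bsub>D\<^esub> \<iota>\<^bsub>D\<^esub> (fob M Z))"
    and fmu_lun: "fmo M (lun C X) \<cdot>\<^bsub>D\<^esub> fmu M \<one>\<^bsub>C\<^esub> X \<cdot>\<^bsub>D\<^esub> (fun1 M \<boxtimes>\<^bsub>D\<^esub> \<iota>\<^bsub>D\<^esub> (fob M X))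
      = lun D (fob M X)"
    and fmu_run: "fmo M (run C X) \<cdot>\<^bsub>D\<^esub> fmu M X \<one>\<^bsub>C\<^esub> \<cdot>\<^bsub>D\<^esub> (\<iota>\<^bsub>D\<^esub> (fob M X) \<boxtimes>\<^bsub>D\<^esub> fun1 M)
      = run D (fob M X)"

definition inv_fmu ::
  "('k, 'o, 'm, 'y) moncat_scheme \<Rightarrow> ('k, 'p, 'n, 'z) moncat_scheme \<Rightarrow> ('o, 'm, 'p, 'n) monfun
    \<Rightarrow> 'o \<Rightarrow> 'o \<Rightarrow> 'n" where
  "inv_fmu C D M X Y = inv_mor D (fob M X \<otimes>\<^bsub>D\<^esub> fob M Y) (fob M (X \<otimes>\<^bsub>C\<^esub> Y)) (fmu M X Y)"

definition inv_fun1 ::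
  "('k, 'o, 'm, 'y) moncat_scheme \<Rightarrow> ('k, 'p, 'n, 'z) moncat_scheme \<Rightarrow> ('o, 'm, 'p, 'n) monfun
    \<Rightarrow> 'n" where
  "inv_fun1 C D M = inv_mor D \<one>\<^bsub>D\<^esub> (fob M \<one>\<^bsub>C\<^esub>) (fun1 M)"

text \<open>The canonical isomorphism from \<open>M (dual C X)\<close> to \<open>dual D (M X)\<close>. A monoidal functor is
  pivotal if this isomorphism is compatible with the pivotal structures.\<close>

definition fdual ::
  "('k, 'o, 'm, 'y) pivcat_scheme \<Rightarrow> ('k, 'p, 'n, 'z) pivcat_scheme \<Rightarrow> ('o, 'm, 'p, 'n) monfun
    \<Rightarrow> 'o \<Rightarrow> 'n" where
  "fdual C D M X = mate D (fob M (dual C X)) (fob M X)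
     (inv_fun1 C D M \<cdot>\<^bsub>D\<^esub> fmo M (ev C X) \<cdot>\<^bsub>D\<^esub> fmu M (dual C X) X)"

locale pivotal_monoidal_functor = monoidal_functor C D M + C: pivotal_category C + D: pivotal_category D
  for C :: "('k::field, 'o, 'm::ab_group_add, 'y) pivcat_scheme"
    and D :: "('k, 'p, 'n::ab_group_add, 'z) pivcat_scheme"
    and M :: "('o, 'm, 'p, 'n) monfun" +
  assumes fmo_piv:
    "dual_mor D (fob M (dual C X)) (dual D (fob M X)) (fdual C D M X) \<cdot>\<^bsub>D\<^esub> piv D (fob M X)
     = fdual C D M (dual C X) \<cdot>\<^bsub>D\<^esub> fmo M (piv C X)"


section \<open>The space \<open>Hom\<^sup>\<sigma>\<close>\<close>

text \<open>\<open>M f\<close> for \<open>f : X \<otimes> Y \<rightarrow> X' \<otimes> Y'\<close>, regarded as a morphism \<open>M X \<otimes> M Y \<rightarrow> M X' \<otimes> M Y'\<close>.\<close>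

definition fmo2 ::
  "('k, 'o, 'm, 'y) moncat_scheme \<Rightarrow> ('k, 'p, 'n, 'z) moncat_scheme \<Rightarrow> ('o, 'm, 'p, 'n) monfun
    \<Rightarrow> 'o \<Rightarrow> 'o \<Rightarrow> 'o \<Rightarrow> 'o \<Rightarrow> 'm \<Rightarrow> 'n" where
  "fmo2 C D M X Y X' Y' f = inv_fmu C D M X' Y' \<cdot>\<^bsub>D\<^esub> fmo M f \<cdot>\<^bsub>D\<^esub> fmu M X Y"

definition hom_sigma ::
  "('k, 'o, 'm, 'y) brcat_scheme \<Rightarrow> ('k, 'p, 'n, 'z) moncat_scheme \<Rightarrow> ('o, 'm, 'p, 'n) monfun
    \<Rightarrow> 'o \<Rightarrow> 'o \<Rightarrow> 'n set" where
  "hom_sigma C D M X Y = {\<beta> \<in> hom D (fob M X) (fob M Y). \<forall>Z.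
     (\<iota>\<^bsub>D\<^esub> (fob M Z) \<boxtimes>\<^bsub>D\<^esub> \<beta>) \<cdot>\<^bsub>D\<^esub> fmo2 C D M X Z Z X (inv_brd C Z X)
     = fmo2 C D M Y Z Z Y (brd C Y Z) \<cdot>\<^bsub>D\<^esub> (\<beta> \<boxtimes>\<^bsub>D\<^esub> \<iota>\<^bsub>D\<^esub> (fob M Z))}"


section \<open>The tube category\<close>

text \<open>A tube morphism is the family of its components, extended by \<open>0\<close> outside \<open>I\<close>.\<close>

definition tube_hom :: "('k, 'o, 'm::zero, 'z) moncat_scheme \<Rightarrow> 'o set \<Rightarrow> 'o \<Rightarrow> 'o \<Rightarrow> ('o \<Rightarrow> 'm) set"
  where "tube_hom C I X Y =
    {f. (\<forall>S\<in>I. f S \<in> hom C (S \<otimes>\<^bsub>C\<^esub> X) (Y \<otimes>\<^bsub>C\<^esub> S)) \<and> (\<forall>S. S \<notin> I \<longrightarrow> f S = 0)}"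

definition dual_basis ::
  "('k::field, 'o, 'm::ab_group_add, 'z) lincat_scheme \<Rightarrow> 'o \<Rightarrow> 'o \<Rightarrow> 'm set \<Rightarrow> ('m \<Rightarrow> 'm) \<Rightarrow> bool"
  where "dual_basis C S G B b' \<longleftrightarrow>
    \<not> module.dependent (scl C) B \<and> module.span (scl C) B = hom C S G
    \<and> (\<forall>b\<in>B. b' b \<in> hom C G S)
    \<and> (\<forall>b\<in>B. \<forall>c\<in>B. b' b \<cdot>\<^bsub>C\<^esub> c = (if b = c then \<iota>\<^bsub>C\<^esub> S else 0))"

text \<open>\<open>tube_mor C I G X Y \<alpha>\<close> is \<open>\<alpha>\<^sub>G\<close>, where \<open>\<alpha> : G \<otimes> X \<rightarrow> Y \<otimes> G\<close>; the sum does not depend on the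
  choice of dual bases.\<close>

definition tube_mor ::
  "('k::field, 'o, 'm::ab_group_add, 'z) moncat_scheme \<Rightarrow> 'o set \<Rightarrow> 'o \<Rightarrow> 'o \<Rightarrow> 'o \<Rightarrow> 'm \<Rightarrow> 'o \<Rightarrow> 'm"
  where "tube_mor C I G X Y \<alpha> = (\<lambda>S. if S \<in> I then
    (let (B, b') = (SOME (B, b'). dual_basis C S G B b')
     in \<Sum>b\<in>B. (\<iota>\<^bsub>C\<^esub> Y \<boxtimes>\<^bsub>C\<^esub> b' b) \<cdot>\<^bsub>C\<^esub> \<alpha> \<cdot>\<^bsub>C\<^esub> (b \<boxtimes>\<^bsub>C\<^esub> \<iota>\<^bsub>C\<^esub> X)) else 0)"

text \<open>Composition \<open>g \<circ> f\<close> of \<open>f : X \<rightarrow> Y\<close> and \<open>g : Y \<rightarrow> Z\<close>, extended bilinearly from the rule for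
  \<open>\<beta>\<^sub>H \<circ> \<alpha>\<^sub>G\<close>.\<close>

definition tube_cmp ::
  "('k::field, 'o, 'm::ab_group_add, 'z) moncat_scheme \<Rightarrow> 'o set \<Rightarrow> 'o \<Rightarrow> 'o \<Rightarrow> 'o
    \<Rightarrow> ('o \<Rightarrow> 'm) \<Rightarrow> ('o \<Rightarrow> 'm) \<Rightarrow> 'o \<Rightarrow> 'm" where
  "tube_cmp C I X Y Z g f = (\<lambda>S. \<Sum>H\<in>I. \<Sum>G\<in>I. tube_mor C I (H \<otimes>\<^bsub>C\<^esub> G) X Z
     (asc C Z H G
      \<cdot>\<^bsub>C\<^esub> (g H \<boxtimes>\<^bsub>C\<^esub> \<iota>\<^bsub>C\<^esub> G)
      \<cdot>\<^bsub>C\<^esub> inv_mor C ((H \<otimes>\<^bsub>C\<^esub> Y) \<otimes>\<^bsub>C\<^esub> G) (H \<otimes>\<^bsub>C\<^esub> (Y \<otimes>\<^bsub>C\<^esub> G)) (asc C H Y G)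
      \<cdot>\<^bsub>C\<^esub> (\<iota>\<^bsub>C\<^esub> H \<boxtimes>\<^bsub>C\<^esub> f G)
      \<cdot>\<^bsub>C\<^esub> asc C H G X) S)"

definition tube_eps :: "('k::field, 'o, 'm::zero, 'z) brcat_scheme \<Rightarrow> 'o set \<Rightarrow> 'o \<Rightarrow> 'o \<Rightarrow> 'o \<Rightarrow> 'm"
  where "tube_eps C I X Y = (\<lambda>S. if S \<in> I then
    scl C (qdim C S / cat_dim C I)
      (inv_mor C ((X \<otimes>\<^bsub>C\<^esub> Y) \<otimes>\<^bsub>C\<^esub> S) (X \<otimes>\<^bsub>C\<^esub> (Y \<otimes>\<^bsub>C\<^esub> S)) (asc C X Y S)
       \<cdot>\<^bsub>C\<^esub> (\<iota>\<^bsub>C\<^esub> X \<boxtimes>\<^bsub>C\<^esub> inv_brd C Y S)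
       \<cdot>\<^bsub>C\<^esub> asc C X S Y
       \<cdot>\<^bsub>C\<^esub> (brd C S X \<boxtimes>\<^bsub>C\<^esub> \<iota>\<^bsub>C\<^esub> Y)
       \<cdot>\<^bsub>C\<^esub> inv_mor C ((S \<otimes>\<^bsub>C\<^esub> X) \<otimes>\<^bsub>C\<^esub> Y) (S \<otimes>\<^bsub>C\<^esub> (X \<otimes>\<^bsub>C\<^esub> Y)) (asc C S X Y)) else 0)"


section \<open>The functor \<open>TM\<close>\<close>

definition TM_ob :: "('k, 'p, 'n, 'z) moncat_scheme \<Rightarrow> ('o, 'm, 'p, 'n) monfun \<Rightarrow> 'o \<Rightarrow> 'n set" where
  "TM_ob D M X = hom D (fob M X) \<one>\<^bsub>D\<^esub>"

text \<open>\<open>TM(\<alpha>\<^sub>G)(\<beta>)\<close> for \<open>\<alpha> : G \<otimes> X \<rightarrow> Y \<otimes> G\<close> and \<open>\<beta> : M Y \<rightarrow> \<one>\<close>.\<close>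

definition TM_gen ::
  "('k, 'o, 'm, 'y) pivcat_scheme \<Rightarrow> ('k, 'p, 'n, 'z) moncat_scheme \<Rightarrow> ('o, 'm, 'p, 'n) monfun
    \<Rightarrow> 'o \<Rightarrow> 'o \<Rightarrow> 'o \<Rightarrow> 'm \<Rightarrow> 'n \<Rightarrow> 'n" where
  "TM_gen C D M G X Y \<alpha> \<beta> =
     inv_fun1 C D M
     \<cdot>\<^bsub>D\<^esub> fmo M (ev C G)
     \<cdot>\<^bsub>D\<^esub> fmu M (dual C G) G
     \<cdot>\<^bsub>D\<^esub> (\<iota>\<^bsub>D\<^esub> (fob M (dual C G)) \<boxtimes>\<^bsub>D\<^esub>
         (lun D (fob M G) \<cdot>\<^bsub>D\<^esub> (\<beta> \<boxtimes>\<^bsub>D\<^esub> \<iota>\<^bsub>D\<^esub> (fob M G)) \<cdot>\<^bsub>D\<^esub> inv_fmu C D M Y G))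
     \<cdot>\<^bsub>D\<^esub> inv_fmu C D M (dual C G) (Y \<otimes>\<^bsub>C\<^esub> G)
     \<cdot>\<^bsub>D\<^esub> fmo M (\<iota>\<^bsub>C\<^esub> (dual C G) \<boxtimes>\<^bsub>C\<^esub> \<alpha>)
     \<cdot>\<^bsub>D\<^esub> fmo M (asc C (dual C G) G X
         \<cdot>\<^bsub>C\<^esub> (coev' C G \<boxtimes>\<^bsub>C\<^esub> \<iota>\<^bsub>C\<^esub> X)
         \<cdot>\<^bsub>C\<^esub> inv_mor C (\<one>\<^bsub>C\<^esub> \<otimes>\<^bsub>C\<^esub> X) X (lun C X))"

text \<open>\<open>TM(f)(\<beta>)\<close> for \<open>f \<in> tube_hom C I X Y\<close>: since \<open>f = (\<Sum>S\<in>I. (f S)\<^sub>S)\<close>, \<open>TM(f)\<close> is the sum of the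
  \<open>TM((f S)\<^sub>S)\<close>.\<close>

definition TM_mor ::
  "('k, 'o, 'm, 'y) pivcat_scheme \<Rightarrow> 'o set \<Rightarrow> ('k, 'p, 'n::ab_group_add, 'z) moncat_scheme
    \<Rightarrow> ('o, 'm, 'p, 'n) monfun \<Rightarrow> 'o \<Rightarrow> 'o \<Rightarrow> ('o \<Rightarrow> 'm) \<Rightarrow> 'n \<Rightarrow> 'n" where
  "TM_mor C I D M X Y f \<beta> = (\<Sum>S\<in>I. TM_gen C D M S X Y (f S) \<beta>)"

definition TM_eps ::
  "('k::field, 'o, 'm::zero, 'y) brcat_scheme \<Rightarrow> 'o set \<Rightarrow> ('k, 'p, 'n::ab_group_add, 'z) moncat_scheme
    \<Rightarrow> ('o, 'm, 'p, 'n) monfun \<Rightarrow> 'o \<Rightarrow> 'o \<Rightarrow> 'n set" where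
  "TM_eps C I D M X Y = {\<alpha> \<in> TM_ob D M (X \<otimes>\<^bsub>C\<^esub> Y).
     TM_mor C I D M (X \<otimes>\<^bsub>C\<^esub> Y) (X \<otimes>\<^bsub>C\<^esub> Y) (tube_eps C I X Y) \<alpha> = \<alpha>}"


section \<open>Isomorphism of subspaces\<close>

definition subspaces_isomorphic ::
  "('k::field \<Rightarrow> 'v::ab_group_add \<Rightarrow> 'v) \<Rightarrow> 'v set \<Rightarrow> 'v set \<Rightarrow> bool" where
  "subspaces_isomorphic s V W \<longleftrightarrow> module.subspace s V \<and> module.subspace s W
     \<and> (\<exists>\<phi>. (\<forall>v\<in>V. \<forall>w\<in>V. \<phi> (v + w) = \<phi> v + \<phi> w) \<and> (\<forall>a. \<forall>v\<in>V. \<phi> (s a v) = s a (\<phi> v))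
          \<and> bij_betw \<phi> V W)"

end

theory Submission
  imports Defs
begin

text \<open>
  Bending \<open>\<beta> : M X \<rightarrow> M (dual Y)\<close> with the evaluation of \<open>Y\<close> gives \<open>\<gamma> : M X \<otimes> M Y \<rightarrow> \<one>\<close>. Naturality of the
  braiding turns the condition defining \<open>Hom\<^sup>\<sigma>\<close> into: \<open>\<gamma>\<close> is transparent, that is, it can be slid through
  every strand \<open>Z\<close> along the half-braiding \<open>t\<^sub>Z : Z X Y \<rightarrow> X Y Z\<close> passing over \<open>X\<close> and under \<open>Y\<close>. The
  idempotent \<open>\<epsilon>\<close> acts on \<open>\<gamma>\<close> by encircling it with \<open>\<Sum>\<^sub>S d(S) / d(C) S\<close>. A transparent \<open>\<gamma>\<close> pulls out of
  the circle and is fixed, since the circle evaluates to \<open>1\<close>. Conversely every encircled morphism is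
  transparent by a handle slide: both sides expand over \<open>S, T \<in> I\<close>, using dual bases of \<open>Hom(T, S Z)\<close> on
  one side and of \<open>Hom(dual S, Z (dual T))\<close> on the other, and evaluating a theta graph in two ways shows
  that the canonical elements agree up to the factor \<open>d(S) / d(T)\<close>.

  The diagrams are computed in strict monoidal categories. The objects are words \<open>xs\<close> in the objects of
  \<open>C\<close>, and a morphism \<open>xs \<rightarrow> ys\<close> is one between the right-bracketed products of the letters (for \<open>C\<close>) or of
  their images under \<open>M\<close> (for \<open>D\<close>), so that \<open>M\<close> becomes a strict functor that is the identity on objects.
\<close>

text \<open>The handle slide explains the weights of the circle. Cutting a circle \<open>S\<close>
  together with \<open>Z\<close> produces circles \<open>T\<close> that still carry the weight
  \<open>d(S)\<close>, while the other side starts from circles \<open>T\<close> of weight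
  \<open>d(T)\<close>. The rotated bases supply exactly the quotient \<open>d(S) / d(T)\<close>.
  This requires dividing by every single \<open>d(T)\<close>, so beyond \<open>d(C)\<close> the
  dimension of each simple object must be shown to be nonzero; semisimplicity gives this.

  The rotated bases consist of arrows out of duals of members of \<open>I\<close>, which in general
  are not the chosen representatives in \<open>I\<close>. Instead of re-indexing \<open>I\<close> by
  duality, the second expansion is verified by testing it on all arrows out of such duals.

  Scalars appear because simple objects have only scalar endomorphisms; the proof by an annihilating
  polynomial is where algebraic closedness enters.

  Coherence is not quoted as a theorem. A relation \<open>rep\<close> follows a morphism through its
  build-up, and associators, unitors and the structure maps of \<open>M\<close> are represented by
  identities.\<close>

context linear_category begin

lemma inverses_unique: "inverses C X Y f g \<Longrightarrow> inverses C X Y f h \<Longrightarrow> g = h"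
  unfolding inverses_def using cmp_assoc[of h Y X f Y g X] id_left[of h Y X] id_right[of g Y X] by simp

lemma inv_mor_inverses: "iso_mor C X Y f \<Longrightarrow> inverses C X Y f (inv_mor C X Y f)"
  unfolding iso_mor_def inv_mor_def by (metis inverses_unique theI')

lemma iso_hom: "iso_mor C X Y f \<Longrightarrow> f \<in> hom C X Y"
  unfolding iso_mor_def inverses_def by blast

lemma iso_id: "iso_mor C X X (\<iota> X)"
  unfolding iso_mor_def inverses_def using id_hom id_left by blast

lemma inverses_cmp:
  assumes "inverses C X Y f f'" "inverses C Y Z g g'"
  shows "inverses C X Z (g \<cdot> f) (f' \<cdot> g')"
proof -
  have h: "f \<in> hom C X Y" "f' \<in> hom C Y X" "g \<in> hom C Y Z" "g' \<in> hom C Z Y"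
    and e: "f' \<cdot> f = \<iota> X" "f \<cdot> f' = \<iota> Y" "g' \<cdot> g = \<iota> Y" "g \<cdot> g' = \<iota> Z"
    using assms by (auto simp: inverses_def)
  have "(f' \<cdot> g') \<cdot> (g \<cdot> f) = \<iota> X"
    using cmp_assoc[OF cmp_hom[OF h(1,3)] h(4,2)] cmp_assoc[OF h(1,3,4)] e id_left[OF h(1)] by simp
  moreover have "(g \<cdot> f) \<cdot> (f' \<cdot> g') = \<iota> Z"
    using cmp_assoc[OF cmp_hom[OF h(4,2)] h(1,3)] cmp_assoc[OF h(4,2,1)] e id_left[OF h(4)] by simp
  ultimately show ?thesis using h e by (auto simp: inverses_def cmp_hom id_left)
qed

lemma iso_cmp: "iso_mor C X Y f \<Longrightarrow> iso_mor C Y Z g \<Longrightarrow> iso_mor C X Z (g \<cdot> f)"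
  unfolding iso_mor_def using inverses_cmp by blast

lemma iso_inv: "inverses C X Y f g \<Longrightarrow> inverses C Y X g f"
  unfolding inverses_def by auto

lemma iso_cancel_right:
  assumes "iso_mor C X Y f" "g \<in> hom C Y Z" "h \<in> hom C Y Z" "g \<cdot> f = h \<cdot> f" shows "g = h"
proof -
  obtain f' where f': "inverses C X Y f f'" using assms by (auto simp: iso_mor_def)
  have "(g \<cdot> f) \<cdot> f' = (h \<cdot> f) \<cdot> f'" using assms by simp
  then show ?thesis using f' assms(2,3) cmp_assoc[of f' Y X f Y _ Z] id_right unfolding inverses_def by simp
qed

lemma iso_cancel_left:
  assumes "iso_mor C X Y f" "g \<in> hom C Z X" "h \<in> hom C Z X" "f \<cdot> g = f \<cdot> h" shows "g = h"
proof -
  obtain f' where f': "inverses C X Y f f'" using assms by (auto simp: iso_mor_def)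
  have "f' \<cdot> (f \<cdot> g) = f' \<cdot> (f \<cdot> h)" using assms by simp
  then show ?thesis using f' assms(2,3) cmp_assoc[of _ Z X f Y f' X] id_left unfolding inverses_def by simp
qed

lemma zero_hom: "0 \<in> hom C X Y" using subspace_0[OF hom_subspace] .
lemma add_hom: "f \<in> hom C X Y \<Longrightarrow> g \<in> hom C X Y \<Longrightarrow> f + g \<in> hom C X Y"
  using subspace_add[OF hom_subspace] .
lemma scl_hom: "f \<in> hom C X Y \<Longrightarrow> scl C a f \<in> hom C X Y" using subspace_scale[OF hom_subspace] .
lemma diff_hom: "f \<in> hom C X Y \<Longrightarrow> g \<in> hom C X Y \<Longrightarrow> f - g \<in> hom C X Y"
  using subspace_diff[OF hom_subspace] .
lemma sum_hom: "(\<And>i. i \<in> A \<Longrightarrow> f i \<in> hom C X Y) \<Longrightarrow> sum f A \<in> hom C X Y"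
  using subspace_sum[OF hom_subspace] by blast

lemma cmp_zero_left: "f \<in> hom C X Y \<Longrightarrow> 0 \<cdot> f = 0"
  using cmp_scl_left[OF _ zero_hom, of f X Y 0] by simp
lemma cmp_zero_right: "g \<in> hom C Y Z \<Longrightarrow> g \<cdot> 0 = 0"
  using cmp_scl_right[OF zero_hom, of g Y Z 0] by simp

lemma cmp_sum_left:
  assumes "f \<in> hom C X Y" "\<And>i. i \<in> A \<Longrightarrow> g i \<in> hom C Y Z"
  shows "sum g A \<cdot> f = (\<Sum>i\<in>A. g i \<cdot> f)"
  using assms(2)
proof (induction A rule: infinite_finite_induct)
  case (insert x F)
  then show ?case using cmp_add_left[OF assms(1), of "g x" Z "sum g F"] by (simp add: sum_hom)
qed (auto simp: cmp_zero_left[OF assms(1)])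

lemma cmp_sum_right:
  assumes "g \<in> hom C Y Z" "\<And>i. i \<in> A \<Longrightarrow> f i \<in> hom C X Y"
  shows "g \<cdot> sum f A = (\<Sum>i\<in>A. g \<cdot> f i)"
  using assms(2)
proof (induction A rule: infinite_finite_induct)
  case (insert x F)
  then show ?case using cmp_add_right[OF _ _ assms(1), of "f x" X "sum f F"] by (simp add: sum_hom)
qed (auto simp: cmp_zero_right[OF assms(1)])

end

section \<open>Whiskering and unit coherence in a monoidal category\<close>

context monoidal_category begin

lemma tmo_zero_left: "h \<in> hom C X' Y' \<Longrightarrow> 0 \<boxtimes> h = 0"
  using tmo_scl_left[OF zero_hom, of h X' Y' 0] by simp
lemma tmo_zero_right: "h \<in> hom C X' Y' \<Longrightarrow> h \<boxtimes> 0 = 0"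
  using tmo_scl_right[OF _ zero_hom, of h X' Y' 0] by simp

lemma tmo_sum_left:
  assumes "h \<in> hom C X' Y'" "\<And>i. i \<in> A \<Longrightarrow> f i \<in> hom C X Y"
  shows "sum f A \<boxtimes> h = (\<Sum>i\<in>A. f i \<boxtimes> h)"
  using assms(2)
proof (induction A rule: infinite_finite_induct)
  case (insert x F)
  then show ?case using tmo_add_left[OF _ _ assms(1), of "f x" X Y "sum f F"] by (simp add: sum_hom)
qed (auto simp: tmo_zero_left[OF assms(1)])

lemma tmo_sum_right:
  assumes "h \<in> hom C X' Y'" "\<And>i. i \<in> A \<Longrightarrow> f i \<in> hom C X Y"
  shows "h \<boxtimes> sum f A = (\<Sum>i\<in>A. h \<boxtimes> f i)"
  using assms(2)
proof (induction A rule: infinite_finite_induct)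
  case (insert x F)
  then show ?case using tmo_add_right[OF assms(1), of "f x" X Y "sum f F"] by (simp add: sum_hom)
qed (auto simp: tmo_zero_right[OF assms(1)])

lemma tmo_inverses:
  assumes "inverses C X Y f f'" "inverses C X2 Y2 g g'"
  shows "inverses C (X \<otimes> X2) (Y \<otimes> Y2) (f \<boxtimes> g) (f' \<boxtimes> g')"
  using assms unfolding inverses_def
  by (auto simp: tmo_hom tmo_id tmo_cmp[symmetric, of f X Y f' X g X2 Y2 g' X2] tmo_cmp[symmetric, of f' Y X f Y g' Y2 X2 g Y2])

lemma tmo_iso: "iso_mor C X Y f \<Longrightarrow> iso_mor C X2 Y2 g \<Longrightarrow> iso_mor C (X \<otimes> X2) (Y \<otimes> Y2) (f \<boxtimes> g)"
  unfolding iso_mor_def using tmo_inverses by blast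

lemmas asc_hom = iso_hom[OF asc_iso]
lemmas lun_hom = iso_hom[OF lun_iso]
lemmas run_hom = iso_hom[OF run_iso]
lemmas hom_rules = id_hom asc_hom lun_hom run_hom tmo_hom cmp_hom

lemma lwhisker_cmp: "f \<in> hom C X Y \<Longrightarrow> g \<in> hom C Y Z \<Longrightarrow> \<iota> W \<boxtimes> (g \<cdot> f) = (\<iota> W \<boxtimes> g) \<cdot> (\<iota> W \<boxtimes> f)"
  using tmo_cmp[OF id_hom id_hom, of f X Y g Z W] id_left[OF id_hom] by simp
lemma rwhisker_cmp: "f \<in> hom C X Y \<Longrightarrow> g \<in> hom C Y Z \<Longrightarrow> (g \<cdot> f) \<boxtimes> \<iota> W = (g \<boxtimes> \<iota> W) \<cdot> (f \<boxtimes> \<iota> W)"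
  using tmo_cmp[OF _ _ id_hom id_hom, of f X Y g Z W] id_left[OF id_hom] by simp

text \<open>Naturality of \<open>lun\<close> makes \<open>f\<close> a conjugate of
  \<open>\<iota> \<one> \<boxtimes> f\<close>. Kelly's argument yields the unit laws only in
  whiskered form, and this removes the extra factor.\<close>

lemma unit_whisker_inj:
  assumes "f \<in> hom C X Y" "g \<in> hom C X Y" "\<iota> \<one> \<boxtimes> f = \<iota> \<one> \<boxtimes> g" shows "f = g"
  using lun_natural[OF assms(1)] lun_natural[OF assms(2)] assms iso_cancel_right[OF lun_iso] by metis
lemma unit_rwhisker_inj:
  assumes "f \<in> hom C X Y" "g \<in> hom C X Y" "f \<boxtimes> \<iota> \<one> = g \<boxtimes> \<iota> \<one>" shows "f = g"
  using run_natural[OF assms(1)] run_natural[OF assms(2)] assms iso_cancel_right[OF run_iso] by metis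

text \<open>The unit coherences below are consequences of the pentagon and the triangle (Kelly).\<close>

lemma lun_tensor: "lun C (X \<otimes> Y) \<cdot> asc C \<one> X Y = lun C X \<boxtimes> \<iota> Y"
proof -
  let ?a = "asc C"
  have a1: "?a \<one> \<one> (X \<otimes> Y) \<in> hom C ((\<one> \<otimes> \<one>) \<otimes> X \<otimes> Y) (\<one> \<otimes> \<one> \<otimes> X \<otimes> Y)"
    and a2: "?a (\<one> \<otimes> \<one>) X Y \<in> hom C (((\<one> \<otimes> \<one>) \<otimes> X) \<otimes> Y) ((\<one> \<otimes> \<one>) \<otimes> X \<otimes> Y)"
    and a3: "?a \<one> \<one> X \<boxtimes> \<iota> Y \<in> hom C (((\<one> \<otimes> \<one>) \<otimes> X) \<otimes> Y) ((\<one> \<otimes> \<one> \<otimes> X) \<otimes> Y)"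
    and a4: "?a \<one> (\<one> \<otimes> X) Y \<in> hom C ((\<one> \<otimes> \<one> \<otimes> X) \<otimes> Y) (\<one> \<otimes> (\<one> \<otimes> X) \<otimes> Y)"
    and a5: "\<iota> \<one> \<boxtimes> ?a \<one> X Y \<in> hom C (\<one> \<otimes> (\<one> \<otimes> X) \<otimes> Y) (\<one> \<otimes> \<one> \<otimes> X \<otimes> Y)"
    and l1: "\<iota> \<one> \<boxtimes> lun C (X \<otimes> Y) \<in> hom C (\<one> \<otimes> \<one> \<otimes> X \<otimes> Y) (\<one> \<otimes> X \<otimes> Y)"
    and l2: "\<iota> \<one> \<boxtimes> (lun C X \<boxtimes> \<iota> Y) \<in> hom C (\<one> \<otimes> (\<one> \<otimes> X) \<otimes> Y) (\<one> \<otimes> X \<otimes> Y)"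
    by (rule hom_rules)+
  \<comment> \<open>Both composites of the pentagon for \<open>\<one>\<close>,
    \<open>\<one>\<close>, \<open>X\<close>, \<open>Y\<close> are followed by a unitor. Once the
    invertible common tail is cancelled, what remains is the claim whiskered by
    \<open>\<one>\<close> on the left.\<close>
  have b0: "(\<iota> \<one> \<boxtimes> lun C (X \<otimes> Y)) \<cdot> (?a \<one> \<one> (X \<otimes> Y) \<cdot> ?a (\<one> \<otimes> \<one>) X Y)
      = (run C \<one> \<boxtimes> (\<iota> X \<boxtimes> \<iota> Y)) \<cdot> ?a (\<one> \<otimes> \<one>) X Y"
    unfolding cmp_assoc[OF a2 a1 l1] triangle tmo_id ..
  also have "\<dots> = ?a \<one> X Y \<cdot> ((run C \<one> \<boxtimes> \<iota> X) \<boxtimes> \<iota> Y)"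
    by (rule asc_natural[symmetric]) (rule hom_rules)+
  also have "\<dots> = ?a \<one> X Y \<cdot> (((\<iota> \<one> \<boxtimes> lun C X) \<boxtimes> \<iota> Y) \<cdot> (?a \<one> \<one> X \<boxtimes> \<iota> Y))"
    unfolding triangle[symmetric] by (subst rwhisker_cmp[where Y="\<one> \<otimes> \<one> \<otimes> X" and Z="\<one> \<otimes> X"], (rule hom_rules)+) (rule refl)
  also have "\<dots> = ?a \<one> X Y \<cdot> ((\<iota> \<one> \<boxtimes> lun C X) \<boxtimes> \<iota> Y) \<cdot> (?a \<one> \<one> X \<boxtimes> \<iota> Y)"
    by (rule cmp_assoc[OF a3]) (rule hom_rules)+
  also have "?a \<one> X Y \<cdot> ((\<iota> \<one> \<boxtimes> lun C X) \<boxtimes> \<iota> Y) = (\<iota> \<one> \<boxtimes> (lun C X \<boxtimes> \<iota> Y)) \<cdot> ?a \<one> (\<one> \<otimes> X) Y"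
    by (rule asc_natural) (rule hom_rules)+
  finally have e: "(\<iota> \<one> \<boxtimes> lun C (X \<otimes> Y)) \<cdot> (?a \<one> \<one> (X \<otimes> Y) \<cdot> ?a (\<one> \<otimes> \<one>) X Y)
    = (\<iota> \<one> \<boxtimes> (lun C X \<boxtimes> \<iota> Y)) \<cdot> (?a \<one> (\<one> \<otimes> X) Y \<cdot> (?a \<one> \<one> X \<boxtimes> \<iota> Y))"
    using cmp_assoc[OF a3 a4 l2] by simp
  have "?a \<one> \<one> (X \<otimes> Y) \<cdot> ?a (\<one> \<otimes> \<one>) X Y = (\<iota> \<one> \<boxtimes> ?a \<one> X Y) \<cdot> (?a \<one> (\<one> \<otimes> X) Y \<cdot> (?a \<one> \<one> X \<boxtimes> \<iota> Y))"
    unfolding pentagon using cmp_assoc[OF a3 a4 a5] by simp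
  with e have "((\<iota> \<one> \<boxtimes> lun C (X \<otimes> Y)) \<cdot> (\<iota> \<one> \<boxtimes> ?a \<one> X Y)) \<cdot> (?a \<one> (\<one> \<otimes> X) Y \<cdot> (?a \<one> \<one> X \<boxtimes> \<iota> Y))
    = (\<iota> \<one> \<boxtimes> (lun C X \<boxtimes> \<iota> Y)) \<cdot> (?a \<one> (\<one> \<otimes> X) Y \<cdot> (?a \<one> \<one> X \<boxtimes> \<iota> Y))"
    using cmp_assoc[OF cmp_hom[OF a3 a4] a5 l1] by simp
  moreover have "iso_mor C (((\<one> \<otimes> \<one>) \<otimes> X) \<otimes> Y) (\<one> \<otimes> (\<one> \<otimes> X) \<otimes> Y) (?a \<one> (\<one> \<otimes> X) Y \<cdot> (?a \<one> \<one> X \<boxtimes> \<iota> Y))"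
    by (rule iso_cmp[OF tmo_iso[OF asc_iso iso_id] asc_iso])
  ultimately have "(\<iota> \<one> \<boxtimes> lun C (X \<otimes> Y)) \<cdot> (\<iota> \<one> \<boxtimes> ?a \<one> X Y) = \<iota> \<one> \<boxtimes> (lun C X \<boxtimes> \<iota> Y)"
    using iso_cancel_right[OF _ cmp_hom[OF a5 l1] l2] by blast
  moreover have "\<iota> \<one> \<boxtimes> (lun C (X \<otimes> Y) \<cdot> ?a \<one> X Y) = (\<iota> \<one> \<boxtimes> lun C (X \<otimes> Y)) \<cdot> (\<iota> \<one> \<boxtimes> ?a \<one> X Y)"
    by (rule lwhisker_cmp) (rule hom_rules)+
  ultimately have "\<iota> \<one> \<boxtimes> (lun C (X \<otimes> Y) \<cdot> ?a \<one> X Y) = \<iota> \<one> \<boxtimes> (lun C X \<boxtimes> \<iota> Y)" by simp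
  then show ?thesis by (rule unit_whisker_inj[rotated 2]) (rule hom_rules)+
qed


lemma run_tensor: "(\<iota> X \<boxtimes> run C Y) \<cdot> asc C X Y \<one> = run C (X \<otimes> Y)"
proof -
  let ?a = "asc C"
  have a1: "?a (X \<otimes> Y) \<one> \<one> \<in> hom C (((X \<otimes> Y) \<otimes> \<one>) \<otimes> \<one>) ((X \<otimes> Y) \<otimes> \<one> \<otimes> \<one>)"
    and a2: "?a X Y (\<one> \<otimes> \<one>) \<in> hom C ((X \<otimes> Y) \<otimes> \<one> \<otimes> \<one>) (X \<otimes> Y \<otimes> \<one> \<otimes> \<one>)"
    and a3: "?a X Y \<one> \<boxtimes> \<iota> \<one> \<in> hom C (((X \<otimes> Y) \<otimes> \<one>) \<otimes> \<one>) ((X \<otimes> Y \<otimes> \<one>) \<otimes> \<one>)"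
    and a4: "?a X (Y \<otimes> \<one>) \<one> \<in> hom C ((X \<otimes> Y \<otimes> \<one>) \<otimes> \<one>) (X \<otimes> (Y \<otimes> \<one>) \<otimes> \<one>)"
    and a5: "\<iota> X \<boxtimes> ?a Y \<one> \<one> \<in> hom C (X \<otimes> (Y \<otimes> \<one>) \<otimes> \<one>) (X \<otimes> Y \<otimes> \<one> \<otimes> \<one>)"
    and a6: "?a X Y \<one> \<in> hom C ((X \<otimes> Y) \<otimes> \<one>) (X \<otimes> Y \<otimes> \<one>)"
    and l1: "\<iota> (X \<otimes> Y) \<boxtimes> lun C \<one> \<in> hom C ((X \<otimes> Y) \<otimes> \<one> \<otimes> \<one>) ((X \<otimes> Y) \<otimes> \<one>)"
    and l2: "\<iota> X \<boxtimes> (\<iota> Y \<boxtimes> lun C \<one>) \<in> hom C (X \<otimes> Y \<otimes> \<one> \<otimes> \<one>) (X \<otimes> Y \<otimes> \<one>)"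
    and l3: "(\<iota> X \<boxtimes> run C Y) \<boxtimes> \<iota> \<one> \<in> hom C ((X \<otimes> Y \<otimes> \<one>) \<otimes> \<one>) ((X \<otimes> Y) \<otimes> \<one>)"
    by (rule hom_rules)+
  have t: "\<iota> X \<boxtimes> (run C Y \<boxtimes> \<iota> \<one>) = (\<iota> X \<boxtimes> (\<iota> Y \<boxtimes> lun C \<one>)) \<cdot> (\<iota> X \<boxtimes> ?a Y \<one> \<one>)"
    unfolding triangle[symmetric] by (rule lwhisker_cmp) (rule hom_rules)+
  \<comment> \<open>The mirror argument: the pentagon for \<open>X\<close>, \<open>Y\<close>,
    \<open>\<one>\<close>, \<open>\<one>\<close> gives the claim whiskered by \<open>\<one>\<close>
    on the right.\<close>
  have "?a X Y \<one> \<cdot> (run C (X \<otimes> Y) \<boxtimes> \<iota> \<one>) = (?a X Y \<one> \<cdot> (\<iota> (X \<otimes> Y) \<boxtimes> lun C \<one>)) \<cdot> ?a (X \<otimes> Y) \<one> \<one>"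
    unfolding triangle[symmetric] by (rule cmp_assoc[OF a1 l1 a6])
  also have "?a X Y \<one> \<cdot> (\<iota> (X \<otimes> Y) \<boxtimes> lun C \<one>) = (\<iota> X \<boxtimes> (\<iota> Y \<boxtimes> lun C \<one>)) \<cdot> ?a X Y (\<one> \<otimes> \<one>)"
    unfolding tmo_id[symmetric] by (rule asc_natural) (rule hom_rules)+
  also have "\<dots> \<cdot> ?a (X \<otimes> Y) \<one> \<one> = (\<iota> X \<boxtimes> (\<iota> Y \<boxtimes> lun C \<one>)) \<cdot> (?a X Y (\<one> \<otimes> \<one>) \<cdot> ?a (X \<otimes> Y) \<one> \<one>)"
    using cmp_assoc[OF a1 a2 l2] by simp
  also have "\<dots> = ((\<iota> X \<boxtimes> (\<iota> Y \<boxtimes> lun C \<one>)) \<cdot> (\<iota> X \<boxtimes> ?a Y \<one> \<one>)) \<cdot> (?a X (Y \<otimes> \<one>) \<one> \<cdot> (?a X Y \<one> \<boxtimes> \<iota> \<one>))"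
    unfolding pentagon using cmp_assoc[OF cmp_hom[OF a3 a4] a5 l2] cmp_assoc[OF a3 a4 a5] by simp
  also have "\<dots> = (\<iota> X \<boxtimes> (run C Y \<boxtimes> \<iota> \<one>)) \<cdot> ?a X (Y \<otimes> \<one>) \<one> \<cdot> (?a X Y \<one> \<boxtimes> \<iota> \<one>)"
    unfolding t using cmp_assoc[OF a3 a4 cmp_hom[OF a5 l2]] by simp
  also have "(\<iota> X \<boxtimes> (run C Y \<boxtimes> \<iota> \<one>)) \<cdot> ?a X (Y \<otimes> \<one>) \<one> = ?a X Y \<one> \<cdot> ((\<iota> X \<boxtimes> run C Y) \<boxtimes> \<iota> \<one>)"
    by (rule asc_natural[symmetric]) (rule hom_rules)+
  also have "\<dots> \<cdot> (?a X Y \<one> \<boxtimes> \<iota> \<one>) = ?a X Y \<one> \<cdot> (((\<iota> X \<boxtimes> run C Y) \<boxtimes> \<iota> \<one>) \<cdot> (?a X Y \<one> \<boxtimes> \<iota> \<one>))"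
    using cmp_assoc[OF a3 l3 a6] by simp
  finally have "run C (X \<otimes> Y) \<boxtimes> \<iota> \<one> = ((\<iota> X \<boxtimes> run C Y) \<boxtimes> \<iota> \<one>) \<cdot> (?a X Y \<one> \<boxtimes> \<iota> \<one>)"
    by (rule iso_cancel_left[OF asc_iso, rotated 2]) (rule hom_rules)+
  also have "\<dots> = ((\<iota> X \<boxtimes> run C Y) \<cdot> ?a X Y \<one>) \<boxtimes> \<iota> \<one>"
    by (rule rwhisker_cmp[symmetric]) (rule hom_rules)+
  finally show ?thesis by (rule unit_rwhisker_inj[symmetric, rotated 2]) (rule hom_rules)+
qed

lemma lun_one: "lun C \<one> = run C \<one>"
proof -
  have "lun C \<one> \<cdot> (\<iota> \<one> \<boxtimes> lun C \<one>) = lun C \<one> \<cdot> lun C (\<one> \<otimes> \<one>)" by (rule lun_natural) (rule hom_rules)+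
  then have "\<iota> \<one> \<boxtimes> lun C \<one> = lun C (\<one> \<otimes> \<one>)" by (rule iso_cancel_left[OF lun_iso, rotated 2]) (rule hom_rules)+
  then have "run C \<one> \<boxtimes> \<iota> \<one> = lun C \<one> \<boxtimes> \<iota> \<one>" using triangle[of \<one> \<one>] lun_tensor[of \<one> \<one>] by simp
  then show ?thesis by (rule unit_rwhisker_inj[symmetric, rotated 2]) (rule hom_rules)+
qed

end

text \<open>The three types are independent because the same projections serve arrows, whose two
  ends are words, and frames, which lead from an object to a word.\<close>

definition src :: "'a \<times> 'b \<times> 'c \<Rightarrow> 'a" where "src f = fst f"
definition mor :: "'a \<times> 'b \<times> 'c \<Rightarrow> 'b" where "mor f = fst (snd f)"
definition trg :: "'a \<times> 'b \<times> 'c \<Rightarrow> 'c" where "trg f = snd (snd f)"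

lemma triple_simps [simp]: "src (x, f, y) = x" "mor (x, f, y) = f" "trg (x, f, y) = y"
  by (simp_all add: src_def mor_def trg_def)

lemma triple_eqI: "src f = src g \<Longrightarrow> mor f = mor g \<Longrightarrow> trg f = trg g \<Longrightarrow> f = g"
  by (simp add: src_def mor_def trg_def prod_eq_iff)

section \<open>Strictification of a monoidal category\<close>

locale words = monoidal_category C
  for C :: "('k::field, 'o, 'm::ab_group_add, 'z) moncat_scheme" (structure) +
  fixes F :: "'a \<Rightarrow> 'o"
begin

text \<open>Ending every product in the unit makes concatenation uniform. The price is that a
  one-letter word stands for \<open>F x \<otimes> \<one>\<close> rather than \<open>F x\<close>; the
  frame \<open>fleaf\<close> pays it with a right unitor.\<close>

primrec ob :: "'a list \<Rightarrow> 'o" where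
  "ob [] = \<one>"
| "ob (x # xs) = F x \<otimes> ob xs"

primrec phi :: "'a list \<Rightarrow> 'a list \<Rightarrow> 'm" where
  "phi [] = (\<lambda>ys. lun C (ob ys))"
| "phi (x # xs) = (\<lambda>ys. (\<iota> (F x) \<boxtimes> phi xs ys) \<cdot> asc C (F x) (ob xs) (ob ys))"

lemma phi_iso: "iso_mor C (ob xs \<otimes> ob ys) (ob (xs @ ys)) (phi xs ys)"
proof (induction xs)
  case Nil
  show ?case using lun_iso by simp
next
  case (Cons x xs)
  have "iso_mor C ((F x \<otimes> ob xs) \<otimes> ob ys) (F x \<otimes> ob (xs @ ys))
      ((\<iota> (F x) \<boxtimes> phi xs ys) \<cdot> asc C (F x) (ob xs) (ob ys))"
    by (rule iso_cmp[OF asc_iso tmo_iso[OF iso_id Cons.IH]])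
  then show ?case by simp
qed

lemmas phi_hom = iso_hom[OF phi_iso]

lemma phi_Nil_right: "phi xs [] = run C (ob xs)"
  by (induction xs) (simp_all add: lun_one run_tensor)

text \<open>This cocycle identity is what makes the tensor product of arrows strictly associative.
  For the empty first word it is \<open>lun_tensor\<close>; each further letter costs one pentagon
  and naturality of the associator.\<close>

lemma phi_assoc: "phi (xs @ ys) zs \<cdot> (phi xs ys \<boxtimes> \<iota> (ob zs))
  = phi xs (ys @ zs) \<cdot> ((\<iota> (ob xs) \<boxtimes> phi ys zs) \<cdot> asc C (ob xs) (ob ys) (ob zs))"
proof (induction xs)
  case Nil
  have h: "\<iota> \<one> \<boxtimes> phi ys zs \<in> hom C (\<one> \<otimes> ob ys \<otimes> ob zs) (\<one> \<otimes> ob (ys @ zs))"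
    by (rule hom_rules phi_hom)+
  have "lun C (ob (ys @ zs)) \<cdot> ((\<iota> \<one> \<boxtimes> phi ys zs) \<cdot> asc C \<one> (ob ys) (ob zs))
      = (lun C (ob (ys @ zs)) \<cdot> (\<iota> \<one> \<boxtimes> phi ys zs)) \<cdot> asc C \<one> (ob ys) (ob zs)"
    by (rule cmp_assoc[OF asc_hom h lun_hom])
  also have "lun C (ob (ys @ zs)) \<cdot> (\<iota> \<one> \<boxtimes> phi ys zs) = phi ys zs \<cdot> lun C (ob ys \<otimes> ob zs)"
    by (rule lun_natural[OF phi_hom])
  also have "\<dots> \<cdot> asc C \<one> (ob ys) (ob zs) = phi ys zs \<cdot> (lun C (ob ys \<otimes> ob zs) \<cdot> asc C \<one> (ob ys) (ob zs))"
    by (rule cmp_assoc[symmetric, OF asc_hom lun_hom phi_hom])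
  finally show ?case by (simp add: lun_tensor)
next
  case (Cons x xs)
  let ?a = "asc C" and ?X = "F x" and ?A = "ob xs" and ?B = "ob ys" and ?D = "ob zs"
  let ?i = "\<iota> (F x)"
  have h1: "?a ?X ?A ?B \<boxtimes> \<iota> ?D \<in> hom C (((?X \<otimes> ?A) \<otimes> ?B) \<otimes> ?D) ((?X \<otimes> ?A \<otimes> ?B) \<otimes> ?D)"
    and h2: "(?i \<boxtimes> phi xs ys) \<boxtimes> \<iota> ?D \<in> hom C ((?X \<otimes> ?A \<otimes> ?B) \<otimes> ?D) ((?X \<otimes> ob (xs @ ys)) \<otimes> ?D)"
    and h3: "?a ?X (ob (xs @ ys)) ?D \<in> hom C ((?X \<otimes> ob (xs @ ys)) \<otimes> ?D) (?X \<otimes> ob (xs @ ys) \<otimes> ?D)"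
    by (rule hom_rules phi_hom)+
  have h4: "?i \<boxtimes> phi (xs @ ys) zs \<in> hom C (?X \<otimes> ob (xs @ ys) \<otimes> ?D) (?X \<otimes> ob (xs @ ys @ zs))"
    using tmo_hom[OF id_hom phi_hom, of "?X" "xs @ ys" zs] by simp
  have h5: "?a ?X (?A \<otimes> ?B) ?D \<in> hom C ((?X \<otimes> ?A \<otimes> ?B) \<otimes> ?D) (?X \<otimes> (?A \<otimes> ?B) \<otimes> ?D)"
    and h6: "?i \<boxtimes> (phi xs ys \<boxtimes> \<iota> ?D) \<in> hom C (?X \<otimes> (?A \<otimes> ?B) \<otimes> ?D) (?X \<otimes> ob (xs @ ys) \<otimes> ?D)"
    and h7: "?i \<boxtimes> ?a ?A ?B ?D \<in> hom C (?X \<otimes> (?A \<otimes> ?B) \<otimes> ?D) (?X \<otimes> ?A \<otimes> ?B \<otimes> ?D)"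
    and h8: "?i \<boxtimes> (\<iota> ?A \<boxtimes> phi ys zs) \<in> hom C (?X \<otimes> ?A \<otimes> ?B \<otimes> ?D) (?X \<otimes> ?A \<otimes> ob (ys @ zs))"
    and h9: "?i \<boxtimes> phi xs (ys @ zs) \<in> hom C (?X \<otimes> ?A \<otimes> ob (ys @ zs)) (?X \<otimes> ob (xs @ ys @ zs))"
    and k1: "?a ?X ?A (ob (ys @ zs)) \<in> hom C ((?X \<otimes> ?A) \<otimes> ob (ys @ zs)) (?X \<otimes> ?A \<otimes> ob (ys @ zs))"
    and k2: "\<iota> (?X \<otimes> ?A) \<boxtimes> phi ys zs \<in> hom C ((?X \<otimes> ?A) \<otimes> ?B \<otimes> ?D) ((?X \<otimes> ?A) \<otimes> ob (ys @ zs))"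
    and k3: "?a (?X \<otimes> ?A) ?B ?D \<in> hom C (((?X \<otimes> ?A) \<otimes> ?B) \<otimes> ?D) ((?X \<otimes> ?A) \<otimes> ?B \<otimes> ?D)"
    and k4: "?a ?X ?A (?B \<otimes> ?D) \<in> hom C ((?X \<otimes> ?A) \<otimes> ?B \<otimes> ?D) (?X \<otimes> ?A \<otimes> ?B \<otimes> ?D)"
    by (rule hom_rules phi_hom)+
  have ih: "(?i \<boxtimes> phi (xs @ ys) zs) \<cdot> (?i \<boxtimes> (phi xs ys \<boxtimes> \<iota> ?D))
     = (?i \<boxtimes> phi xs (ys @ zs)) \<cdot> ((?i \<boxtimes> (\<iota> ?A \<boxtimes> phi ys zs)) \<cdot> (?i \<boxtimes> ?a ?A ?B ?D))"
  proof -
    have "(?i \<boxtimes> phi (xs @ ys) zs) \<cdot> (?i \<boxtimes> (phi xs ys \<boxtimes> \<iota> ?D)) = ?i \<boxtimes> (phi (xs @ ys) zs \<cdot> (phi xs ys \<boxtimes> \<iota> ?D))"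
      by (rule lwhisker_cmp[symmetric]) (rule hom_rules phi_hom)+
    also have "\<dots> = ?i \<boxtimes> (phi xs (ys @ zs) \<cdot> ((\<iota> ?A \<boxtimes> phi ys zs) \<cdot> ?a ?A ?B ?D))" by (simp add: Cons.IH)
    also have "\<dots> = (?i \<boxtimes> phi xs (ys @ zs)) \<cdot> (?i \<boxtimes> ((\<iota> ?A \<boxtimes> phi ys zs) \<cdot> ?a ?A ?B ?D))"
      by (rule lwhisker_cmp) (rule hom_rules phi_hom)+
    also have "?i \<boxtimes> ((\<iota> ?A \<boxtimes> phi ys zs) \<cdot> ?a ?A ?B ?D) = (?i \<boxtimes> (\<iota> ?A \<boxtimes> phi ys zs)) \<cdot> (?i \<boxtimes> ?a ?A ?B ?D)"
      by (rule lwhisker_cmp) (rule hom_rules phi_hom)+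
    finally show ?thesis .
  qed
  have n1: "?a ?X (ob (xs @ ys)) ?D \<cdot> ((?i \<boxtimes> phi xs ys) \<boxtimes> \<iota> ?D) = (?i \<boxtimes> (phi xs ys \<boxtimes> \<iota> ?D)) \<cdot> ?a ?X (?A \<otimes> ?B) ?D"
    by (rule asc_natural) (rule hom_rules phi_hom)+
  have n2: "?a ?X ?A (ob (ys @ zs)) \<cdot> (\<iota> (?X \<otimes> ?A) \<boxtimes> phi ys zs) = (?i \<boxtimes> (\<iota> ?A \<boxtimes> phi ys zs)) \<cdot> ?a ?X ?A (?B \<otimes> ?D)"
    unfolding tmo_id[symmetric] by (rule asc_natural) (rule hom_rules phi_hom)+
  have "phi ((x # xs) @ ys) zs \<cdot> (phi (x # xs) ys \<boxtimes> \<iota> ?D)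
      = ((?i \<boxtimes> phi (xs @ ys) zs) \<cdot> ?a ?X (ob (xs @ ys)) ?D) \<cdot> (((?i \<boxtimes> phi xs ys) \<boxtimes> \<iota> ?D) \<cdot> (?a ?X ?A ?B \<boxtimes> \<iota> ?D))"
    using rwhisker_cmp[OF asc_hom tmo_hom[OF id_hom phi_hom], of ?X xs ys ?D] by simp
  also have "\<dots> = (?i \<boxtimes> phi (xs @ ys) zs) \<cdot> ((?a ?X (ob (xs @ ys)) ?D \<cdot> ((?i \<boxtimes> phi xs ys) \<boxtimes> \<iota> ?D)) \<cdot> (?a ?X ?A ?B \<boxtimes> \<iota> ?D))"
    using cmp_assoc[OF cmp_hom[OF h1 h2] h3 h4] cmp_assoc[OF h1 h2 h3] by simp
  also have "\<dots> = ((?i \<boxtimes> phi (xs @ ys) zs) \<cdot> (?i \<boxtimes> (phi xs ys \<boxtimes> \<iota> ?D))) \<cdot> (?a ?X (?A \<otimes> ?B) ?D \<cdot> (?a ?X ?A ?B \<boxtimes> \<iota> ?D))"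
    unfolding n1 using cmp_assoc[OF h1 h5 h6] cmp_assoc[OF cmp_hom[OF h1 h5] h6 h4] by simp
  also have "\<dots> = (?i \<boxtimes> phi xs (ys @ zs)) \<cdot> ((?i \<boxtimes> (\<iota> ?A \<boxtimes> phi ys zs)) \<cdot> ((?i \<boxtimes> ?a ?A ?B ?D) \<cdot> (?a ?X (?A \<otimes> ?B) ?D \<cdot> (?a ?X ?A ?B \<boxtimes> \<iota> ?D))))"
    unfolding ih using cmp_assoc[OF cmp_hom[OF h1 h5] cmp_hom[OF h7 h8] h9] cmp_assoc[OF cmp_hom[OF h1 h5] h7 h8] by simp
  also have "(?i \<boxtimes> ?a ?A ?B ?D) \<cdot> (?a ?X (?A \<otimes> ?B) ?D \<cdot> (?a ?X ?A ?B \<boxtimes> \<iota> ?D)) = ?a ?X ?A (?B \<otimes> ?D) \<cdot> ?a (?X \<otimes> ?A) ?B ?D"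
    using pentagon[of ?X ?A ?B ?D] cmp_assoc[OF h1 h5 h7] by simp
  also have "(?i \<boxtimes> (\<iota> ?A \<boxtimes> phi ys zs)) \<cdot> (?a ?X ?A (?B \<otimes> ?D) \<cdot> ?a (?X \<otimes> ?A) ?B ?D)
     = ?a ?X ?A (ob (ys @ zs)) \<cdot> ((\<iota> (?X \<otimes> ?A) \<boxtimes> phi ys zs) \<cdot> ?a (?X \<otimes> ?A) ?B ?D)"
    using cmp_assoc[OF k3 k4 h8] cmp_assoc[OF k3 k2 k1] n2 by simp
  also have "(?i \<boxtimes> phi xs (ys @ zs)) \<cdot> \<dots> = ((?i \<boxtimes> phi xs (ys @ zs)) \<cdot> ?a ?X ?A (ob (ys @ zs))) \<cdot> ((\<iota> (?X \<otimes> ?A) \<boxtimes> phi ys zs) \<cdot> ?a (?X \<otimes> ?A) ?B ?D)"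
    by (rule cmp_assoc[OF cmp_hom[OF k3 k2] k1 h9])
  finally show ?case by simp
qed

text \<open>Arrows between words are triples (source, morphism, target); their composition and tensor product
  \<open>sten\<close> are strictly associative and unital.\<close>

definition arr :: "'a list \<times> 'm \<times> 'a list \<Rightarrow> bool" where
  "arr f \<longleftrightarrow> mor f \<in> hom C (ob (src f)) (ob (trg f))"

definition scmp :: "'a list \<times> 'm \<times> 'a list \<Rightarrow> 'a list \<times> 'm \<times> 'a list \<Rightarrow> 'a list \<times> 'm \<times> 'a list" (infixr \<open>\<bullet>\<close> 70) where "g \<bullet> f = (src f, mor g \<cdot> mor f, trg g)"
definition sid where "sid xs = (xs, \<iota> (ob xs), xs)"
definition sten :: "'a list \<times> 'm \<times> 'a list \<Rightarrow> 'a list \<times> 'm \<times> 'a list \<Rightarrow> 'a list \<times> 'm \<times> 'a list" (infixr \<open>\<odot>\<close> 75) where "f \<odot> g = (src f @ src g,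
   phi (trg f) (trg g) \<cdot> (mor f \<boxtimes> mor g)
     \<cdot> inv_mor C (ob (src f) \<otimes> ob (src g)) (ob (src f @ src g)) (phi (src f) (src g)),
   trg f @ trg g)"
text \<open>A box with idle strands on both sides. Every diagram below is a right-nested composite
  of such layers, which serves as the normal form for \<open>simp\<close>.\<close>

definition wh where "wh xs f ys = sid xs \<odot> f \<odot> sid ys"
definition sscl :: "'k \<Rightarrow> 'a list \<times> 'm \<times> 'a list \<Rightarrow> 'a list \<times> 'm \<times> 'a list" where "sscl a f = (src f, scl C a (mor f), trg f)"
text \<open>The ends are arguments because an empty family would not determine them.\<close>

definition ssum :: "'a list \<Rightarrow> 'a list \<Rightarrow> 'i set \<Rightarrow> ('i \<Rightarrow> 'a list \<times> 'm \<times> 'a list) \<Rightarrow> 'a list \<times> 'm \<times> 'a list" where "ssum xs ys A h = (xs, \<Sum>i\<in>A. mor (h i), ys)"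

lemma src_trg [simp]:
  "src (g \<bullet> f) = src f" "trg (g \<bullet> f) = trg g" "src (sid xs) = xs" "trg (sid xs) = xs"
  "src (sten f g) = src f @ src g" "trg (sten f g) = trg f @ trg g"
  "src (wh xs f ys) = xs @ src f @ ys" "trg (wh xs f ys) = xs @ trg f @ ys"
  "src (sscl a f) = src f" "trg (sscl a f) = trg f"
  "src (ssum xs ys A h) = xs" "trg (ssum xs ys A h) = ys"
  by (simp_all add: scmp_def sid_def sten_def wh_def sscl_def ssum_def)

lemma arr_scmp [simp]: "arr f \<Longrightarrow> arr g \<Longrightarrow> trg f = src g \<Longrightarrow> arr (g \<bullet> f)"
  unfolding arr_def scmp_def using cmp_hom by simp
lemma arr_sid [simp]: "arr (sid xs)" by (simp add: arr_def sid_def id_hom)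

lemma sten_mor:
  assumes "arr f" "arr g"
  shows "mor (f \<odot> g) \<cdot> phi (src f) (src g) = phi (trg f) (trg g) \<cdot> (mor f \<boxtimes> mor g)"
    and "mor (f \<odot> g) \<in> hom C (ob (src f @ src g)) (ob (trg f @ trg g))"
proof -
  let ?i = "inv_mor C (ob (src f) \<otimes> ob (src g)) (ob (src f @ src g)) (phi (src f) (src g))"
  have i: "?i \<in> hom C (ob (src f @ src g)) (ob (src f) \<otimes> ob (src g))"
      "?i \<cdot> phi (src f) (src g) = \<iota> (ob (src f) \<otimes> ob (src g))"
    using inv_mor_inverses[OF phi_iso, of "src f" "src g"] by (simp_all add: inverses_def)
  have h: "mor f \<boxtimes> mor g \<in> hom C (ob (src f) \<otimes> ob (src g)) (ob (trg f) \<otimes> ob (trg g))"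
    using tmo_hom assms by (simp add: arr_def)
  have h2: "phi (trg f) (trg g) \<cdot> (mor f \<boxtimes> mor g) \<in> hom C (ob (src f) \<otimes> ob (src g)) (ob (trg f @ trg g))"
    by (rule cmp_hom[OF h phi_hom])
  show "mor (f \<odot> g) \<cdot> phi (src f) (src g) = phi (trg f) (trg g) \<cdot> (mor f \<boxtimes> mor g)"
    using cmp_assoc[OF phi_hom i(1) h2] i(2) id_right[OF h2] by (simp add: sten_def)
  show "mor (f \<odot> g) \<in> hom C (ob (src f @ src g)) (ob (trg f @ trg g))"
    using cmp_hom[OF i(1) h2] by (simp add: sten_def)
qed

lemma arr_sten [simp]: "arr f \<Longrightarrow> arr g \<Longrightarrow> arr (f \<odot> g)"
  using sten_mor(2) by (simp add: arr_def)

lemma arr_wh [simp]: "arr f \<Longrightarrow> arr (wh xs f ys)"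
  by (simp add: wh_def)

text \<open>Since \<open>phi\<close> is invertible, the conjugation defining the tensor product is
  equivalent to an equation without inverses. The algebraic laws of the strict tensor product are
  obtained by checking that equation.\<close>

lemma sten_unique:
  assumes "arr f" "arr g" "arr h" "src h = src f @ src g" "trg h = trg f @ trg g"
    and "mor h \<cdot> phi (src f) (src g) = phi (trg f) (trg g) \<cdot> (mor f \<boxtimes> mor g)"
  shows "f \<odot> g = h"
proof (rule triple_eqI)
  show "mor (f \<odot> g) = mor h"
    by (rule iso_cancel_right[OF phi_iso, where Z="ob (trg f @ trg g)", of _ "src f" "src g"])
      (use sten_mor[OF assms(1,2)] assms arr_def in simp_all)
qed (use assms in simp_all)

lemma scmp_assoc: "arr f \<Longrightarrow> arr g \<Longrightarrow> arr h \<Longrightarrow> trg f = src g \<Longrightarrow> trg g = src h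
   \<Longrightarrow> (h \<bullet> g) \<bullet> f = h \<bullet> g \<bullet> f"
  unfolding arr_def scmp_def by (simp add: cmp_assoc)

lemma sid_left [simp]: "arr f \<Longrightarrow> trg f = xs \<Longrightarrow> sid xs \<bullet> f = f"
  by (rule triple_eqI) (auto simp: arr_def scmp_def sid_def id_left)
lemma sid_right [simp]: "arr f \<Longrightarrow> src f = xs \<Longrightarrow> f \<bullet> sid xs = f"
  by (rule triple_eqI) (auto simp: arr_def scmp_def sid_def id_right)

lemma sten_sid: "sid xs \<odot> sid ys = sid (xs @ ys)"
  by (rule sten_unique) (simp_all add: sid_def tmo_id id_left[OF phi_hom] id_right[OF phi_hom] arr_def id_hom)

lemma sten_Nil_left: "arr f \<Longrightarrow> sid [] \<odot> f = f"
  by (rule sten_unique) (simp_all add: arr_def sid_def id_hom lun_natural)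

lemma sten_Nil_right: "arr f \<Longrightarrow> f \<odot> sid [] = f"
  by (rule sten_unique) (simp_all add: arr_def sid_def id_hom run_natural phi_Nil_right)

lemma sten_scmp:
  assumes "arr f" "arr g" "arr f'" "arr g'" "trg f = src g" "trg f' = src g'"
  shows "(g \<bullet> f) \<odot> (g' \<bullet> f') = (g \<odot> g') \<bullet> (f \<odot> f')"
proof (rule sten_unique)
  have h: "mor f \<boxtimes> mor f' \<in> hom C (ob (src f) \<otimes> ob (src f')) (ob (src g) \<otimes> ob (src g'))"
    "mor g \<boxtimes> mor g' \<in> hom C (ob (src g) \<otimes> ob (src g')) (ob (trg g) \<otimes> ob (trg g'))"
    using assms tmo_hom by (simp_all add: arr_def)
  note s = sten_mor[OF assms(1,3), unfolded assms(5,6)] sten_mor[OF assms(2,4)]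
  have "mor (g \<bullet> f) \<boxtimes> mor (g' \<bullet> f') = (mor g \<boxtimes> mor g') \<cdot> (mor f \<boxtimes> mor f')"
    using assms by (simp add: scmp_def arr_def tmo_cmp)
  moreover have "mor ((g \<odot> g') \<bullet> f \<odot> f') \<cdot> phi (src f) (src f')
     = mor (g \<odot> g') \<cdot> (mor (f \<odot> f') \<cdot> phi (src f) (src f'))"
    using cmp_assoc[OF phi_hom s(2) s(4)] by (simp add: scmp_def)
  moreover have "\<dots> = phi (trg g) (trg g') \<cdot> ((mor g \<boxtimes> mor g') \<cdot> (mor f \<boxtimes> mor f'))"
    unfolding s(1) using cmp_assoc[OF h(1) phi_hom s(4)] cmp_assoc[OF h phi_hom] s(3) by simp
  ultimately show "mor ((g \<odot> g') \<bullet> f \<odot> f') \<cdot> phi (src (g \<bullet> f)) (src (g' \<bullet> f')) =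
    phi (trg (g \<bullet> f)) (trg (g' \<bullet> f')) \<cdot> (mor (g \<bullet> f) \<boxtimes> mor (g' \<bullet> f'))" by simp
qed (use assms in simp_all)

text \<open>Both sides are compared after the isomorphism \<open>?p\<close> from the left-bracketed
  triple product. \<open>phi_assoc\<close> at source and target, with naturality of the associator
  in between, carries one side to the other.\<close>

lemma sten_assoc:
  assumes "arr f" "arr g" "arr h"
  shows "(f \<odot> g) \<odot> h = f \<odot> g \<odot> h"
proof -
  let ?X = "ob (src f)" and ?Y = "ob (src g)" and ?Z = "ob (src h)"
  let ?X' = "ob (trg f)" and ?Y' = "ob (trg g)" and ?Z' = "ob (trg h)"
  let ?p = "phi (src f @ src g) (src h) \<cdot> (phi (src f) (src g) \<boxtimes> \<iota> ?Z)"
  have f: "mor f \<in> hom C ?X ?X'" and g: "mor g \<in> hom C ?Y ?Y'" and h: "mor h \<in> hom C ?Z ?Z'"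
    using assms by (simp_all add: arr_def)
  have p: "iso_mor C ((?X \<otimes> ?Y) \<otimes> ?Z) (ob ((src f @ src g) @ src h)) ?p"
    by (rule iso_cmp[OF tmo_iso[OF phi_iso iso_id] phi_iso])
  have p1: "phi (src f) (src g) \<boxtimes> \<iota> ?Z \<in> hom C ((?X \<otimes> ?Y) \<otimes> ?Z) (ob (src f @ src g) \<otimes> ?Z)"
    and p2: "\<iota> ?X \<boxtimes> phi (src g) (src h) \<in> hom C (?X \<otimes> ?Y \<otimes> ?Z) (?X \<otimes> ob (src g @ src h))"
    by (rule hom_rules phi_hom)+
  note fg = sten_mor[OF assms(1,2)] and gh = sten_mor[OF assms(2,3)]
  note l = sten_mor[OF arr_sten[OF assms(1,2)] assms(3)] and r = sten_mor[OF assms(1) arr_sten[OF assms(2,3)]]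
  have a1: "mor (f \<odot> g) \<boxtimes> mor h \<in> hom C (ob (src f @ src g) \<otimes> ?Z) (ob (trg f @ trg g) \<otimes> ?Z')"
    by (rule tmo_hom[OF fg(2) h])
  have a2: "(mor f \<boxtimes> mor g) \<boxtimes> mor h \<in> hom C ((?X \<otimes> ?Y) \<otimes> ?Z) ((?X' \<otimes> ?Y') \<otimes> ?Z')"
    and a3: "phi (trg f) (trg g) \<boxtimes> \<iota> ?Z' \<in> hom C ((?X' \<otimes> ?Y') \<otimes> ?Z') (ob (trg f @ trg g) \<otimes> ?Z')"
    by (rule tmo_hom f g h hom_rules phi_hom)+
  have b1: "mor f \<boxtimes> mor (g \<odot> h) \<in> hom C (?X \<otimes> ob (src g @ src h)) (?X' \<otimes> ob (trg g @ trg h))"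
    by (rule tmo_hom[OF f gh(2)])
  have b2: "mor f \<boxtimes> (mor g \<boxtimes> mor h) \<in> hom C (?X \<otimes> ?Y \<otimes> ?Z) (?X' \<otimes> ?Y' \<otimes> ?Z')"
    and b3: "\<iota> ?X' \<boxtimes> phi (trg g) (trg h) \<in> hom C (?X' \<otimes> ?Y' \<otimes> ?Z') (?X' \<otimes> ob (trg g @ trg h))"
    by (rule tmo_hom f g h hom_rules phi_hom)+
  have p2': "(\<iota> ?X \<boxtimes> phi (src g) (src h)) \<cdot> asc C ?X ?Y ?Z \<in> hom C ((?X \<otimes> ?Y) \<otimes> ?Z) (?X \<otimes> ob (src g @ src h))"
    by (rule cmp_hom[OF asc_hom p2])
  have "mor ((f \<odot> g) \<odot> h) \<cdot> ?p = (mor ((f \<odot> g) \<odot> h) \<cdot> phi (src f @ src g) (src h)) \<cdot> (phi (src f) (src g) \<boxtimes> \<iota> ?Z)"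
    using cmp_assoc[OF p1 phi_hom l(2)[unfolded src_trg]] by simp
  also have "\<dots> = phi (trg f @ trg g) (trg h) \<cdot> ((mor (f \<odot> g) \<boxtimes> mor h) \<cdot> (phi (src f) (src g) \<boxtimes> \<iota> ?Z))"
    using cmp_assoc[OF p1 a1 phi_hom] l(1) by simp
  also have "(mor (f \<odot> g) \<boxtimes> mor h) \<cdot> (phi (src f) (src g) \<boxtimes> \<iota> ?Z) = (mor (f \<odot> g) \<cdot> phi (src f) (src g)) \<boxtimes> (mor h \<cdot> \<iota> ?Z)"
    by (rule tmo_cmp[symmetric, OF phi_hom fg(2) id_hom h])
  also have "\<dots> = (phi (trg f) (trg g) \<cdot> (mor f \<boxtimes> mor g)) \<boxtimes> (\<iota> ?Z' \<cdot> mor h)"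
    using fg(1) h id_left id_right by simp
  also have "\<dots> = (phi (trg f) (trg g) \<boxtimes> \<iota> ?Z') \<cdot> ((mor f \<boxtimes> mor g) \<boxtimes> mor h)"
    by (rule tmo_cmp[OF tmo_hom[OF f g] phi_hom h id_hom])
  also have "phi (trg f @ trg g) (trg h) \<cdot> \<dots> = phi (trg f) (trg g @ trg h) \<cdot> ((\<iota> ?X' \<boxtimes> phi (trg g) (trg h)) \<cdot> asc C ?X' ?Y' ?Z') \<cdot> ((mor f \<boxtimes> mor g) \<boxtimes> mor h)"
    using phi_assoc[of "trg f" "trg g" "trg h"] cmp_assoc[OF a2 a3 phi_hom] by simp
  also have "\<dots> = phi (trg f) (trg g @ trg h) \<cdot> ((\<iota> ?X' \<boxtimes> phi (trg g) (trg h)) \<cdot> (asc C ?X' ?Y' ?Z' \<cdot> ((mor f \<boxtimes> mor g) \<boxtimes> mor h)))"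
    using cmp_assoc[OF a2 cmp_hom[OF asc_hom b3] phi_hom] cmp_assoc[OF a2 asc_hom b3] by simp
  also have "asc C ?X' ?Y' ?Z' \<cdot> ((mor f \<boxtimes> mor g) \<boxtimes> mor h) = (mor f \<boxtimes> (mor g \<boxtimes> mor h)) \<cdot> asc C ?X ?Y ?Z"
    by (rule asc_natural[OF f g h])
  also have "(\<iota> ?X' \<boxtimes> phi (trg g) (trg h)) \<cdot> ((mor f \<boxtimes> (mor g \<boxtimes> mor h)) \<cdot> asc C ?X ?Y ?Z) = ((\<iota> ?X' \<boxtimes> phi (trg g) (trg h)) \<cdot> (mor f \<boxtimes> (mor g \<boxtimes> mor h))) \<cdot> asc C ?X ?Y ?Z"
    by (rule cmp_assoc[OF asc_hom b2 b3])
  also have "(\<iota> ?X' \<boxtimes> phi (trg g) (trg h)) \<cdot> (mor f \<boxtimes> (mor g \<boxtimes> mor h)) = (\<iota> ?X' \<cdot> mor f) \<boxtimes> (phi (trg g) (trg h) \<cdot> (mor g \<boxtimes> mor h))"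
    by (rule tmo_cmp[symmetric, OF f id_hom tmo_hom[OF g h] phi_hom])
  also have "\<dots> = (mor f \<cdot> \<iota> ?X) \<boxtimes> (mor (g \<odot> h) \<cdot> phi (src g) (src h))"
    using gh(1) f id_left id_right by simp
  also have "\<dots> = (mor f \<boxtimes> mor (g \<odot> h)) \<cdot> (\<iota> ?X \<boxtimes> phi (src g) (src h))"
    by (rule tmo_cmp[OF id_hom f phi_hom gh(2)])
  also have "\<dots> \<cdot> asc C ?X ?Y ?Z = (mor f \<boxtimes> mor (g \<odot> h)) \<cdot> ((\<iota> ?X \<boxtimes> phi (src g) (src h)) \<cdot> asc C ?X ?Y ?Z)"
    by (rule cmp_assoc[symmetric, OF asc_hom p2 b1])
  also have "phi (trg f) (trg g @ trg h) \<cdot> \<dots> = (mor (f \<odot> g \<odot> h) \<cdot> phi (src f) (src g @ src h)) \<cdot> ((\<iota> ?X \<boxtimes> phi (src g) (src h)) \<cdot> asc C ?X ?Y ?Z)"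
    using r(1) cmp_assoc[OF p2' b1 phi_hom] by simp
  also have "\<dots> = mor (f \<odot> g \<odot> h) \<cdot> ?p"
    unfolding phi_assoc by (rule cmp_assoc[symmetric, OF p2' phi_hom r(2)[unfolded src_trg]])
  finally have "mor ((f \<odot> g) \<odot> h) = mor (f \<odot> g \<odot> h)"
    by (rule iso_cancel_right[OF p, where Z="ob (trg f @ trg g @ trg h)", rotated 2])
      (use l(2) r(2) in simp_all)
  then show ?thesis by (intro triple_eqI) simp_all
qed

end

section \<open>Interchange and linearity of strict arrows\<close>

context words begin

abbreviation hm where "hm f xs ys \<equiv> arr f \<and> src f = xs \<and> trg f = ys"

lemma wh_sid [simp]: "wh xs (sid zs) ys = sid (xs @ zs @ ys)"
  by (simp add: wh_def sten_sid)

lemma wh_Nil [simp]: "arr f \<Longrightarrow> wh [] f [] = f"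
  by (simp add: wh_def sten_Nil_left sten_Nil_right)

lemma sten_sid_sid: "arr f \<Longrightarrow> sid xs \<odot> sid ys \<odot> f = sid (xs @ ys) \<odot> f"
  by (simp add: sten_assoc[symmetric] sten_sid)

lemma wh_wh [simp]: "arr f \<Longrightarrow> wh xs (wh xs' f ys') ys = wh (xs @ xs') f (ys' @ ys)"
  by (simp add: wh_def sten_assoc sten_sid sten_sid_sid)

lemma wh_scmp:
  assumes "arr f" "arr g" "trg f = src g"
  shows "wh xs (g \<bullet> f) ys = wh xs g ys \<bullet> wh xs f ys"
  using sten_scmp[of "sid xs" "sid xs" "f \<odot> sid ys" "g \<odot> sid ys"] sten_scmp[of f g "sid ys" "sid ys"] assms
  by (simp add: wh_def)

text \<open>Functoriality of the tensor product in each variable. Together with the rewriting rules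
  \<open>wh_scmp\<close> and \<open>scmp_assoc\<close> it replaces every isotopy that only changes
  the heights of boxes.\<close>

lemma exchange:
  assumes "arr f" "arr g"
  shows "wh xs f (ys @ trg g @ zs) \<bullet> wh (xs @ src f @ ys) g zs
    = wh (xs @ trg f @ ys) g zs \<bullet> wh xs f (ys @ src g @ zs)"
  using assms
  by (simp add: wh_def sten_sid[symmetric] sten_assoc sten_scmp[symmetric])

lemma arr_sscl [simp]: "arr f \<Longrightarrow> arr (sscl a f)"
  by (simp add: arr_def sscl_def scl_hom)

lemma mor_hom: "hm f xs ys \<Longrightarrow> mor f \<in> hom C (ob xs) (ob ys)"
  by (auto simp: arr_def)

lemma arr_ssum [simp]:
  assumes "\<And>i. i \<in> A \<Longrightarrow> hm (h i) xs ys" shows "arr (ssum xs ys A h)"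
proof -
  have "(\<Sum>i\<in>A. mor (h i)) \<in> hom C (ob xs) (ob ys)"
    by (rule sum_hom) (rule mor_hom[OF assms])
  then show ?thesis by (simp add: arr_def ssum_def)
qed

lemma ssum_cong: "(\<And>i. i \<in> A \<Longrightarrow> f i = g i) \<Longrightarrow> ssum xs ys A f = ssum xs ys A g"
  by (simp add: ssum_def)

lemma scmp_ssum:
  assumes "arr g" "\<And>i. i \<in> A \<Longrightarrow> hm (h i) xs (src g)"
  shows "g \<bullet> ssum xs (src g) A h = ssum xs (trg g) A (\<lambda>i. g \<bullet> h i)"
  using cmp_sum_right[OF assms(1)[unfolded arr_def] mor_hom[OF assms(2)]]
  by (simp add: scmp_def ssum_def)

lemma ssum_scmp:
  assumes "arr g" "\<And>i. i \<in> A \<Longrightarrow> hm (h i) (trg g) ys"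
  shows "ssum (trg g) ys A h \<bullet> g = ssum (src g) ys A (\<lambda>i. h i \<bullet> g)"
  using cmp_sum_left[OF assms(1)[unfolded arr_def] mor_hom[OF assms(2)]]
  by (simp add: scmp_def ssum_def)

lemma sten_ssum:
  assumes "arr g" "\<And>i. i \<in> A \<Longrightarrow> hm (h i) xs ys"
  shows "g \<odot> ssum xs ys A h = ssum (src g @ xs) (trg g @ ys) A (\<lambda>i. g \<odot> h i)"
proof (rule sten_unique)
  have s: "hm (g \<odot> h i) (src g @ xs) (trg g @ ys)" if "i \<in> A" for i using assms that by auto
  have "mor (ssum (src g @ xs) (trg g @ ys) A (\<lambda>i. g \<odot> h i)) \<cdot> phi (src g) xs
     = (\<Sum>i\<in>A. mor (g \<odot> h i) \<cdot> phi (src g) xs)"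
    using cmp_sum_left[OF phi_hom mor_hom[OF s]] by (simp add: ssum_def)
  also have "\<dots> = (\<Sum>i\<in>A. phi (trg g) ys \<cdot> (mor g \<boxtimes> mor (h i)))"
    using sten_mor[OF assms(1), of "h _"] assms(2) by (intro sum.cong) auto
  also have "\<dots> = phi (trg g) ys \<cdot> (\<Sum>i\<in>A. mor g \<boxtimes> mor (h i))"
    by (rule cmp_sum_right[symmetric, OF phi_hom tmo_hom[OF assms(1)[unfolded arr_def] mor_hom[OF assms(2)]]])
  also have "(\<Sum>i\<in>A. mor g \<boxtimes> mor (h i)) = mor g \<boxtimes> mor (ssum xs ys A h)"
    using tmo_sum_right[OF assms(1)[unfolded arr_def] mor_hom[OF assms(2)], of A "\<lambda>i. i"] by (simp add: ssum_def)
  finally show "mor (ssum (src g @ xs) (trg g @ ys) A (\<lambda>i. g \<odot> h i)) \<cdot> phi (src g) (src (ssum xs ys A h))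
     = phi (trg g) (trg (ssum xs ys A h)) \<cdot> (mor g \<boxtimes> mor (ssum xs ys A h))" by simp
qed (use assms in simp_all)

lemma ssum_sten:
  assumes "arr g" "\<And>i. i \<in> A \<Longrightarrow> hm (h i) xs ys"
  shows "ssum xs ys A h \<odot> g = ssum (xs @ src g) (ys @ trg g) A (\<lambda>i. h i \<odot> g)"
proof (rule sten_unique)
  have s: "hm (h i \<odot> g) (xs @ src g) (ys @ trg g)" if "i \<in> A" for i using assms that by auto
  have "mor (ssum (xs @ src g) (ys @ trg g) A (\<lambda>i. h i \<odot> g)) \<cdot> phi xs (src g)
     = (\<Sum>i\<in>A. mor (h i \<odot> g) \<cdot> phi xs (src g))"
    using cmp_sum_left[OF phi_hom mor_hom[OF s]] by (simp add: ssum_def)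
  also have "\<dots> = (\<Sum>i\<in>A. phi ys (trg g) \<cdot> (mor (h i) \<boxtimes> mor g))"
    using sten_mor[of "h _", OF _ assms(1)] assms(2) by (intro sum.cong) auto
  also have "\<dots> = phi ys (trg g) \<cdot> (\<Sum>i\<in>A. mor (h i) \<boxtimes> mor g)"
    by (rule cmp_sum_right[symmetric, OF phi_hom tmo_hom[OF mor_hom[OF assms(2)] assms(1)[unfolded arr_def]]])
  also have "(\<Sum>i\<in>A. mor (h i) \<boxtimes> mor g) = mor (ssum xs ys A h) \<boxtimes> mor g"
    using tmo_sum_left[OF assms(1)[unfolded arr_def] mor_hom[OF assms(2)], of A "\<lambda>i. i"] by (simp add: ssum_def)
  finally show "mor (ssum (xs @ src g) (ys @ trg g) A (\<lambda>i. h i \<odot> g)) \<cdot> phi (src (ssum xs ys A h)) (src g)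
     = phi (trg (ssum xs ys A h)) (trg g) \<cdot> (mor (ssum xs ys A h) \<boxtimes> mor g)" by simp
qed (use assms in simp_all)

lemma wh_ssum:
  assumes "\<And>i. i \<in> A \<Longrightarrow> hm (h i) xs ys"
  shows "wh us (ssum xs ys A h) vs = ssum (us @ xs @ vs) (us @ ys @ vs) A (\<lambda>i. wh us (h i) vs)"
  using ssum_sten[of "sid vs" A h, OF _ assms] sten_ssum[of "sid us" A "\<lambda>i. h i \<odot> sid vs" "xs @ vs" "ys @ vs"] assms
  by (simp add: wh_def)

text \<open>Linearity of a whole diagram in one of its boxes. It turns a diagram into a sum after a
  resolution of the identity has been inserted on some strands.\<close>

lemma ssum_context:
  assumes "arr l" "arr r" "src l = us @ ys @ vs" "trg r = us @ xs @ vs" "\<And>i. i \<in> A \<Longrightarrow> hm (h i) xs ys"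
  shows "l \<bullet> wh us (ssum xs ys A h) vs \<bullet> r = ssum (src r) (trg l) A (\<lambda>i. l \<bullet> wh us (h i) vs \<bullet> r)"
proof -
  have w: "hm (wh us (h i) vs) (trg r) (src l)" "hm (wh us (h i) vs \<bullet> r) (src r) (src l)" if "i \<in> A" for i
    using assms that by simp_all
  show ?thesis
    using wh_ssum[of A h xs ys us vs, OF assms(5)] ssum_scmp[OF assms(2) w(1), of A "\<lambda>i. i"] scmp_ssum[OF assms(1) w(2), of A "\<lambda>i. i"] assms(3,4)
    by simp
qed

lemma scmp_sscl: "arr f \<Longrightarrow> arr g \<Longrightarrow> trg f = src g \<Longrightarrow> g \<bullet> sscl a f = sscl a (g \<bullet> f)"
  unfolding arr_def scmp_def sscl_def by (simp add: cmp_scl_right)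
lemma sscl_scmp: "arr f \<Longrightarrow> arr g \<Longrightarrow> trg f = src g \<Longrightarrow> sscl a g \<bullet> f = sscl a (g \<bullet> f)"
  unfolding arr_def scmp_def sscl_def by (simp add: cmp_scl_left)

lemma sten_sscl:
  assumes "arr f" "arr g" shows "f \<odot> sscl a g = sscl a (f \<odot> g)" "sscl a f \<odot> g = sscl a (f \<odot> g)"
proof -
  have h: "mor f \<in> hom C (ob (src f)) (ob (trg f))" "mor g \<in> hom C (ob (src g)) (ob (trg g))"
    using assms by (simp_all add: arr_def)
  note s = sten_mor[OF assms]
  have e: "scl C a (mor (f \<odot> g)) \<cdot> phi (src f) (src g) = phi (trg f) (trg g) \<cdot> scl C a (mor f \<boxtimes> mor g)"
    using s cmp_scl_left[OF phi_hom s(2)] cmp_scl_right[OF tmo_hom[OF h] phi_hom] by simp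
  show "f \<odot> sscl a g = sscl a (f \<odot> g)"
    by (rule sten_unique) (use assms e tmo_scl_right[OF h] in \<open>simp_all add: sscl_def scl_hom arr_def s(2)\<close>)
  show "sscl a f \<odot> g = sscl a (f \<odot> g)"
    by (rule sten_unique) (use assms e tmo_scl_left[OF h] in \<open>simp_all add: sscl_def scl_hom arr_def s(2)\<close>)
qed

lemma wh_sscl: "arr f \<Longrightarrow> wh xs (sscl a f) ys = sscl a (wh xs f ys)"
  by (simp add: wh_def sten_sscl)

lemma sscl_sscl [simp]: "sscl a (sscl b f) = sscl (a * b) f" by (simp add: sscl_def)
lemma sscl_one [simp]: "sscl 1 f = f" by (rule triple_eqI) (simp_all add: sscl_def)
section \<open>Duality\<close>

text \<open>Duality is a relation between words here, so that the bending rules apply alike to the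
  chosen duals, to their pivotal mirror images and to the images of both under the functor.\<close>

definition adj where "adj xs ys \<eta> \<epsilon> \<longleftrightarrow> hm \<eta> [] (xs @ ys) \<and> hm \<epsilon> (ys @ xs) []
   \<and> wh xs \<epsilon> [] \<bullet> wh [] \<eta> xs = sid xs \<and> wh [] \<epsilon> ys \<bullet> wh ys \<eta> [] = sid ys"

text \<open>The first of four rules saying that bending a strand and bending it back changes
  nothing: the strand is at the left or right end, and starts at the source or at the target. Each
  is one exchange followed by one zigzag.\<close>

lemma lbend_lunbend:
  assumes a: "adj A B \<eta> \<epsilon>" and f: "hm f (B @ xs) ys"
  shows "wh [] \<epsilon> ys \<bullet> wh B (wh A f [] \<bullet> wh [] \<eta> xs) [] = f"
proof -
  have h: "hm \<eta> [] (A @ B)" "hm \<epsilon> (B @ A) []" and z: "wh [] \<epsilon> B \<bullet> wh B \<eta> [] = sid B"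
    using a by (auto simp: adj_def)
  have "wh [] \<epsilon> ys \<bullet> wh (B @ A) f [] \<bullet> wh B \<eta> xs = f \<bullet> wh [] \<epsilon> (B @ xs) \<bullet> wh B \<eta> xs"
    using exchange[of \<epsilon> f "[]" "[]" "[]"] h f scmp_assoc[of "wh B \<eta> xs" "wh (B @ A) f []" "wh [] \<epsilon> ys"]
      scmp_assoc[of "wh B \<eta> xs" "wh [] \<epsilon> (B @ xs)" f] by simp
  also have "wh [] \<epsilon> (B @ xs) \<bullet> wh B \<eta> xs = wh [] (wh [] \<epsilon> B \<bullet> wh B \<eta> []) xs"
    using h by (subst wh_scmp) simp_all
  finally show ?thesis using h f z by (simp add: wh_scmp)
qed

lemma lunbend_lbend:
  assumes a: "adj A B \<eta> \<epsilon>" and g: "hm g xs (A @ ys)"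
  shows "wh A (wh [] \<epsilon> ys \<bullet> wh B g []) [] \<bullet> wh [] \<eta> xs = g"
proof -
  have h: "hm \<eta> [] (A @ B)" "hm \<epsilon> (B @ A) []" and z: "wh A \<epsilon> [] \<bullet> wh [] \<eta> A = sid A"
    using a by (auto simp: adj_def)
  have "wh A \<epsilon> ys \<bullet> wh (A @ B) g [] \<bullet> wh [] \<eta> xs = wh A \<epsilon> ys \<bullet> wh [] \<eta> (A @ ys) \<bullet> g"
    using exchange[of \<eta> g "[]" "[]" "[]"] h g by simp
  also have "\<dots> = wh [] (wh A \<epsilon> [] \<bullet> wh [] \<eta> A) ys \<bullet> g"
    using h g by (subst wh_scmp) (simp_all add: scmp_assoc)
  finally show ?thesis using h g z by (simp add: wh_scmp scmp_assoc)
qed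

lemma rbend_runbend:
  assumes a: "adj A B \<eta> \<epsilon>" and f: "hm f (xs @ A) ys"
  shows "wh ys \<epsilon> [] \<bullet> wh [] (wh [] f B \<bullet> wh xs \<eta> []) A = f"
proof -
  have h: "hm \<eta> [] (A @ B)" "hm \<epsilon> (B @ A) []" and z: "wh A \<epsilon> [] \<bullet> wh [] \<eta> A = sid A"
    using a by (auto simp: adj_def)
  have "wh ys \<epsilon> [] \<bullet> wh [] f (B @ A) \<bullet> wh xs \<eta> A = f \<bullet> wh (xs @ A) \<epsilon> [] \<bullet> wh xs \<eta> A"
    using exchange[of f \<epsilon> "[]" "[]" "[]"] h f scmp_assoc[of "wh xs \<eta> A" "wh [] f (B @ A)" "wh ys \<epsilon> []"]
      scmp_assoc[of "wh xs \<eta> A" "wh (xs @ A) \<epsilon> []" f] by simp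
  also have "wh (xs @ A) \<epsilon> [] \<bullet> wh xs \<eta> A = wh xs (wh A \<epsilon> [] \<bullet> wh [] \<eta> A) []"
    using h by (subst wh_scmp) simp_all
  finally show ?thesis using h f z by (simp add: wh_scmp)
qed

lemma runbend_rbend:
  assumes a: "adj A B \<eta> \<epsilon>" and g: "hm g xs (ys @ B)"
  shows "wh [] (wh ys \<epsilon> [] \<bullet> wh [] g A) B \<bullet> wh xs \<eta> [] = g"
proof -
  have h: "hm \<eta> [] (A @ B)" "hm \<epsilon> (B @ A) []" and z: "wh [] \<epsilon> B \<bullet> wh B \<eta> [] = sid B"
    using a by (auto simp: adj_def)
  have "wh ys \<epsilon> B \<bullet> wh [] g (A @ B) \<bullet> wh xs \<eta> [] = wh ys \<epsilon> B \<bullet> wh (ys @ B) \<eta> [] \<bullet> g"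
    using exchange[of g \<eta> "[]" "[]" "[]"] h g by simp
  also have "\<dots> = wh ys (wh [] \<epsilon> B \<bullet> wh B \<eta> []) [] \<bullet> g"
    using h g by (subst wh_scmp) (simp_all add: scmp_assoc)
  finally show ?thesis using h g z by (simp add: wh_scmp scmp_assoc)
qed

section \<open>Strictification of morphisms\<close>

text \<open>A frame \<open>(A, a, xs)\<close> presents the object \<open>A\<close> as the word \<open>xs\<close> through \<open>a : A \<rightarrow> ob xs\<close>;
  \<open>rep v w f g\<close> says that the strict arrow \<open>g\<close> is \<open>f\<close> seen through the frames \<open>v\<close> and \<open>w\<close>.\<close>

definition frame :: "'o \<times> 'm \<times> 'a list \<Rightarrow> bool" where
  "frame v \<longleftrightarrow> iso_mor C (src v) (ob (trg v)) (mor v)"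

definition rep :: "'o \<times> 'm \<times> 'a list \<Rightarrow> 'o \<times> 'm \<times> 'a list \<Rightarrow> 'm \<Rightarrow> 'a list \<times> 'm \<times> 'a list \<Rightarrow> bool" where
  "rep v w f g \<longleftrightarrow> frame v \<and> frame w \<and> f \<in> hom C (src v) (src w) \<and> hm g (trg v) (trg w)
     \<and> mor g \<cdot> mor v = mor w \<cdot> f"

definition fleaf where "fleaf x = (F x, inv_mor C (F x \<otimes> \<one>) (F x) (run C (F x)), [x])"
definition funit :: "'o \<times> 'm \<times> 'a list" where "funit = (\<one>, \<iota> \<one>, [])"
definition fnode :: "'o \<times> 'm \<times> 'a list \<Rightarrow> 'o \<times> 'm \<times> 'a list \<Rightarrow> 'o \<times> 'm \<times> 'a list" where
  "fnode v w = (src v \<otimes> src w, phi (trg v) (trg w) \<cdot> (mor v \<boxtimes> mor w), trg v @ trg w)"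

lemma frame_fst_trg [simp]:
  "src (fleaf x) = F x" "src funit = \<one>" "src (fnode v w) = src v \<otimes> src w"
  "trg (fleaf x) = [x]" "trg funit = []" "trg (fnode v w) = trg v @ trg w"
  by (simp_all add: fleaf_def funit_def fnode_def)

lemma frame_fleaf [simp]: "frame (fleaf x)"
  using iso_inv[OF inv_mor_inverses[OF run_iso]] by (auto simp: frame_def fleaf_def iso_mor_def)
lemma frame_funit [simp]: "frame funit"
  by (simp add: frame_def funit_def iso_id)
lemma frame_fnode [simp]: "frame v \<Longrightarrow> frame w \<Longrightarrow> frame (fnode v w)"
  by (simp add: frame_def fnode_def iso_cmp[OF tmo_iso phi_iso])
lemma rep_hom: "rep v w f g \<Longrightarrow> f \<in> hom C (src v) (src w)" by (simp add: rep_def)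
lemma rep_hm: "rep v w f g \<Longrightarrow> hm g (trg v) (trg w)" by (simp add: rep_def)

text \<open>Separates finding the strict arrow from simplifying it: resolution with the
  \<open>rep\<close> rules builds some \<open>g'\<close> along the syntax of \<open>f\<close>, and a
  final \<open>simp\<close> identifies it with the intended \<open>g\<close>.\<close>

lemma rep_eq: "rep v w f g' \<Longrightarrow> g' = g \<Longrightarrow> rep v w f g" by simp

text \<open>With \<open>rep_inj\<close> this makes the dictionary faithful in both directions, as
  frame maps are isomorphisms: equations can be proved on either side and transferred.\<close>

lemma rep_unique: assumes "rep v w f g" "rep v w f g'" shows "g = g'"
proof (rule triple_eqI)
  show "mor g = mor g'"
    by (rule iso_cancel_right[where f="mor v" and X="src v" and Y="ob (trg v)" and Z="ob (trg w)"])
      (use assms in \<open>auto simp: rep_def frame_def arr_def\<close>)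
qed (use assms in \<open>auto simp: rep_def\<close>)

lemma rep_inj: "rep v w f g \<Longrightarrow> rep v w f' g \<Longrightarrow> f = f'"
  using iso_cancel_left[of "src w" "ob (trg w)" "mor w" f "src v" f'] by (auto simp: rep_def frame_def)

lemma rep_ex: assumes "frame v" "frame w" "f \<in> hom C (src v) (src w)" shows "\<exists>g. rep v w f g"
proof -
  obtain v' where v': "inverses C (src v) (ob (trg v)) (mor v) v'" using assms by (auto simp: frame_def iso_mor_def)
  have w: "mor w \<in> hom C (src w) (ob (trg w))" using assms iso_hom by (auto simp: frame_def)
  have h: "v' \<in> hom C (ob (trg v)) (src v)" "mor v \<in> hom C (src v) (ob (trg v))" "v' \<cdot> mor v = \<iota> (src v)"
    using v' by (auto simp: inverses_def)
  have wf: "mor w \<cdot> f \<in> hom C (src v) (ob (trg w))" by (rule cmp_hom[OF assms(3) w])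
  have "rep v w f (trg v, (mor w \<cdot> f) \<cdot> v', trg w)"
    using assms cmp_hom[OF h(1) wf] cmp_assoc[OF h(2,1) wf] h(3) id_right[OF wf] by (simp add: rep_def arr_def)
  then show ?thesis by blast
qed

lemma rep_ex': assumes "frame v" "frame w" "hm g (trg v) (trg w)" shows "\<exists>f. rep v w f g"
proof -
  obtain w' where w': "inverses C (src w) (ob (trg w)) (mor w) w'" using assms by (auto simp: frame_def iso_mor_def)
  have v: "mor v \<in> hom C (src v) (ob (trg v))" using assms iso_hom by (auto simp: frame_def)
  have h: "w' \<in> hom C (ob (trg w)) (src w)" "mor w \<in> hom C (src w) (ob (trg w))" "mor w \<cdot> w' = \<iota> (ob (trg w))"
    using w' by (auto simp: inverses_def)
  have gv: "mor g \<cdot> mor v \<in> hom C (src v) (ob (trg w))" using assms(3) v by (auto simp: arr_def intro!: cmp_hom)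
  have "rep v w (w' \<cdot> (mor g \<cdot> mor v)) g"
    using assms cmp_hom[OF gv h(1)] cmp_assoc[OF gv h(1,2)] h(3) id_left[OF gv] by (simp add: rep_def)
  then show ?thesis by blast
qed

lemma rep_id: "frame v \<Longrightarrow> X = src v \<Longrightarrow> rep v v (\<iota> X) (sid (trg v))"
  using id_left[OF iso_hom] id_right[OF iso_hom] by (simp add: rep_def frame_def sid_def arr_def id_hom)

lemma rep_cmp: assumes "rep u v f g" "rep v w f' g'" shows "rep u w (f' \<cdot> f) (g' \<bullet> g)"
proof -
  have h: "f \<in> hom C (src u) (src v)" "f' \<in> hom C (src v) (src w)" "mor g \<in> hom C (ob (trg u)) (ob (trg v))"
    "mor g' \<in> hom C (ob (trg v)) (ob (trg w))" "mor u \<in> hom C (src u) (ob (trg u))"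
    "mor v \<in> hom C (src v) (ob (trg v))" "mor w \<in> hom C (src w) (ob (trg w))"
    using assms iso_hom by (auto simp: rep_def frame_def arr_def)
  have "(mor g' \<cdot> mor g) \<cdot> mor u = mor w \<cdot> (f' \<cdot> f)"
    using cmp_assoc[OF h(5,3,4)] cmp_assoc[OF h(1,6,4)] cmp_assoc[OF h(1,2,7)] assms by (auto simp: rep_def)
  then show ?thesis using assms h cmp_hom[OF h(1,2)] by (auto simp: rep_def scmp_def arr_def cmp_hom[OF h(3,4)])
qed

lemma rep_ten: assumes "rep v w f g" "rep v' w' f' g'"
  shows "rep (fnode v v') (fnode w w') (f \<boxtimes> f') (g \<odot> g')"
proof -
  have h: "f \<in> hom C (src v) (src w)" "f' \<in> hom C (src v') (src w')" "mor g \<in> hom C (ob (trg v)) (ob (trg w))"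
    "mor g' \<in> hom C (ob (trg v')) (ob (trg w'))" "mor v \<in> hom C (src v) (ob (trg v))"
    "mor v' \<in> hom C (src v') (ob (trg v'))" "mor w \<in> hom C (src w) (ob (trg w))" "mor w' \<in> hom C (src w') (ob (trg w'))"
    and e: "mor g \<cdot> mor v = mor w \<cdot> f" "mor g' \<cdot> mor v' = mor w' \<cdot> f'"
    and g: "hm g (trg v) (trg w)" "hm g' (trg v') (trg w')"
    using assms iso_hom by (auto simp: rep_def frame_def arr_def)
  note s = sten_mor[of g g']
  have "mor (g \<odot> g') \<cdot> (phi (trg v) (trg v') \<cdot> (mor v \<boxtimes> mor v')) = (phi (trg w) (trg w') \<cdot> (mor g \<boxtimes> mor g')) \<cdot> (mor v \<boxtimes> mor v')"
    using cmp_assoc[OF tmo_hom[OF h(5,6)] phi_hom, of "mor (g \<odot> g')"] s g by simp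
  also have "\<dots> = phi (trg w) (trg w') \<cdot> ((mor g \<cdot> mor v) \<boxtimes> (mor g' \<cdot> mor v'))"
    using cmp_assoc[OF tmo_hom[OF h(5,6)] tmo_hom[OF h(3,4)] phi_hom] tmo_cmp[OF h(5,3,6,4)] by simp
  also have "\<dots> = (phi (trg w) (trg w') \<cdot> (mor w \<boxtimes> mor w')) \<cdot> (f \<boxtimes> f')"
    unfolding e using cmp_assoc[OF tmo_hom[OF h(1,2)] tmo_hom[OF h(7,8)] phi_hom] tmo_cmp[OF h(1,7,2,8)] by simp
  finally have "mor (g \<odot> g') \<cdot> mor (fnode v v') = mor (fnode w w') \<cdot> (f \<boxtimes> f')" by (simp add: fnode_def)
  then show ?thesis using assms g tmo_hom[OF h(1,2)] unfolding rep_def by simp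
qed

lemma rep_inv:
  assumes "rep v w f g" "inverses C (src v) (src w) f f'" "rep w v f' g'"
  shows "g' \<bullet> g = sid (trg v)" "g \<bullet> g' = sid (trg w)"
  using rep_unique[OF rep_cmp[OF assms(1,3)]] rep_unique[OF rep_cmp[OF assms(3,1)]] rep_id[of v "src v"] rep_id[of w "src w"] assms
  by (auto simp: inverses_def rep_def)

lemma rep_inv_sid:
  assumes "rep v w f (sid (trg v))" "iso_mor C X Y f" "X = src v" "Y = src w"
  shows "rep w v (inv_mor C X Y f) (sid (trg w))"
proof -
  have i: "inverses C (src v) (src w) f (inv_mor C X Y f)" using inv_mor_inverses assms by simp
  then obtain g' where g': "rep w v (inv_mor C X Y f) g'"
    using rep_ex[of w v "inv_mor C X Y f"] assms(1) by (fastforce simp: rep_def inverses_def)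
  have "g' = sid (trg w)"
    using rep_inv[OF assms(1) i g'] assms(1) rep_hm[OF g'] by (auto simp: rep_def)
  then show ?thesis using g' by simp
qed

text \<open>The purpose of frames: rebracketing changes the frame but not the word, so the
  associator is represented by an identity arrow. By \<open>phi_assoc\<close> the two frame maps
  differ exactly by the associator.\<close>

lemma rep_asc:
  assumes "frame u" "frame v" "frame w" "X = src u" "Y = src v" "Z = src w"
  shows "rep (fnode (fnode u v) w) (fnode u (fnode v w)) (asc C X Y Z) (sid (trg u @ trg v @ trg w))"
proof -
  have h: "mor u \<in> hom C (src u) (ob (trg u))" "mor v \<in> hom C (src v) (ob (trg v))" "mor w \<in> hom C (src w) (ob (trg w))"
    using assms iso_hom by (auto simp: frame_def)
  let ?U = "ob (trg u)" and ?V = "ob (trg v)" and ?W = "ob (trg w)"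
  have a2: "(mor u \<boxtimes> mor v) \<boxtimes> mor w \<in> hom C ((src u \<otimes> src v) \<otimes> src w) ((?U \<otimes> ?V) \<otimes> ?W)"
    and a3: "phi (trg u) (trg v) \<boxtimes> \<iota> ?W \<in> hom C ((?U \<otimes> ?V) \<otimes> ?W) (ob (trg u @ trg v) \<otimes> ?W)"
    and b2: "mor u \<boxtimes> (mor v \<boxtimes> mor w) \<in> hom C (src u \<otimes> src v \<otimes> src w) (?U \<otimes> ?V \<otimes> ?W)"
    and b3: "\<iota> ?U \<boxtimes> phi (trg v) (trg w) \<in> hom C (?U \<otimes> ?V \<otimes> ?W) (?U \<otimes> ob (trg v @ trg w))"
    by (rule tmo_hom h hom_rules phi_hom)+
  have c: "mor (fnode (fnode u v) w) \<in> hom C ((src u \<otimes> src v) \<otimes> src w) (ob ((trg u @ trg v) @ trg w))"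
    unfolding fnode_def triple_simps by (rule hom_rules phi_hom h)+
  have "mor (fnode (fnode u v) w) = phi (trg u @ trg v) (trg w) \<cdot> ((phi (trg u) (trg v) \<cdot> (mor u \<boxtimes> mor v)) \<boxtimes> (\<iota> ?W \<cdot> mor w))"
    using id_left[OF h(3)] by (simp add: fnode_def)
  also have "\<dots> = phi (trg u @ trg v) (trg w) \<cdot> ((phi (trg u) (trg v) \<boxtimes> \<iota> ?W) \<cdot> ((mor u \<boxtimes> mor v) \<boxtimes> mor w))"
    using tmo_cmp[OF tmo_hom[OF h(1,2)] phi_hom h(3) id_hom] by simp
  also have "\<dots> = (phi (trg u) (trg v @ trg w) \<cdot> ((\<iota> ?U \<boxtimes> phi (trg v) (trg w)) \<cdot> asc C ?U ?V ?W)) \<cdot> ((mor u \<boxtimes> mor v) \<boxtimes> mor w)"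
    using cmp_assoc[OF a2 a3 phi_hom] phi_assoc[of "trg u" "trg v" "trg w"] by simp
  also have "\<dots> = phi (trg u) (trg v @ trg w) \<cdot> ((\<iota> ?U \<boxtimes> phi (trg v) (trg w)) \<cdot> (asc C ?U ?V ?W \<cdot> ((mor u \<boxtimes> mor v) \<boxtimes> mor w)))"
    using cmp_assoc[OF a2 cmp_hom[OF asc_hom b3] phi_hom] cmp_assoc[OF a2 asc_hom b3] by simp
  also have "asc C ?U ?V ?W \<cdot> ((mor u \<boxtimes> mor v) \<boxtimes> mor w) = (mor u \<boxtimes> (mor v \<boxtimes> mor w)) \<cdot> asc C (src u) (src v) (src w)"
    by (rule asc_natural[OF h])
  also have "phi (trg u) (trg v @ trg w) \<cdot> ((\<iota> ?U \<boxtimes> phi (trg v) (trg w)) \<cdot> \<dots>)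
     = (phi (trg u) (trg v @ trg w) \<cdot> ((\<iota> ?U \<boxtimes> phi (trg v) (trg w)) \<cdot> (mor u \<boxtimes> (mor v \<boxtimes> mor w)))) \<cdot> asc C (src u) (src v) (src w)"
    using cmp_assoc[OF asc_hom b2 b3] cmp_assoc[OF asc_hom cmp_hom[OF b2 b3] phi_hom] by simp
  also have "(\<iota> ?U \<boxtimes> phi (trg v) (trg w)) \<cdot> (mor u \<boxtimes> (mor v \<boxtimes> mor w)) = mor u \<boxtimes> (phi (trg v) (trg w) \<cdot> (mor v \<boxtimes> mor w))"
    using tmo_cmp[OF h(1) id_hom tmo_hom[OF h(2,3)] phi_hom] id_left[OF h(1)] by simp
  finally have "mor (fnode (fnode u v) w) = mor (fnode u (fnode v w)) \<cdot> asc C X Y Z"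
    using assms by (simp add: fnode_def)
  then show ?thesis using assms asc_hom id_left[OF c] by (simp add: rep_def sid_def arr_def id_hom)
qed

lemma rep_lun: assumes "frame v" "X = src v" shows "rep (fnode funit v) v (lun C X) (sid (trg v))"
proof -
  have h: "mor v \<in> hom C (src v) (ob (trg v))" using assms iso_hom by (auto simp: frame_def)
  have "\<iota> (ob (trg v)) \<cdot> (lun C (ob (trg v)) \<cdot> (\<iota> \<one> \<boxtimes> mor v)) = mor v \<cdot> lun C (src v)"
    using lun_natural[OF h] id_left[OF cmp_hom[OF tmo_hom[OF id_hom h] lun_hom]] by simp
  moreover have "mor (fnode funit v) = lun C (ob (trg v)) \<cdot> (\<iota> \<one> \<boxtimes> mor v)"
    by (simp add: fnode_def funit_def phi_Nil_right)
  ultimately show ?thesis using assms lun_hom frame_fnode[of funit v] by (simp add: rep_def sid_def arr_def id_hom)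
qed

lemma rep_run: assumes "frame v" "X = src v" shows "rep (fnode v funit) v (run C X) (sid (trg v))"
proof -
  have h: "mor v \<in> hom C (src v) (ob (trg v))" using assms iso_hom by (auto simp: frame_def)
  have "\<iota> (ob (trg v)) \<cdot> (run C (ob (trg v)) \<cdot> (mor v \<boxtimes> \<iota> \<one>)) = mor v \<cdot> run C (src v)"
    using run_natural[OF h] id_left[OF cmp_hom[OF tmo_hom[OF h id_hom] run_hom]] by simp
  moreover have "mor (fnode v funit) = run C (ob (trg v)) \<cdot> (mor v \<boxtimes> \<iota> \<one>)"
    by (simp add: fnode_def funit_def phi_Nil_right)
  ultimately show ?thesis using assms run_hom frame_fnode[of v funit] by (simp add: rep_def sid_def arr_def id_hom)
qed

lemma rep_inv_asc:
  assumes "frame u" "frame v" "frame w" "X = src u" "Y = src v" "Z = src w" "P = (X \<otimes> Y) \<otimes> Z" "Q = X \<otimes> Y \<otimes> Z"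
  shows "rep (fnode u (fnode v w)) (fnode (fnode u v) w) (inv_mor C P Q (asc C X Y Z)) (sid (trg u @ trg v @ trg w))"
  using rep_inv_sid[of "fnode (fnode u v) w" "fnode u (fnode v w)", OF _ asc_iso] rep_asc[OF assms(1-6)] assms by simp

lemma rep_inv_lun: assumes "frame v" "X = src v" "P = \<one> \<otimes> X" shows "rep v (fnode funit v) (inv_mor C P X (lun C X)) (sid (trg v))"
  using rep_inv_sid[of "fnode funit v" v, OF _ lun_iso] rep_lun[OF assms(1,2)] assms by simp

lemma rep_inv_run: assumes "frame v" "X = src v" "P = X \<otimes> \<one>" shows "rep v (fnode v funit) (inv_mor C P X (run C X)) (sid (trg v))"
  using rep_inv_sid[of "fnode v funit" v, OF _ run_iso] rep_run[OF assms(1,2)] assms by simp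

lemma rep_scl: assumes "rep v w f g" shows "rep v w (scl C a f) (sscl a g)"
proof -
  have h: "f \<in> hom C (src v) (src w)" "mor g \<in> hom C (ob (trg v)) (ob (trg w))"
    "mor v \<in> hom C (src v) (ob (trg v))" "mor w \<in> hom C (src w) (ob (trg w))"
    using assms iso_hom by (auto simp: rep_def frame_def arr_def)
  show ?thesis using assms cmp_scl_left[OF h(3,2)] cmp_scl_right[OF h(1,4)] scl_hom[OF h(1)]
    by (auto simp: rep_def sscl_def arr_def scl_hom)
qed

lemma rep_sum: assumes "frame v" "frame w" "\<And>i. i \<in> A \<Longrightarrow> rep v w (f i) (g i)" "xs = trg v" "ys = trg w"
  shows "rep v w (\<Sum>i\<in>A. f i) (ssum xs ys A g)"
proof -
  have h: "f i \<in> hom C (src v) (src w)" "mor (g i) \<in> hom C (ob (trg v)) (ob (trg w))" if "i \<in> A" for i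
    using assms(3)[OF that] by (auto simp: rep_def arr_def)
  have v: "mor v \<in> hom C (src v) (ob (trg v))" "mor w \<in> hom C (src w) (ob (trg w))"
    using assms iso_hom by (auto simp: frame_def)
  have "(\<Sum>i\<in>A. mor (g i)) \<cdot> mor v = mor w \<cdot> (\<Sum>i\<in>A. f i)"
  proof -
    have "(\<Sum>i\<in>A. mor (g i)) \<cdot> mor v = (\<Sum>i\<in>A. mor (g i) \<cdot> mor v)"
      by (rule cmp_sum_left[OF v(1)]) (rule h(2))
    also have "\<dots> = (\<Sum>i\<in>A. mor w \<cdot> f i)" using assms(3) by (simp add: rep_def)
    also have "\<dots> = mor w \<cdot> (\<Sum>i\<in>A. f i)" by (rule cmp_sum_right[symmetric, OF v(2)]) (rule h(1))
    finally show ?thesis .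
  qed
  moreover have "(\<Sum>i\<in>A. f i) \<in> hom C (src v) (src w)" by (rule sum_hom) (rule h(1))
  moreover have "(\<Sum>i\<in>A. mor (g i)) \<in> hom C (ob (trg v)) (ob (trg w))" by (rule sum_hom) (rule h(2))
  ultimately show ?thesis using assms by (simp add: rep_def ssum_def arr_def)
qed

end

section \<open>Simple objects\<close>

context abelian_category begin

text \<open>Schur's lemma. The kernel of \<open>f\<close> is a subobject of the simple
  \<open>S\<close>. If it is all of \<open>S\<close>, then \<open>f\<close> vanishes; if it is zero,
  then \<open>f\<close> is a monomorphism into the simple \<open>T\<close>, hence
  invertible.\<close>

lemma iso_simple_mor:
  assumes S: "simple_object C S" and T: "simple_object C T" and f: "f \<in> hom C S T" "f \<noteq> 0"
  shows "iso_mor C S T f"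
proof -
  obtain W k where k: "is_kernel C W k S T f" using kernels[OF f(1)] by blast
  have kh: "k \<in> hom C W S" "f \<cdot> k = 0"
    and ku: "\<And>V g. g \<in> hom C V S \<Longrightarrow> f \<cdot> g = 0 \<Longrightarrow> \<exists>!u. u \<in> hom C V W \<and> k \<cdot> u = g"
    using k by (auto simp: is_kernel_def)
  have "mono_mor C W S k"
    unfolding mono_mor_def
  proof (intro conjI allI ballI impI kh(1))
    fix V g h assume gh: "g \<in> hom C V W" "h \<in> hom C V W" "k \<cdot> g = k \<cdot> h"
    have "f \<cdot> (k \<cdot> g) = 0" using cmp_assoc[OF gh(1) kh(1) f(1)] kh(2) cmp_zero_left[OF gh(1)] by simp
    then show "g = h" using ku[OF cmp_hom[OF gh(1) kh(1)]] gh by metis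
  qed
  then consider "\<iota> W = 0" | "iso_mor C W S k" using S by (auto simp: simple_object_def)
  then show ?thesis
  proof cases
    case 1
    then have k0: "k = 0" using id_right[OF kh(1)] cmp_zero_right[OF kh(1)] by simp
    have "mono_mor C S T f"
      unfolding mono_mor_def
    proof (intro conjI allI ballI impI f(1))
      fix V g h assume gh: "g \<in> hom C V S" "h \<in> hom C V S" "f \<cdot> g = f \<cdot> h"
      have "f \<cdot> ((g - h) + h) = f \<cdot> (g - h) + f \<cdot> h"
        by (rule cmp_add_right[OF diff_hom[OF gh(1,2)] gh(2) f(1)])
      then have "f \<cdot> (g - h) = 0" using gh(3) by simp
      then obtain u where u: "u \<in> hom C V W" "k \<cdot> u = g - h" using ku[OF diff_hom[OF gh(1,2)]] by blast
      then show "g = h" using k0 cmp_zero_left[OF u(1)] by simp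
    qed
    moreover have "\<iota> S \<noteq> 0" using S by (simp add: simple_object_def)
    ultimately show ?thesis using T by (auto simp: simple_object_def)
  next
    case 2
    have "f \<cdot> k = 0 \<cdot> k" using kh cmp_zero_left[OF kh(1)] by simp
    then show ?thesis using iso_cancel_right[OF 2 f(1) zero_hom] f(2) by blast
  qed
qed

end

section \<open>Endomorphisms of simple objects are scalars\<close>

context premodular_category begin

text \<open>Evaluation of a polynomial at the endomorphism \<open>f\<close> by Horner's rule, with
  \<open>\<iota> S\<close> in the place of 1.\<close>

definition pev :: "'m \<Rightarrow> 'o \<Rightarrow> 'k poly \<Rightarrow> 'm" where
  "pev f S p = fold_coeffs (\<lambda>a m. scl C a (\<iota> S) + f \<cdot> m) p 0"

context
  fixes f S assumes f: "f \<in> hom C S S"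
begin

lemma pev_0 [simp]: "pev f S 0 = 0" by (simp add: pev_def)

lemma pev_pCons [simp]: "pev f S (pCons a p) = scl C a (\<iota> S) + f \<cdot> pev f S p"
  using cmp_zero_right[OF f] by (cases "p = 0 \<and> a = 0") (auto simp: pev_def)

lemma pev_hom: "pev f S p \<in> hom C S S"
  by (induction p) (auto intro!: zero_hom add_hom scl_hom id_hom cmp_hom[OF _ f])

lemma pev_smult: "pev f S (smult c p) = scl C c (pev f S p)"
  by (induction p) (simp_all add: scale_right_distrib cmp_scl_right[OF pev_hom f])

lemma pev_add: "pev f S (p + q) = pev f S p + pev f S q"
  by (induction p q rule: poly_induct2)
    (simp_all add: scale_left_distrib cmp_add_right[OF pev_hom pev_hom f] algebra_simps)

lemma pev_sum: "pev f S (sum h A) = (\<Sum>i\<in>A. pev f S (h i))"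
  by (induction A rule: infinite_finite_induct) (simp_all add: pev_add)

text \<open>The powers of \<open>f\<close> lie in a finite-dimensional space. If they are pairwise
  distinct, they form an infinite and therefore dependent set; if two coincide, the difference of
  the two monomials annihilates \<open>f\<close>.\<close>

lemma pev_annihilator: "\<exists>p. p \<noteq> 0 \<and> pev f S p = 0"
proof (cases "inj (\<lambda>i. pev f S (monom 1 i))")
  case True
  let ?e = "\<lambda>i. pev f S (monom 1 i)"
  obtain B where B: "finite B" "span B = hom C S S" using hom_finite_dim by blast
  have "infinite (range ?e)" using True finite_imageD by blast
  then have "dependent (range ?e)"
    using independent_span_bound[OF B(1), of "range ?e"] B(2) pev_hom by blast
  then obtain t u where t: "finite t" "t \<subseteq> range ?e" "(\<Sum>v\<in>t. scl C (u v) v) = 0" "\<exists>v\<in>t. u v \<noteq> 0"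
    unfolding dependent_explicit by blast
  define A where "A = ?e -` t"
  have A: "finite A" "t = ?e ` A" using t True by (auto simp: A_def finite_vimageI)
  define p where "p = (\<Sum>i\<in>A. monom (u (?e i)) i)"
  have m: "pev f S (monom c i) = scl C c (?e i)" for c i
    using pev_smult[of c "monom 1 i"] by (simp add: smult_monom)
  have "pev f S p = (\<Sum>i\<in>A. scl C (u (?e i)) (?e i))"
    unfolding p_def pev_sum by (intro sum.cong refl m)
  also have "\<dots> = (\<Sum>v\<in>t. scl C (u v) v)"
    unfolding A(2) using sum.reindex[OF inj_on_subset[OF True subset_UNIV], of "\<lambda>v. scl C (u v) v" A]
    by (simp add: comp_def)
  finally have "pev f S p = 0" using t by simp
  moreover obtain i where i: "i \<in> A" "u (?e i) \<noteq> 0" using t(4) A by auto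
  moreover have "coeff p i = u (?e i)" using A(1) i by (simp add: p_def coeff_sum)
  ultimately show ?thesis by (metis coeff_0)
next
  case False
  then obtain i j where "i \<noteq> j" "pev f S (monom 1 i) = pev f S (monom 1 j)" by (auto simp: inj_def)
  moreover have "coeff (monom 1 i + smult (-1) (monom (1::'k) j)) i = 1" using \<open>i \<noteq> j\<close> by simp
  ultimately show ?thesis using pev_add[of "monom 1 i" "smult (-1) (monom 1 j)"] pev_smult[of "-1" "monom 1 j"]
    by (metis coeff_0 scale_minus_left scale_one add.right_inverse zero_neq_one)
qed

end

text \<open>An annihilator \<open>p\<close> of least degree has a root \<open>r\<close>. Splitting
  off that root leaves \<open>q\<close> with \<open>q(f)\<close> nonzero and
  \<open>(f - r) q(f) = 0\<close>. By Schur's lemma \<open>f - r\<close> is zero or invertible, and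
  invertibility would force \<open>q(f) = 0\<close>.\<close>

lemma simple_endo_scalar:
  assumes S: "simple_object C S" and f: "f \<in> hom C S S"
  shows "\<exists>a. f = scl C a (\<iota> S)"
proof -
  have S0: "\<iota> S \<noteq> 0" using S by (simp add: simple_object_def)
  define P where "P p \<longleftrightarrow> p \<noteq> 0 \<and> pev f S p = 0" for p
  obtain p where p: "P p" and min: "\<And>q. P q \<Longrightarrow> degree p \<le> degree q"
    using pev_annihilator[OF f] ex_has_least_nat[of P _ degree] by (metis P_def)
  have "degree p \<noteq> 0"
  proof
    assume "degree p = 0"
    then obtain c where c: "p = [:c:]" by (rule degree_eq_zeroE)
    then have "scl C c (\<iota> S) = 0" using p f by (auto simp: P_def cmp_zero_right[OF f])
    then show False using S0 c p by (auto simp: P_def)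
  qed
  then obtain r where "poly p r = 0" using alg_closed_imp_poly_has_root[of p] by auto
  then obtain q where q: "p = [:- r, 1:] * q" by (auto simp: poly_eq_0_iff_dvd dvd_def)
  let ?g = "f - scl C r (\<iota> S)"
  have g: "?g \<in> hom C S S" by (intro diff_hom f scl_hom id_hom)
  have q0: "q \<noteq> 0" using q p by (auto simp: P_def)
  then have "degree p = Suc (degree q)" using q degree_mult_eq[of "[:- r, 1:]" q] by (simp del: mult_pCons_left)
  then have nq: "pev f S q \<noteq> 0" using min[of q] q0 by (auto simp: P_def)
  note qh = pev_hom[OF f, of q]
  have "pev f S p = f \<cdot> pev f S q + scl C (- r) (pev f S q)"
    using pev_add[OF f, of "smult (- r) q" "pCons 0 q"] pev_smult[OF f, of "- r" q] pev_pCons[OF f, of 0 q]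
    by (simp add: q)
  moreover have "(?g + scl C r (\<iota> S)) \<cdot> pev f S q = ?g \<cdot> pev f S q + scl C r (\<iota> S) \<cdot> pev f S q"
    by (rule cmp_add_left[OF qh g scl_hom[OF id_hom]])
  ultimately have "?g \<cdot> pev f S q = 0"
    using p cmp_scl_left[OF qh id_hom, of r] id_left[OF qh] by (simp add: P_def)
  then have "?g = 0"
    using iso_simple_mor[OF S S g] iso_cancel_left[of S S ?g "pev f S q" S 0] qh zero_hom nq cmp_zero_right[OF g] by auto
  then show ?thesis by (metis eq_iff_diff_eq_0)
qed

lemma qdim_trace: "left_trace C X (\<iota> X) \<in> hom C \<one> \<one> \<Longrightarrow> left_trace C X (\<iota> X) = scl C (qdim C X) (\<iota> \<one>)"
proof -
  assume "left_trace C X (\<iota> X) \<in> hom C \<one> \<one>"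
  then obtain a where a: "left_trace C X (\<iota> X) = scl C a (\<iota> \<one>)" using simple_endo_scalar[OF unit_simple] by blast
  have "\<iota> \<one> \<noteq> 0" using unit_simple by (simp add: simple_object_def)
  then have "qdim C X = a" unfolding qdim_def a by (intro the_equality) auto
  then show ?thesis using a by simp
qed

end

section \<open>Decompositions into the chosen simple objects\<close>

locale premodular_simples = premodular_category C for C :: "('k::alg_closed_field, 'o, 'm::ab_group_add, 'z) brcat_scheme" (structure) +
  fixes I :: "'o set"
  assumes complete: "complete_simples C I"
begin

lemma simple_I: "S \<in> I \<Longrightarrow> simple_object C S" and one_I: "\<one> \<in> I"
  using complete by (auto simp: complete_simples_def)

lemma isomorphic_sym: "isomorphic C X Y \<Longrightarrow> isomorphic C Y X"
  unfolding isomorphic_def iso_mor_def using iso_inv by blast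

lemma isomorphic_I: assumes "S \<in> I" "T \<in> I" "isomorphic C S T" shows "S = T"
proof -
  have "isomorphic C S S" using iso_id by (auto simp: isomorphic_def)
  then show ?thesis using assms complete unfolding complete_simples_def by blast
qed

lemma hom_I_zero: assumes "S \<in> I" "T \<in> I" "S \<noteq> T" "f \<in> hom C S T" shows "f = 0"
  using isomorphic_I[of S T] iso_simple_mor[OF simple_I simple_I] assms unfolding isomorphic_def by blast

lemma finite_I: "finite I"
proof -
  obtain G where G: "finite G" "\<And>S. simple_object C S \<Longrightarrow> \<exists>T\<in>G. isomorphic C S T"
    using finitely_many_simples by blast
  then obtain h where h: "\<And>S. S \<in> I \<Longrightarrow> h S \<in> G \<and> isomorphic C S (h S)" using simple_I by metis
  have "inj_on h I"
  proof (rule inj_onI)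
    fix S T assume a: "S \<in> I" "T \<in> I" "h S = h T"
    then have "isomorphic C S (h S)" "isomorphic C (h S) T" using h isomorphic_sym by metis+
    then have "isomorphic C S T" unfolding isomorphic_def using iso_cmp by blast
    then show "S = T" using isomorphic_I[OF a(1,2)] by simp
  qed
  moreover have "h ` I \<subseteq> G" using h by blast
  ultimately show ?thesis using G(1) inj_on_finite by blast
qed

text \<open>Each simple summand is transported along an isomorphism to its representative in
  \<open>I\<close>. Afterwards the indices with a common value of \<open>T\<close> give a basis of
  the Hom space from that object to \<open>X\<close>, together with its dual basis.\<close>

lemma decomposition:
  "\<exists>(n::nat) T b b'. (\<forall>j<n. T j \<in> I \<and> b j \<in> hom C (T j) X \<and> b' j \<in> hom C X (T j))
      \<and> (\<forall>j<n. \<forall>l<n. T j = T l \<longrightarrow> b' j \<cdot> b l = (if j = l then \<iota> (T j) else 0))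
      \<and> (\<Sum>j<n. b j \<cdot> b' j) = \<iota> X"
proof -
  obtain n S i p where d: "\<And>j. j < (n::nat) \<Longrightarrow> simple_object C (S j) \<and> i j \<in> hom C (S j) X \<and> p j \<in> hom C X (S j)"
    "\<And>j l. j < n \<Longrightarrow> l < n \<Longrightarrow> p j \<cdot> i l = (if j = l then \<iota> (S j) else 0)" "(\<Sum>j<n. i j \<cdot> p j) = \<iota> X"
    using semisimple[of X] by blast
  have "\<exists>T w w'. T \<in> I \<and> inverses C (S j) T w w'" if "j < n" for j
  proof -
    have "simple_object C (S j)" using d(1)[OF that] by blast
    then obtain T where "T \<in> I" "isomorphic C (S j) T" using complete unfolding complete_simples_def by blast
    then show ?thesis unfolding isomorphic_def iso_mor_def by blast
  qed
  then obtain T w w' where T: "\<And>j. j < n \<Longrightarrow> T j \<in> I \<and> inverses C (S j) (T j) (w j) (w' j)" by metis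
  define b where "b j = i j \<cdot> w' j" for j
  define b' where "b' j = w j \<cdot> p j" for j
  have w: "w j \<in> hom C (S j) (T j)" "w' j \<in> hom C (T j) (S j)" "w' j \<cdot> w j = \<iota> (S j)" "w j \<cdot> w' j = \<iota> (T j)"
    if "j < n" for j using T[OF that] by (auto simp: inverses_def)
  have e: "b j \<cdot> b' j = i j \<cdot> p j" if j: "j < n" for j
    using w[OF j] d(1)[OF j] cmp_assoc[of "b' j" X "T j" "w' j" "S j" "i j" X] cmp_assoc[of "p j" X "S j" "w j" "T j" "w' j" "S j"]
      id_left[of "p j" X "S j"] cmp_hom[of "p j" X "S j" "w j" "T j"] by (simp add: b_def b'_def)
  have o: "b' j \<cdot> b l = (if j = l then \<iota> (T j) else 0)" if j: "j < n" and l: "l < n" for j l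
  proof -
    have "b' j \<cdot> b l = w j \<cdot> ((p j \<cdot> i l) \<cdot> w' l)"
      using w[OF j] w[OF l] d(1)[OF j] d(1)[OF l] cmp_assoc[of "b l" "T l" X "p j" "S j" "w j" "T j"]
        cmp_assoc[of "w' l" "T l" "S l" "i l" X "p j" "S j"] cmp_hom[of "w' l" "T l" "S l" "i l" X] by (simp add: b_def b'_def)
    then show ?thesis using w[OF j] w[OF l] d(2)[OF j l] id_left[OF w(2)[OF j]] cmp_zero_left[OF w(2)[OF l]]
      cmp_zero_right[OF w(1)[OF j]] by auto
  qed
  have "(\<forall>j<n. T j \<in> I \<and> b j \<in> hom C (T j) X \<and> b' j \<in> hom C X (T j))"
  proof (intro allI impI)
    fix j assume j: "j < n"
    show "T j \<in> I \<and> b j \<in> hom C (T j) X \<and> b' j \<in> hom C X (T j)"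
      using T[OF j] w[OF j] d(1)[OF j] cmp_hom[of "w' j" "T j" "S j" "i j" X] cmp_hom[of "p j" X "S j" "w j" "T j"]
      by (simp add: b_def b'_def)
  qed
  then show ?thesis using o e d(3) by (intro exI[of _ n] exI[of _ T] exI[of _ b] exI[of _ b']) simp
qed

end

context words begin

lemma sten_sid_left: "arr f \<Longrightarrow> sid xs \<odot> f = wh xs f []"
  by (simp add: wh_def sten_Nil_right)
lemma sten_sid_right: "arr f \<Longrightarrow> f \<odot> sid xs = wh [] f xs"
  by (simp add: wh_def sten_Nil_left)

lemmas sten_sid_wh = sten_sid_left sten_sid_right

definition st where "st v w f = (THE g. rep v w f g)"

lemma rep_st: "frame v \<Longrightarrow> frame w \<Longrightarrow> f \<in> hom C (src v) (src w) \<Longrightarrow> rep v w f (st v w f)"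
  unfolding st_def using rep_ex[of v w f] rep_unique[of v w f] by (metis theI)

text \<open>A word isomorphic to a dual is again a dual. With the pivotal isomorphism as
  \<open>p\<close> this makes \<open>X\<close> itself a dual of \<open>dual C X\<close>.\<close>

lemma adj_iso:
  assumes a: "adj A B \<eta> \<epsilon>" and p: "hm p B' B" and q: "hm q B B'" and i: "q \<bullet> p = sid B'" "p \<bullet> q = sid B"
  shows "adj A B' (wh A q [] \<bullet> \<eta>) (\<epsilon> \<bullet> wh [] p A)"
proof -
  have h: "hm \<eta> [] (A @ B)" "hm \<epsilon> (B @ A) []"
    and z: "wh A \<epsilon> [] \<bullet> wh [] \<eta> A = sid A" "wh [] \<epsilon> B \<bullet> wh B \<eta> [] = sid B"
    using a by (auto simp: adj_def)
  have "wh A \<epsilon> [] \<bullet> wh A p A \<bullet> wh A q A \<bullet> wh [] \<eta> A = wh A \<epsilon> [] \<bullet> wh A (p \<bullet> q) A \<bullet> wh [] \<eta> A"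
    using h p q by (subst wh_scmp) (simp_all add: scmp_assoc)
  also have "\<dots> = sid A" using h i z by simp
  finally have 1: "wh A (\<epsilon> \<bullet> wh [] p A) [] \<bullet> wh [] (wh A q [] \<bullet> \<eta>) A = sid A"
    using h p q by (simp add: wh_scmp scmp_assoc)
  have "wh [] \<epsilon> B' \<bullet> wh [] p (A @ B') \<bullet> wh (B' @ A) q [] \<bullet> wh B' \<eta> []
     = wh [] \<epsilon> B' \<bullet> wh (B @ A) q [] \<bullet> wh [] p (A @ B) \<bullet> wh B' \<eta> []"
    using exchange[of p q "[]" A "[]"] h p q scmp_assoc[of "wh B' \<eta> []" "wh (B' @ A) q []" "wh [] p (A @ B')"]
      scmp_assoc[of "wh B' \<eta> []" "wh [] p (A @ B)" "wh (B @ A) q []"] by simp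
  also have "\<dots> = wh [] \<epsilon> B' \<bullet> wh (B @ A) q [] \<bullet> wh B \<eta> [] \<bullet> p"
    using exchange[of p \<eta> "[]" "[]" "[]"] h p by simp
  also have "\<dots> = q \<bullet> wh [] \<epsilon> B \<bullet> wh B \<eta> [] \<bullet> p"
    using exchange[of \<epsilon> q "[]" "[]" "[]"] h p q scmp_assoc[of "wh B \<eta> [] \<bullet> p" "wh (B @ A) q []" "wh [] \<epsilon> B'"]
      scmp_assoc[of "wh B \<eta> [] \<bullet> p" "wh [] \<epsilon> B" q] by simp
  also have "\<dots> = q \<bullet> (wh [] \<epsilon> B \<bullet> wh B \<eta> []) \<bullet> p" using h p by (simp add: scmp_assoc)
  also have "\<dots> = sid B'" using z i p by simp
  finally have 2: "wh [] (\<epsilon> \<bullet> wh [] p A) B' \<bullet> wh B' (wh A q [] \<bullet> \<eta>) [] = sid B'"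
    using h p q by (simp add: wh_scmp scmp_assoc)
  show ?thesis using 1 2 h p q by (simp add: adj_def)
qed

lemmas rep_rules = rep_cmp rep_ten rep_id rep_asc rep_inv_asc rep_lun rep_inv_lun rep_run rep_inv_run

no_notation scmp (infixr \<open>\<bullet>\<close> 70) and sten (infixr \<open>\<odot>\<close> 75)

end

section \<open>Duals, braidings and dimensions on words\<close>

sublocale pivotal_category \<subseteq> words C "\<lambda>x. x" ..

context pivotal_category begin

notation scmp (infixr \<open>\<bullet>\<close> 70)

definition sev where "sev X = st (fnode (fleaf (dual C X)) (fleaf X)) funit (ev C X)"
definition scoev where "scoev X = st funit (fnode (fleaf X) (fleaf (dual C X))) (coev C X)"
definition spiv where "spiv X = st (fleaf X) (fleaf (dual C (dual C X))) (piv C X)"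
definition ipiv where "ipiv X = st (fleaf (dual C (dual C X))) (fleaf X) (inv_mor C X (dual C (dual C X)) (piv C X))"
definition sev' where "sev' X = sev (dual C X) \<bullet> wh [] (spiv X) [dual C X]"
definition scoev' where "scoev' X = wh [dual C X] (ipiv X) [] \<bullet> scoev (dual C X)"

lemma rep_ev: "rep (fnode (fleaf (dual C X)) (fleaf X)) funit (ev C X) (sev X)"
  unfolding sev_def using ev_hom by (intro rep_st) simp_all
lemma rep_coev: "rep funit (fnode (fleaf X) (fleaf (dual C X))) (coev C X) (scoev X)"
  unfolding scoev_def using coev_hom by (intro rep_st) simp_all
lemma rep_piv: "rep (fleaf X) (fleaf (dual C (dual C X))) (piv C X) (spiv X)"
  unfolding spiv_def using iso_hom[OF piv_iso] by (intro rep_st) simp_all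
lemma rep_ipiv: "rep (fleaf (dual C (dual C X))) (fleaf X) (inv_mor C X (dual C (dual C X)) (piv C X)) (ipiv X)"
  unfolding ipiv_def using inv_mor_inverses[OF piv_iso] by (intro rep_st) (simp_all add: inverses_def)

lemma dual_arr [simp]:
  "arr (sev X)" "src (sev X) = [dual C X, X]" "trg (sev X) = []"
  "arr (scoev X)" "src (scoev X) = []" "trg (scoev X) = [X, dual C X]"
  "arr (spiv X)" "src (spiv X) = [X]" "trg (spiv X) = [dual C (dual C X)]"
  "arr (ipiv X)" "trg (ipiv X) = [X]" "src (ipiv X) = [dual C (dual C X)]"
  using rep_hm[OF rep_ev[of X]] rep_hm[OF rep_coev[of X]] rep_hm[OF rep_piv[of X]] rep_hm[OF rep_ipiv[of X]] by simp_all

lemma dual_arr' [simp]: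
  "arr (sev' X)" "src (sev' X) = [X, dual C X]" "trg (sev' X) = []"
  "arr (scoev' X)" "src (scoev' X) = []" "trg (scoev' X) = [dual C X, X]"
  by (simp_all add: sev'_def scoev'_def)

lemma adj_dual: "adj [X] [dual C X] (scoev X) (sev X)"
proof -
  let ?X = "dual C X"
  have "rep (fleaf X) (fleaf X) (run C X \<cdot> (\<iota> X \<boxtimes> ev C X) \<cdot> asc C X ?X X \<cdot> (coev C X \<boxtimes> \<iota> X)
      \<cdot> inv_mor C (\<one> \<otimes> X) X (lun C X)) (wh [X] (sev X) [] \<bullet> wh [] (scoev X) [X])"
    by (rule rep_eq, (rule rep_rules rep_ev rep_coev refl | simp)+, simp add: sten_sid_wh)
  then have "rep (fleaf X) (fleaf X) (\<iota> X) (wh [X] (sev X) [] \<bullet> wh [] (scoev X) [X])" unfolding zigzag by blast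
  then have 1: "wh [X] (sev X) [] \<bullet> wh [] (scoev X) [X] = sid [X]"
    using rep_unique rep_id[of "fleaf X" X] by fastforce
  have "rep (fleaf ?X) (fleaf ?X) (mate C ?X X (ev C X)) (wh [] (sev X) [?X] \<bullet> wh [?X] (scoev X) [])"
    unfolding mate_def
    by (rule rep_eq, (rule rep_rules rep_ev rep_coev refl | simp)+, simp add: sten_sid_wh)
  then have "rep (fleaf ?X) (fleaf ?X) (\<iota> ?X) (wh [] (sev X) [?X] \<bullet> wh [?X] (scoev X) [])" unfolding zigzag_dual by blast
  then have 2: "wh [] (sev X) [?X] \<bullet> wh [?X] (scoev X) [] = sid [?X]"
    using rep_unique rep_id[of "fleaf ?X" ?X] by fastforce
  show ?thesis using 1 2 by (simp add: adj_def)
qed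

lemma adj_dual': "adj [dual C X] [X] (scoev' X) (sev' X)"
proof -
  have i: "inverses C X (dual C (dual C X)) (piv C X) (inv_mor C X (dual C (dual C X)) (piv C X))"
    by (rule inv_mor_inverses[OF piv_iso])
  show ?thesis unfolding scoev'_def sev'_def
    by (rule adj_iso[OF adj_dual]) (use rep_inv[OF rep_piv _ rep_ipiv, of X] i in simp_all)
qed

lemma rep_ev': "rep (fnode (fleaf X) (fleaf (dual C X))) funit (ev' C X) (sev' X)"
proof -
  have "rep (fnode (fleaf X) (fleaf (dual C X))) funit (ev' C X) (sev' X)"
    unfolding ev'_def
    by (rule rep_eq, (rule rep_rules rep_ev rep_piv refl | simp)+, simp add: sev'_def sten_sid_wh)
  then show ?thesis by blast
qed

lemma rep_coev': "rep funit (fnode (fleaf (dual C X)) (fleaf X)) (coev' C X) (scoev' X)"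
proof -
  have "rep funit (fnode (fleaf (dual C X)) (fleaf X)) (coev' C X) (scoev' X)"
    unfolding coev'_def
    by (rule rep_eq, (rule rep_rules rep_coev rep_ipiv refl | simp)+, simp add: scoev'_def sten_sid_wh)
  then show ?thesis by blast
qed

end

context words begin

lemma sscl_sid_eqD: "sscl a (sid xs) = sscl b (sid xs) \<Longrightarrow> \<iota> (ob xs) \<noteq> 0 \<Longrightarrow> a = b"
  by (simp add: sscl_def sid_def)

definition fword where "fword xs = (ob xs, \<iota> (ob xs), xs)"

lemma fword_simps [simp]: "frame (fword xs)" "src (fword xs) = ob xs" "trg (fword xs) = xs"
  by (simp_all add: fword_def frame_def iso_id)

lemma sscl_zero: "arr f \<Longrightarrow> mor f = 0 \<Longrightarrow> sscl a f = f"
  by (rule triple_eqI) (simp_all add: sscl_def)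

end

section \<open>Strict braidings, the half-braiding and loop values\<close>

context premodular_category begin

definition sbr where "sbr X Y = st (fnode (fleaf X) (fleaf Y)) (fnode (fleaf Y) (fleaf X)) (brd C X Y)"
definition sib where "sib X Y = st (fnode (fleaf Y) (fleaf X)) (fnode (fleaf X) (fleaf Y)) (inv_brd C X Y)"

lemma rep_brd: "rep (fnode (fleaf X) (fleaf Y)) (fnode (fleaf Y) (fleaf X)) (brd C X Y) (sbr X Y)"
  unfolding sbr_def using iso_hom[OF brd_iso] by (intro rep_st) simp_all
lemma rep_inv_brd: "rep (fnode (fleaf Y) (fleaf X)) (fnode (fleaf X) (fleaf Y)) (inv_brd C X Y) (sib X Y)"
  unfolding sib_def inv_brd_def using inv_mor_inverses[OF brd_iso] by (intro rep_st) (simp_all add: inverses_def)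

lemma braid_arr [simp]:
  "arr (sbr X Y)" "src (sbr X Y) = [X, Y]" "trg (sbr X Y) = [Y, X]"
  "arr (sib X Y)" "src (sib X Y) = [Y, X]" "trg (sib X Y) = [X, Y]"
  using rep_hm[OF rep_brd[of X Y]] rep_hm[OF rep_inv_brd[of Y X]] by simp_all

lemma braid_inv [simp]: "sib X Y \<bullet> sbr X Y = sid [X, Y]" "sbr X Y \<bullet> sib X Y = sid [Y, X]"
  using rep_inv[OF rep_brd _ rep_inv_brd, of X Y] inv_mor_inverses[OF brd_iso, of X Y] by (simp_all add: inv_brd_def)

text \<open>The second hexagon with its associators absorbed into frames. General frames are allowed
  so that the unit frame \<open>funit\<close> can be inserted, as the triviality of the braiding
  with \<open>\<one>\<close> requires.\<close>

lemma rep_brd_tensor_left: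
  assumes A: "rep (fnode u w) (fnode w u) (brd C (src u) (src w)) A"
    and B: "rep (fnode v w) (fnode w v) (brd C (src v) (src w)) B"
    and f: "frame u" "frame v" "frame w"
  shows "rep (fnode (fnode u v) w) (fnode w (fnode u v)) (brd C (src u \<otimes> src v) (src w))
    (wh [] A (trg v) \<bullet> wh (trg u) B [])"
proof -
  let ?X = "src u" and ?Y = "src v" and ?Z = "src w"
  have AB [simp]: "arr A" "src A = trg u @ trg w" "trg A = trg w @ trg u"
    "arr B" "src B = trg v @ trg w" "trg B = trg w @ trg v"
    using rep_hm[OF A] rep_hm[OF B] by simp_all
  note [simp] = f
  obtain G where G: "rep (fnode (fnode u v) w) (fnode w (fnode u v)) (brd C (?X \<otimes> ?Y) ?Z) G"
    using rep_ex[of "fnode (fnode u v) w" "fnode w (fnode u v)"] f iso_hom[OF brd_iso] by fastforce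
  have Gh [simp]: "arr G" "src G = trg u @ trg v @ trg w" "trg G = trg w @ trg u @ trg v"
    using rep_hm[OF G] by simp_all
  have "rep (fnode u (fnode v w)) (fnode (fnode w u) v)
     (inv_mor C ((?Z \<otimes> ?X) \<otimes> ?Y) (?Z \<otimes> (?X \<otimes> ?Y)) (asc C ?Z ?X ?Y) \<cdot> brd C (?X \<otimes> ?Y) ?Z
         \<cdot> inv_mor C ((?X \<otimes> ?Y) \<otimes> ?Z) (?X \<otimes> (?Y \<otimes> ?Z)) (asc C ?X ?Y ?Z)) G"
    by (rule rep_eq, (rule rep_rules G refl | simp)+)
  moreover have "rep (fnode u (fnode v w)) (fnode (fnode w u) v)
     ((brd C ?X ?Z \<boxtimes> \<iota> ?Y) \<cdot> inv_mor C ((?X \<otimes> ?Z) \<otimes> ?Y) (?X \<otimes> (?Z \<otimes> ?Y)) (asc C ?X ?Z ?Y)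
         \<cdot> (\<iota> ?X \<boxtimes> brd C ?Y ?Z)) (wh [] A (trg v) \<bullet> wh (trg u) B [])"
    by (rule rep_eq, (rule rep_rules A B refl | simp)+, simp add: sten_sid_wh)
  ultimately have "G = wh [] A (trg v) \<bullet> wh (trg u) B []" unfolding hexagon' using rep_unique by blast
  then show ?thesis using G by simp
qed

lemma rep_brd_tensor_right:
  assumes A: "rep (fnode u v) (fnode v u) (brd C (src u) (src v)) A"
    and B: "rep (fnode u w) (fnode w u) (brd C (src u) (src w)) B"
    and f: "frame u" "frame v" "frame w"
  shows "rep (fnode u (fnode v w)) (fnode (fnode v w) u) (brd C (src u) (src v \<otimes> src w))
    (wh (trg v) B [] \<bullet> wh [] A (trg w))"
proof -
  let ?X = "src u" and ?Y = "src v" and ?Z = "src w"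
  have AB [simp]: "arr A" "src A = trg u @ trg v" "trg A = trg v @ trg u"
    "arr B" "src B = trg u @ trg w" "trg B = trg w @ trg u"
    using rep_hm[OF A] rep_hm[OF B] by simp_all
  note [simp] = f
  obtain G where G: "rep (fnode u (fnode v w)) (fnode (fnode v w) u) (brd C ?X (?Y \<otimes> ?Z)) G"
    using rep_ex[of "fnode u (fnode v w)" "fnode (fnode v w) u"] f iso_hom[OF brd_iso] by fastforce
  have Gh [simp]: "arr G" "src G = trg u @ trg v @ trg w" "trg G = trg v @ trg w @ trg u"
    using rep_hm[OF G] by simp_all
  have "rep (fnode (fnode u v) w) (fnode v (fnode w u))
     (asc C ?Y ?Z ?X \<cdot> brd C ?X (?Y \<otimes> ?Z) \<cdot> asc C ?X ?Y ?Z) G"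
    by (rule rep_eq, (rule rep_rules G refl | simp)+)
  moreover have "rep (fnode (fnode u v) w) (fnode v (fnode w u))
     ((\<iota> ?Y \<boxtimes> brd C ?X ?Z) \<cdot> asc C ?Y ?X ?Z \<cdot> (brd C ?X ?Y \<boxtimes> \<iota> ?Z)) (wh (trg v) B [] \<bullet> wh [] A (trg w))"
    by (rule rep_eq, (rule rep_rules A B refl | simp)+, simp add: sten_sid_wh)
  ultimately have "G = wh (trg v) B [] \<bullet> wh [] A (trg w)" unfolding hexagon using rep_unique by blast
  then show ?thesis using G by simp
qed

text \<open>The braiding with the unit is idempotent by the hexagon, hence trivial.\<close>

lemma rep_brd_one: "rep (fnode funit (fleaf Z)) (fnode (fleaf Z) funit) (brd C \<one> Z) (sid [Z])"
proof -
  let ?u = "fnode funit (fleaf Z)" and ?v = "fnode (fleaf Z) funit"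
  have i: "inverses C (\<one> \<otimes> Z) (Z \<otimes> \<one>) (brd C \<one> Z) (inv_brd C \<one> Z)"
    unfolding inv_brd_def by (rule inv_mor_inverses[OF brd_iso])
  obtain G H where G: "rep ?u ?v (brd C \<one> Z) G" and H: "rep ?v ?u (inv_brd C \<one> Z) H"
    using rep_ex[of ?u ?v "brd C \<one> Z"] rep_ex[of ?v ?u "inv_brd C \<one> Z"] i by (fastforce simp: inverses_def)
  have Gh [simp]: "arr G" "src G = [Z]" "trg G = [Z]" "arr H" "src H = [Z]" "trg H = [Z]"
    using rep_hm[OF G] rep_hm[OF H] by simp_all
  have GG: "rep (fnode (fnode funit funit) (fleaf Z)) (fnode (fleaf Z) (fnode funit funit)) (brd C (\<one> \<otimes> \<one>) Z) (G \<bullet> G)"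
    using rep_brd_tensor_left[of funit "fleaf Z" G funit G] G by simp
  have "rep (fnode (fnode funit funit) (fleaf Z)) ?v (brd C \<one> Z \<cdot> (lun C \<one> \<boxtimes> \<iota> Z)) G"
    by (rule rep_eq, (rule rep_rules G refl | simp)+, simp add: sten_sid)
  moreover have "rep (fnode (fnode funit funit) (fleaf Z)) ?v ((\<iota> Z \<boxtimes> lun C \<one>) \<cdot> brd C (\<one> \<otimes> \<one>) Z) (G \<bullet> G)"
    by (rule rep_eq, (rule rep_rules GG refl | simp)+, simp add: sten_sid)
  moreover have "brd C \<one> Z \<cdot> (lun C \<one> \<boxtimes> \<iota> Z) = (\<iota> Z \<boxtimes> lun C \<one>) \<cdot> brd C (\<one> \<otimes> \<one>) Z"
    by (rule brd_natural) (rule hom_rules)+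
  ultimately have "G = G \<bullet> G" using rep_unique by metis
  then have "H \<bullet> G = (H \<bullet> G) \<bullet> G" by (simp add: scmp_assoc)
  then have "G = sid [Z]" using rep_inv[OF G _ H] i by simp
  then show ?thesis using G by simp
qed

text \<open>Naturality gives a single crossing of \<open>S \<otimes> Z\<close> with
  \<open>X\<close>, which the hexagon splits into two crossings. The vertices \<open>b\<close> have
  the shape of the basis elements used in the handle slide.\<close>

lemma braid_natural_left:
  assumes b: "hm b [T] [S, Z]"
  shows "wh [] (sbr S X) [Z] \<bullet> wh [S] (sbr Z X) [] \<bullet> wh [] b [X] = wh [X] b [] \<bullet> sbr T X"
proof -
  let ?w = "fnode (fleaf S) (fleaf Z)" and ?x = "fleaf X"
  note [simp] = b
  obtain f where f: "rep (fleaf T) ?w f b" using rep_ex'[of "fleaf T" ?w b] b by auto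
  note br = rep_brd_tensor_left[of "fleaf S" ?x _ "fleaf Z", simplified, OF rep_brd rep_brd]
  have "rep (fnode (fleaf T) ?x) (fnode ?x ?w) (brd C (S \<otimes> Z) X \<cdot> (f \<boxtimes> \<iota> X)) ((wh [] (sbr S X) [Z] \<bullet> wh [S] (sbr Z X) []) \<bullet> wh [] b [X])"
    by (rule rep_eq, (rule rep_rules br f refl | simp)+, simp add: sten_sid_wh)
  moreover have "rep (fnode (fleaf T) ?x) (fnode ?x ?w) ((\<iota> X \<boxtimes> f) \<cdot> brd C T X) (wh [X] b [] \<bullet> sbr T X)"
    by (rule rep_eq, (rule rep_rules rep_brd f refl | simp)+, simp add: sten_sid_wh)
  moreover have "brd C (S \<otimes> Z) X \<cdot> (f \<boxtimes> \<iota> X) = (\<iota> X \<boxtimes> f) \<cdot> brd C T X"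
    by (rule brd_natural) (use rep_hom[OF f] id_hom in simp_all)
  ultimately have "(wh [] (sbr S X) [Z] \<bullet> wh [S] (sbr Z X) []) \<bullet> wh [] b [X] = wh [X] b [] \<bullet> sbr T X"
    using rep_unique by metis
  then show ?thesis by (simp add: scmp_assoc)
qed

lemma braid_natural_right:
  assumes b: "hm b [T] [S, Z]"
  shows "wh [S] (sbr Y Z) [] \<bullet> wh [] (sbr Y S) [Z] \<bullet> wh [Y] b [] = wh [] b [Y] \<bullet> sbr Y T"
proof -
  let ?w = "fnode (fleaf S) (fleaf Z)" and ?x = "fleaf Y"
  note [simp] = b
  obtain f where f: "rep (fleaf T) ?w f b" using rep_ex'[of "fleaf T" ?w b] b by auto
  note br = rep_brd_tensor_right[of ?x "fleaf S" _ "fleaf Z", simplified, OF rep_brd rep_brd]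
  have "rep (fnode ?x (fleaf T)) (fnode ?w ?x) (brd C Y (S \<otimes> Z) \<cdot> (\<iota> Y \<boxtimes> f)) ((wh [S] (sbr Y Z) [] \<bullet> wh [] (sbr Y S) [Z]) \<bullet> wh [Y] b [])"
    by (rule rep_eq, (rule rep_rules br f refl | simp)+, simp add: sten_sid_wh)
  moreover have "rep (fnode ?x (fleaf T)) (fnode ?w ?x) ((f \<boxtimes> \<iota> Y) \<cdot> brd C Y T) (wh [] b [Y] \<bullet> sbr Y T)"
    by (rule rep_eq, (rule rep_rules rep_brd f refl | simp)+, simp add: sten_sid_wh)
  moreover have "brd C Y (S \<otimes> Z) \<cdot> (\<iota> Y \<boxtimes> f) = (f \<boxtimes> \<iota> Y) \<cdot> brd C Y T"
    by (rule brd_natural) (use rep_hom[OF f] id_hom in simp_all)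
  ultimately have "(wh [S] (sbr Y Z) [] \<bullet> wh [] (sbr Y S) [Z]) \<bullet> wh [Y] b [] = wh [] b [Y] \<bullet> sbr Y T"
    using rep_unique by metis
  then show ?thesis by (simp add: scmp_assoc)
qed

lemma braid_inv_natural_right:
  assumes b: "hm b [T] [S, Z]"
  shows "wh [] (sib Y S) [Z] \<bullet> wh [S] (sib Y Z) [] \<bullet> wh [] b [Y] = wh [Y] b [] \<bullet> sib Y T"
proof -
  note [simp] = b
  have "wh [] b [Y] = (wh [] b [Y] \<bullet> sbr Y T) \<bullet> sib Y T" by (simp add: scmp_assoc)
  also have "\<dots> = wh [S] (sbr Y Z) [] \<bullet> wh [] (sbr Y S) [Z] \<bullet> wh [Y] b [] \<bullet> sib Y T"
    unfolding braid_natural_right[OF b, symmetric] by (simp add: scmp_assoc)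
  finally have e: "wh [] b [Y] = wh [S] (sbr Y Z) [] \<bullet> wh [] (sbr Y S) [Z] \<bullet> wh [Y] b [] \<bullet> sib Y T" .
  have "wh [S] (sib Y Z) [] \<bullet> wh [S] (sbr Y Z) [] \<bullet> r = r" if "hm r xs [S, Y, Z]" for r xs
    using that wh_scmp[of "sbr Y Z" "sib Y Z" "[S]" "[]", symmetric] scmp_assoc[of r "wh [S] (sbr Y Z) []" "wh [S] (sib Y Z) []", symmetric] by simp
  moreover have "wh [] (sib Y S) [Z] \<bullet> wh [] (sbr Y S) [Z] \<bullet> r = r" if "hm r xs [Y, S, Z]" for r xs
    using that wh_scmp[of "sbr Y S" "sib Y S" "[]" "[Z]", symmetric] scmp_assoc[of r "wh [] (sbr Y S) [Z]" "wh [] (sib Y S) [Z]", symmetric] by simp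
  ultimately show ?thesis by (subst e) simp
qed

text \<open>Naturality of the braiding at \<open>ev C Y\<close>, whose target is the unit, where the
  braiding is trivial. It is used to trade the crossing of \<open>dual C Y\<close> in the condition
  on \<open>Hom\<^sup>\<sigma>\<close> for an inverse crossing of \<open>Y\<close>.\<close>

lemma braid_ev:
  "wh [] (sev Y) [Z] = wh [Z] (sev Y) [] \<bullet> wh [] (sbr (dual C Y) Z) [Y] \<bullet> wh [dual C Y] (sbr Y Z) []"
proof -
  let ?w = "fnode (fleaf (dual C Y)) (fleaf Y)" and ?z = "fleaf Z"
  note br = rep_brd_tensor_left[of "fleaf (dual C Y)" ?z _ "fleaf Y", simplified, OF rep_brd rep_brd]
  have "rep (fnode ?w ?z) (fnode ?z funit) (brd C \<one> Z \<cdot> (ev C Y \<boxtimes> \<iota> Z)) (wh [] (sev Y) [Z])"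
    by (rule rep_eq, (rule rep_rules rep_brd_one rep_ev refl | simp)+, simp add: sten_sid_wh)
  moreover have "rep (fnode ?w ?z) (fnode ?z funit) ((\<iota> Z \<boxtimes> ev C Y) \<cdot> brd C (dual C Y \<otimes> Y) Z) (wh [Z] (sev Y) [] \<bullet> wh [] (sbr (dual C Y) Z) [Y] \<bullet> wh [dual C Y] (sbr Y Z) [])"
    by (rule rep_eq, (rule rep_rules br rep_ev refl | simp)+, simp add: sten_sid_wh)
  moreover have "brd C \<one> Z \<cdot> (ev C Y \<boxtimes> \<iota> Z) = (\<iota> Z \<boxtimes> ev C Y) \<cdot> brd C (dual C Y \<otimes> Y) Z"
    by (rule brd_natural[OF ev_hom id_hom])
  ultimately show ?thesis using rep_unique by metis
qed

text \<open>The half-braiding of \<open>X \<otimes> Y\<close> that passes over \<open>X\<close> and under \<open>Y\<close>.\<close>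

definition shb where "shb X Y Z = wh [X] (sib Y Z) [] \<bullet> wh [] (sbr Z X) [Y]"

lemma shb_arr [simp]: "arr (shb X Y Z)" "src (shb X Y Z) = [Z, X, Y]" "trg (shb X Y Z) = [X, Y, Z]"
  by (simp_all add: shb_def)

text \<open>The inner crossings with \<open>X\<close> and with \<open>Y\<close> involve disjoint
  strands, so one exchange collects the \<open>X\<close> crossings and the \<open>Y\<close>
  crossings. Then \<open>b\<close> passes each group by naturality.\<close>

lemma shb_natural:
  assumes b: "hm b [T] [S, Z]"
  shows "wh [] (shb X Y S) [Z] \<bullet> wh [S] (shb X Y Z) [] \<bullet> wh [] b [X, Y] = wh [X, Y] b [] \<bullet> shb X Y T"
proof -
  note [simp] = b
  have e: "wh [] (sbr S X) [Y, Z] \<bullet> wh [S, X] (sib Y Z) [] = wh [X, S] (sib Y Z) [] \<bullet> wh [] (sbr S X) [Z, Y]"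
    using exchange[of "sbr S X" "sib Y Z" "[]" "[]" "[]"] by simp
  have "wh [] (shb X Y S) [Z] \<bullet> wh [S] (shb X Y Z) [] \<bullet> wh [] b [X, Y]
     = wh [X] (sib Y S) [Z] \<bullet> (wh [] (sbr S X) [Y, Z] \<bullet> wh [S, X] (sib Y Z) []) \<bullet> wh [S] (sbr Z X) [Y] \<bullet> wh [] b [X, Y]"
    by (simp add: shb_def wh_scmp scmp_assoc)
  also have "\<dots> = wh [X] (sib Y S) [Z] \<bullet> wh [X, S] (sib Y Z) []
      \<bullet> wh [] (wh [] (sbr S X) [Z] \<bullet> wh [S] (sbr Z X) [] \<bullet> wh [] b [X]) [Y]"
    unfolding e by (simp add: wh_scmp scmp_assoc)
  also have "\<dots> = wh [X] (wh [] (sib Y S) [Z] \<bullet> wh [S] (sib Y Z) [] \<bullet> wh [] b [Y]) [] \<bullet> wh [] (sbr T X) [Y]"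
    unfolding braid_natural_left[OF b] by (simp add: wh_scmp scmp_assoc)
  also have "\<dots> = wh [X, Y] b [] \<bullet> shb X Y T"
    unfolding braid_inv_natural_right[OF b] by (simp add: shb_def wh_scmp scmp_assoc)
  finally show ?thesis .
qed

text \<open>\<open>qdim\<close> is defined by the left trace; sphericality is what gives the loop in
  the other direction the same value. The representation also shows that the trace is an
  endomorphism of \<open>\<one>\<close>, hence a scalar.\<close>

lemma dim_left: "sev X \<bullet> scoev' X = sscl (qdim C X) (sid [])"
  and dim_right: "sev' X \<bullet> scoev X = sscl (qdim C X) (sid [])"
proof -
  have "rep funit funit (left_trace C X (\<iota> X)) (sev X \<bullet> scoev' X)"
    unfolding left_trace_def
    by (rule rep_eq, (rule rep_rules rep_ev rep_coev' refl | simp)+, simp add: sten_sid)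
  then have l: "rep funit funit (left_trace C X (\<iota> X)) (sev X \<bullet> scoev' X)" by blast
  have "rep funit funit (right_trace C X (\<iota> X)) (sev' X \<bullet> scoev X)"
    unfolding right_trace_def
    by (rule rep_eq, (rule rep_rules rep_ev' rep_coev refl | simp)+, simp add: sten_sid)
  then have r: "rep funit funit (left_trace C X (\<iota> X)) (sev' X \<bullet> scoev X)" using spherical[OF id_hom] by auto
  have q: "left_trace C X (\<iota> X) = scl C (qdim C X) (\<iota> \<one>)"
    using qdim_trace rep_hom[OF l] by simp
  have s: "rep funit funit (left_trace C X (\<iota> X)) (sscl (qdim C X) (sid []))"
    unfolding q using rep_scl[OF rep_id[of funit \<one>]] by simp
  show "sev X \<bullet> scoev' X = sscl (qdim C X) (sid [])" using rep_unique[OF l s] .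
  show "sev' X \<bullet> scoev X = sscl (qdim C X) (sid [])" using rep_unique[OF r s] .
qed

end

section \<open>Decompositions and Schur's lemma on words\<close>

context premodular_simples begin

definition decomposes :: "'o list \<Rightarrow> nat \<Rightarrow> (nat \<Rightarrow> 'o) \<Rightarrow> (nat \<Rightarrow> 'o list \<times> 'm \<times> 'o list)
    \<Rightarrow> (nat \<Rightarrow> 'o list \<times> 'm \<times> 'o list) \<Rightarrow> bool" where
  "decomposes xs n T b b' \<longleftrightarrow> (\<forall>j<n. T j \<in> I \<and> hm (b j) [T j] xs \<and> hm (b' j) xs [T j])
      \<and> (\<forall>j<n. \<forall>l<n. T j = T l \<longrightarrow> b' j \<bullet> b l = sscl (if j = l then 1 else 0) (sid [T j]))
      \<and> ssum xs xs {..<n} (\<lambda>j. b j \<bullet> b' j) = sid xs"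

lemma strict_decomposition: "\<exists>n T b b'. decomposes xs n T b b'"
proof -
  obtain n T b b' where d: "\<And>j. j < (n::nat) \<Longrightarrow> T j \<in> I \<and> b j \<in> hom C (T j) (ob xs) \<and> b' j \<in> hom C (ob xs) (T j)"
    "\<And>j l. j < n \<Longrightarrow> l < n \<Longrightarrow> T j = T l \<Longrightarrow> b' j \<cdot> b l = (if j = l then \<iota> (T j) else 0)"
    "(\<Sum>j<n. b j \<cdot> b' j) = \<iota> (ob xs)" using decomposition[of "ob xs"] by blast
  let ?w = "fword xs"
  define B where "B j = st (fleaf (T j)) ?w (b j)" for j
  define B' where "B' j = st ?w (fleaf (T j)) (b' j)" for j
  have r: "rep (fleaf (T j)) ?w (b j) (B j)" "rep ?w (fleaf (T j)) (b' j) (B' j)" if "j < n" for j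
    unfolding B_def B'_def using d(1)[OF that] by (auto intro!: rep_st)
  have "B' j \<bullet> B l = sscl (if j = l then 1 else 0) (sid [T j])" if jl: "j < n" "l < n" "T j = T l" for j l
  proof -
    have "rep (fleaf (T j)) (fleaf (T j)) (b' j \<cdot> b l) (B' j \<bullet> B l)" using rep_cmp[OF r(1) r(2)] jl by metis
    moreover have "b' j \<cdot> b l = scl C (if j = l then 1 else 0) (\<iota> (T j))" using d(2)[OF jl] by simp
    moreover have "rep (fleaf (T j)) (fleaf (T j)) (scl C a (\<iota> (T j))) (sscl a (sid [T j]))" for a
      using rep_scl[OF rep_id[of "fleaf (T j)" "T j"]] by simp
    ultimately show ?thesis using rep_unique by metis
  qed
  moreover have "ssum xs xs {..<n} (\<lambda>j. B j \<bullet> B' j) = sid xs"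
  proof (rule rep_unique[of ?w ?w "\<iota> (ob xs)"])
    show "rep ?w ?w (\<iota> (ob xs)) (ssum xs xs {..<n} (\<lambda>j. B j \<bullet> B' j))"
      unfolding d(3)[symmetric] by (rule rep_sum) (use rep_cmp[OF r(2) r(1)] in simp_all)
    show "rep ?w ?w (\<iota> (ob xs)) (sid xs)" using rep_id[of ?w "ob xs"] by simp
  qed
  moreover have "T j \<in> I \<and> hm (B j) [T j] xs \<and> hm (B' j) xs [T j]" if "j < n" for j
    using rep_hm[OF r(1)[OF that]] rep_hm[OF r(2)[OF that]] d(1)[OF that] by simp
  ultimately show ?thesis
    unfolding decomposes_def by (intro exI[of _ n] exI[of _ T] exI[of _ B] exI[of _ B']) simp
qed

lemma strict_hom_I:
  assumes "S \<in> I" "T \<in> I" "hm u [S] [T]"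
  shows "S \<noteq> T \<Longrightarrow> mor u = 0" and "S = T \<Longrightarrow> \<exists>a. u = sscl a (sid [S])"
proof -
  obtain f where f: "rep (fleaf S) (fleaf T) f u" using rep_ex'[of "fleaf S" "fleaf T" u] assms by auto
  then have fh: "f \<in> hom C S T" using rep_hom by fastforce
  show "mor u = 0" if "S \<noteq> T"
  proof -
    \<comment> \<open>Vanishing passes through \<open>rep\<close> in the form of being fixed by the
      scalar 0.\<close>
    have "rep (fleaf S) (fleaf T) (scl C 0 f) (sscl 0 u)" by (rule rep_scl[OF f])
    moreover have "scl C 0 f = f" using hom_I_zero[OF assms(1,2) that fh] by simp
    ultimately have "u = sscl 0 u" using f rep_unique by metis
    then have "mor u = mor (sscl 0 u)" by metis
    then show ?thesis by (simp add: sscl_def)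
  qed
  show "\<exists>a. u = sscl a (sid [S])" if ST: "S = T"
  proof -
    obtain a where "f = scl C a (\<iota> S)" using simple_endo_scalar[OF simple_I[OF assms(1)], of f] fh ST by auto
    moreover have "rep (fleaf S) (fleaf S) (scl C a (\<iota> S)) (sscl a (sid [S]))"
      using rep_scl[OF rep_id[of "fleaf S" S]] by simp
    ultimately show ?thesis using f ST rep_unique by metis
  qed
qed

text \<open>Since \<open>ob [S]\<close> is \<open>S \<otimes> \<one>\<close>, nonvanishing has to be
  carried over from \<open>S\<close> along the right unitor.\<close>

lemma sid_I_nonzero: "S \<in> I \<Longrightarrow> \<iota> (ob [S]) \<noteq> 0" "\<iota> (ob []) \<noteq> 0"
proof -
  show "\<iota> (ob []) \<noteq> 0" using unit_simple by (simp add: simple_object_def)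
  assume "S \<in> I"
  then have "\<iota> S \<noteq> 0" using simple_I by (simp add: simple_object_def)
  then show "\<iota> (ob [S]) \<noteq> 0"
    using run_natural[OF id_hom, of S] id_right[OF run_hom[of S]] id_left[OF run_hom[of S]]
      inv_mor_inverses[OF run_iso, of S] cmp_zero_right[OF run_hom[of S]] tmo_id[of S \<one>]
      cmp_zero_left[of "inv_mor C (S \<otimes> \<one>) S (run C S)" S "S \<otimes> \<one>"]
    by (auto simp: inverses_def)
qed

end

context words begin

lemma rep_sidI:
  assumes "frame v" "frame w" "f \<in> hom C (src v) (src w)" "trg v = trg w" "mor v = mor w \<cdot> f"
  shows "rep v w f (sid (trg v))"
  using assms id_left[OF iso_hom] by (simp add: rep_def frame_def sid_def arr_def id_hom)

text \<open>A representation may be tested after composing with a frame change that is represented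
  by an identity. In this way the coherence axioms of a monoidal functor apply as they stand, with
  no inverses to move around.\<close>

lemma rep_cancel_right:
  assumes e: "rep u v e (sid xs)" and f: "rep u w (f \<cdot> e) g" "f \<in> hom C (src v) (src w)"
  shows "rep v w f g"
proof -
  obtain h where h: "rep v w f h" using rep_ex[OF _ _ f(2)] e f by (auto simp: rep_def)
  have "scmp h (sid xs) = h" using rep_hm[OF h] rep_hm[OF e] by (intro sid_right) auto
  then have "h = g" using rep_unique[OF rep_cmp[OF e h] f(1)] by simp
  then show ?thesis using h by simp
qed

lemma rep_cancel_left:
  assumes e: "rep v w e (sid xs)" and f: "rep u w (e \<cdot> f) g" "f \<in> hom C (src u) (src v)"
  shows "rep u v f g"
proof -
  obtain h where h: "rep u v f h" using rep_ex[OF _ _ f(2)] e f by (auto simp: rep_def)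
  have "scmp (sid xs) h = h" using rep_hm[OF h] rep_hm[OF e] by (intro sid_left) auto
  then have "h = g" using rep_unique[OF rep_cmp[OF h e] f(1)] by simp
  then show ?thesis using h by simp
qed

end

section \<open>Strictification of a monoidal functor\<close>

sublocale monoidal_functor \<subseteq> C: words C "\<lambda>x. x" ..
sublocale monoidal_functor \<subseteq> D: words D "fob M" ..

context monoidal_functor begin

abbreviation cmpD (infixl \<open>\<cdot>\<^sub>D\<close> 70) where "g \<cdot>\<^sub>D f \<equiv> cmp D g f"
abbreviation tobD (infixr \<open>\<otimes>\<^sub>D\<close> 75) where "A \<otimes>\<^sub>D B \<equiv> tob D A B"
abbreviation tmoD (infixr \<open>\<boxtimes>\<^sub>D\<close> 75) where "f \<boxtimes>\<^sub>D g \<equiv> tmo D f g"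
abbreviation idnD (\<open>\<iota>\<^sub>D\<close>) where "\<iota>\<^sub>D \<equiv> idn D"
abbreviation untD (\<open>\<one>\<^sub>D\<close>) where "\<one>\<^sub>D \<equiv> unt D"

lemmas fmu_hom = D.iso_hom[OF fmu_iso]
lemmas fun1_hom = D.iso_hom[OF fun1_iso]

lemma inv_fmu_inverses:
  "inverses D (fob M X \<otimes>\<^sub>D fob M Y) (fob M (X \<otimes>\<^bsub>C\<^esub> Y)) (fmu M X Y) (inv_fmu C D M X Y)"
  unfolding inv_fmu_def by (rule D.inv_mor_inverses[OF fmu_iso])
lemma inv_fun1_inverses: "inverses D \<one>\<^sub>D (fob M \<one>\<^bsub>C\<^esub>) (fun1 M) (inv_fun1 C D M)"
  unfolding inv_fun1_def by (rule D.inv_mor_inverses[OF fun1_iso])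

lemma fmo_iso:
  assumes "iso_mor C X Y f" shows "iso_mor D (fob M X) (fob M Y) (fmo M f)"
proof -
  obtain g where g: "inverses C X Y f g" using assms by (auto simp: iso_mor_def)
  then have "inverses D (fob M X) (fob M Y) (fmo M f) (fmo M g)"
    using fmo_hom fmo_cmp[of f X Y g X] fmo_cmp[of g Y X f Y] by (auto simp: inverses_def fmo_id)
  then show ?thesis by (auto simp: iso_mor_def)
qed

lemma fmo_sum:
  assumes "\<And>i. i \<in> A \<Longrightarrow> f i \<in> hom C X Y"
  shows "fmo M (sum f A) = (\<Sum>i\<in>A. fmo M (f i))"
  using assms
proof (induction A rule: infinite_finite_induct)
  case (insert x G)
  then show ?case using fmo_add[of "f x" X Y "sum f G"] C.sum_hom[of G f X Y] by simp
qed (use fmo_scl[OF C.zero_hom, of 0] in simp_all)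

text \<open>The frame through which \<open>M (ob xs)\<close> is the word \<open>xs\<close> of objects \<open>M x\<close>.\<close>

primrec mframe :: "'o list \<Rightarrow> 'p \<times> 'n \<times> 'o list" where
  "mframe [] = (fob M \<one>\<^bsub>C\<^esub>, inv_fun1 C D M, [])"
| "mframe (x # xs) = (fob M (x \<otimes>\<^bsub>C\<^esub> C.ob xs),
     mor (D.fnode (D.fleaf x) (mframe xs)) \<cdot>\<^sub>D inv_fmu C D M x (C.ob xs), x # xs)"

lemma mframe_src_trg [simp]: "src (mframe xs) = fob M (C.ob xs)" "trg (mframe xs) = xs"
  by (induction xs) simp_all

lemma frame_mframe [simp]: "D.frame (mframe xs)"
proof (induction xs)
  case Nil
  show ?case using D.iso_inv[OF inv_fun1_inverses] by (auto simp: D.frame_def iso_mor_def)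
next
  case (Cons x xs)
  have "iso_mor D (fob M (x \<otimes>\<^bsub>C\<^esub> C.ob xs)) (fob M x \<otimes>\<^sub>D fob M (C.ob xs)) (inv_fmu C D M x (C.ob xs))"
    using D.iso_inv[OF inv_fmu_inverses] by (auto simp: iso_mor_def)
  from D.iso_cmp[OF this] D.frame_fnode[OF D.frame_fleaf Cons.IH, of x] show ?case by (simp add: D.frame_def)
qed

lemma rep_fun1_mframe: "D.rep D.funit (mframe []) (fun1 M) (D.sid [])"
  using D.rep_sidI[of D.funit "mframe []" "fun1 M"] frame_mframe[of "[]"] fun1_hom inv_fun1_inverses
  by (simp add: inverses_def) (simp add: D.funit_def)

lemma rep_fmu_mframe:
  "D.rep (D.fnode (D.fleaf x) (mframe xs)) (mframe (x # xs)) (fmu M x (C.ob xs)) (D.sid (x # xs))"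
proof -
  let ?v = "D.fnode (D.fleaf x) (mframe xs)"
  have v: "mor ?v \<in> hom D (fob M x \<otimes>\<^sub>D fob M (C.ob xs)) (D.ob (x # xs))"
    using D.iso_hom D.frame_fnode[OF D.frame_fleaf frame_mframe, of x xs] by (simp add: D.frame_def)
  have i: "inv_fmu C D M x (C.ob xs) \<in> hom D (fob M (x \<otimes>\<^bsub>C\<^esub> C.ob xs)) (fob M x \<otimes>\<^sub>D fob M (C.ob xs))"
    "inv_fmu C D M x (C.ob xs) \<cdot>\<^sub>D fmu M x (C.ob xs) = \<iota>\<^sub>D (fob M x \<otimes>\<^sub>D fob M (C.ob xs))"
    using inv_fmu_inverses[of x "C.ob xs"] by (simp_all add: inverses_def)
  have e: "mor ?v = mor (mframe (x # xs)) \<cdot>\<^sub>D fmu M x (C.ob xs)"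
    using D.cmp_assoc[OF fmu_hom i(1) v] i(2) D.id_right[OF v] by simp
  have "D.rep ?v (mframe (x # xs)) (fmu M x (C.ob xs)) (D.sid (trg ?v))"
    by (rule D.rep_sidI[OF _ frame_mframe _ _ e]) (simp_all add: fmu_hom)
  then show ?thesis by simp
qed

text \<open>This is why \<open>M\<close> becomes strict on words: its comparison map for a
  concatenation is an identity between the frames. The empty word is \<open>fmu_lun\<close>; a
  further letter is \<open>fmu_asc\<close> together with naturality of \<open>fmu\<close>.\<close>

lemma rep_phi_mframe:
  "D.rep (D.fnode (mframe xs) (mframe ys)) (mframe (xs @ ys))
    (fmo M (C.phi xs ys) \<cdot>\<^sub>D fmu M (C.ob xs) (C.ob ys)) (D.sid (xs @ ys))"
proof (induction xs)
  case Nil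
  show ?case
  proof (rule D.rep_cancel_right)
    show "D.rep (D.fnode D.funit (mframe ys)) (D.fnode (mframe []) (mframe ys))
        (fun1 M \<boxtimes>\<^sub>D \<iota>\<^sub>D (fob M (C.ob ys))) (D.sid ys)"
      using D.rep_ten[OF rep_fun1_mframe D.rep_id[of "mframe ys"]] by (simp add: D.sten_sid)
    show "D.rep (D.fnode D.funit (mframe ys)) (mframe ([] @ ys))
        (fmo M (C.phi [] ys) \<cdot>\<^sub>D fmu M (C.ob []) (C.ob ys) \<cdot>\<^sub>D (fun1 M \<boxtimes>\<^sub>D \<iota>\<^sub>D (fob M (C.ob ys)))) (D.sid ([] @ ys))"
      using D.rep_lun[of "mframe ys"] fmu_lun[of "C.ob ys"] by simp
  qed (use D.cmp_hom[OF fmu_hom fmo_hom[OF C.lun_hom]] in simp)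
next
  case (Cons x xs)
  let ?A = "C.ob xs" and ?B = "C.ob ys" and ?R = "C.ob (xs @ ys)" and ?i = "\<iota>\<^sub>D (fob M x)"
  let ?e = "fmu M x ?A \<boxtimes>\<^sub>D \<iota>\<^sub>D (fob M ?B)" and ?a = "asc D (fob M x) (fob M ?A) (fob M ?B)"
  let ?p = "fmo M (\<iota>\<^bsub>C\<^esub> x \<boxtimes>\<^bsub>C\<^esub> C.phi xs ys)"
  have e: "?e \<in> hom D ((fob M x \<otimes>\<^sub>D fob M ?A) \<otimes>\<^sub>D fob M ?B) (fob M (x \<otimes>\<^bsub>C\<^esub> ?A) \<otimes>\<^sub>D fob M ?B)"
    and f: "?i \<boxtimes>\<^sub>D fmu M ?A ?B \<in> hom D (fob M x \<otimes>\<^sub>D fob M ?A \<otimes>\<^sub>D fob M ?B) (fob M x \<otimes>\<^sub>D fob M (?A \<otimes>\<^bsub>C\<^esub> ?B))"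
    and i: "?i \<boxtimes>\<^sub>D fmo M (C.phi xs ys) \<in> hom D (fob M x \<otimes>\<^sub>D fob M (?A \<otimes>\<^bsub>C\<^esub> ?B)) (fob M x \<otimes>\<^sub>D fob M ?R)"
    and p: "?p \<in> hom D (fob M (x \<otimes>\<^bsub>C\<^esub> ?A \<otimes>\<^bsub>C\<^esub> ?B)) (fob M (x \<otimes>\<^bsub>C\<^esub> ?R))"
    by (rule D.hom_rules fmu_hom fmo_hom C.phi_hom C.hom_rules)+
  note a = fmo_hom[OF C.asc_hom[of x ?A ?B]]
  have P: "fmo M (C.phi (x # xs) ys) = ?p \<cdot>\<^sub>D fmo M (asc C x ?A ?B)"
    using fmo_cmp[OF C.asc_hom C.tmo_hom[OF C.id_hom C.phi_hom], of x xs ys] by simp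
  have "fmo M (C.phi (x # xs) ys) \<cdot>\<^sub>D fmu M (x \<otimes>\<^bsub>C\<^esub> ?A) ?B \<cdot>\<^sub>D ?e
      = ?p \<cdot>\<^sub>D (fmo M (asc C x ?A ?B) \<cdot>\<^sub>D fmu M (x \<otimes>\<^bsub>C\<^esub> ?A) ?B \<cdot>\<^sub>D ?e)"
    unfolding P using D.cmp_assoc[OF fmu_hom a p] D.cmp_assoc[OF e D.cmp_hom[OF fmu_hom a] p] by simp
  also have "\<dots> = (?p \<cdot>\<^sub>D fmu M x (?A \<otimes>\<^bsub>C\<^esub> ?B)) \<cdot>\<^sub>D ((?i \<boxtimes>\<^sub>D fmu M ?A ?B) \<cdot>\<^sub>D ?a)"
    unfolding fmu_asc[symmetric]
    using D.cmp_assoc[OF D.cmp_hom[OF D.asc_hom f] fmu_hom p] D.cmp_assoc[OF D.asc_hom f fmu_hom] by simp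
  also have "?p \<cdot>\<^sub>D fmu M x (?A \<otimes>\<^bsub>C\<^esub> ?B) = fmu M x ?R \<cdot>\<^sub>D (?i \<boxtimes>\<^sub>D fmo M (C.phi xs ys))"
    using fmu_natural[OF C.id_hom C.phi_hom, of x xs ys] by (simp add: fmo_id)
  also have "\<dots> \<cdot>\<^sub>D ((?i \<boxtimes>\<^sub>D fmu M ?A ?B) \<cdot>\<^sub>D ?a)
      = fmu M x ?R \<cdot>\<^sub>D ((?i \<boxtimes>\<^sub>D (fmo M (C.phi xs ys) \<cdot>\<^sub>D fmu M ?A ?B)) \<cdot>\<^sub>D ?a)"
    using D.cmp_assoc[OF D.cmp_hom[OF D.asc_hom f] i fmu_hom] D.cmp_assoc[OF D.asc_hom f i]
      D.lwhisker_cmp[OF fmu_hom fmo_hom[OF C.phi_hom]] by simp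
  finally have eq: "fmo M (C.phi (x # xs) ys) \<cdot>\<^sub>D fmu M (x \<otimes>\<^bsub>C\<^esub> ?A) ?B \<cdot>\<^sub>D ?e
      = fmu M x ?R \<cdot>\<^sub>D ((?i \<boxtimes>\<^sub>D (fmo M (C.phi xs ys) \<cdot>\<^sub>D fmu M ?A ?B)) \<cdot>\<^sub>D ?a)" .
  show ?case
  proof (rule D.rep_cancel_right)
    let ?u = "D.fnode (D.fnode (D.fleaf x) (mframe xs)) (mframe ys)"
    show "D.rep ?u (D.fnode (mframe (x # xs)) (mframe ys)) ?e (D.sid (x # xs @ ys))"
      using D.rep_ten[OF rep_fmu_mframe D.rep_id[of "mframe ys"]] by (simp add: D.sten_sid)
    have "D.rep ?u (mframe (x # xs @ ys)) (fmu M x ?R \<cdot>\<^sub>D ((?i \<boxtimes>\<^sub>D (fmo M (C.phi xs ys) \<cdot>\<^sub>D fmu M ?A ?B)) \<cdot>\<^sub>D ?a)) (D.sid (x # xs @ ys))"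
      by (rule D.rep_eq, (rule D.rep_rules Cons.IH rep_fmu_mframe refl | simp del: mframe.simps)+, simp add: D.sten_sid)
    then show "D.rep ?u (mframe ((x # xs) @ ys))
        (fmo M (C.phi (x # xs) ys) \<cdot>\<^sub>D fmu M (C.ob (x # xs)) ?B \<cdot>\<^sub>D ?e) (D.sid ((x # xs) @ ys))"
      unfolding C.ob.simps eq by simp
  qed (use D.cmp_hom[OF fmu_hom fmo_hom[OF C.phi_hom], of "x # xs" ys] in simp)
qed

text \<open>The strict functor. The ends are copied from \<open>f\<close>, so that
  \<open>Phi_src_trg\<close> is an unconditional simplification rule.\<close>

definition Phi :: "'o list \<times> 'm \<times> 'o list \<Rightarrow> 'o list \<times> 'n \<times> 'o list" where
  "Phi f = (src f, mor (D.st (mframe (src f)) (mframe (trg f)) (fmo M (mor f))), trg f)"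

lemma Phi_src_trg [simp]: "src (Phi f) = src f" "trg (Phi f) = trg f"
  by (simp_all add: Phi_def)

lemma rep_Phi:
  assumes "C.arr f" shows "D.rep (mframe (src f)) (mframe (trg f)) (fmo M (mor f)) (Phi f)"
proof -
  have r: "D.rep (mframe (src f)) (mframe (trg f)) (fmo M (mor f)) (D.st (mframe (src f)) (mframe (trg f)) (fmo M (mor f)))"
    using assms fmo_hom by (intro D.rep_st) (simp_all add: C.arr_def)
  then have "Phi f = D.st (mframe (src f)) (mframe (trg f)) (fmo M (mor f))"
    using D.rep_hm[OF r] by (intro triple_eqI) (simp_all add: Phi_def)
  then show ?thesis using r by simp
qed

lemma Phi_eqI: "C.arr f \<Longrightarrow> D.rep (mframe (src f)) (mframe (trg f)) (fmo M (mor f)) g \<Longrightarrow> Phi f = g"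
  using rep_Phi D.rep_unique by blast

lemma Phi_arr [simp]: "C.arr f \<Longrightarrow> D.arr (Phi f)"
  using D.rep_hm[OF rep_Phi] by blast

lemma Phi_scmp:
  assumes "C.arr f" "C.arr g" "trg f = src g"
  shows "Phi (C.scmp g f) = D.scmp (Phi g) (Phi f)"
  using assms D.rep_cmp[OF rep_Phi[OF assms(1), unfolded assms(3)] rep_Phi[OF assms(2)]]
  by (intro Phi_eqI) (simp_all add: C.scmp_def C.arr_def fmo_cmp C.cmp_hom)

lemma Phi_sid [simp]: "Phi (C.sid xs) = D.sid xs"
  by (rule Phi_eqI) (use D.rep_id[of "mframe xs"] in \<open>simp_all add: C.sid_def C.arr_def C.id_hom fmo_id\<close>)

text \<open>Naturality of \<open>fmu\<close> moves the tensor product across the comparison map, and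
  by \<open>rep_phi_mframe\<close> that map is invisible on words at both ends.\<close>

lemma Phi_sten:
  assumes "C.arr f" "C.arr g"
  shows "Phi (C.sten f g) = D.sten (Phi f) (Phi g)"
proof (rule Phi_eqI[OF C.arr_sten[OF assms] D.rep_cancel_right])
  let ?A = "C.ob (src f)" and ?B = "C.ob (src g)" and ?A' = "C.ob (trg f)" and ?B' = "C.ob (trg g)"
  let ?h = "mor (C.sten f g)"
  note s = C.sten_mor[OF assms]
  have h: "mor f \<in> hom C ?A ?A'" "mor g \<in> hom C ?B ?B'" using assms by (simp_all add: C.arr_def)
  have m: "fmo M (mor f) \<boxtimes>\<^sub>D fmo M (mor g) \<in> hom D (fob M ?A \<otimes>\<^sub>D fob M ?B) (fob M ?A' \<otimes>\<^sub>D fob M ?B')"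
    by (rule D.hom_rules fmo_hom h)+
  note t = C.tmo_hom[OF h] and p = C.phi_hom[of "src f" "src g"] and p' = C.phi_hom[of "trg f" "trg g"]
  have "fmo M ?h \<cdot>\<^sub>D (fmo M (C.phi (src f) (src g)) \<cdot>\<^sub>D fmu M ?A ?B)
      = fmo M (C.phi (trg f) (trg g) \<cdot>\<^bsub>C\<^esub> (mor f \<boxtimes>\<^bsub>C\<^esub> mor g)) \<cdot>\<^sub>D fmu M ?A ?B"
    using D.cmp_assoc[OF fmu_hom fmo_hom[OF p] fmo_hom[OF s(2)]] fmo_cmp[OF p s(2)] s(1) by simp
  also have "\<dots> = (fmo M (C.phi (trg f) (trg g)) \<cdot>\<^sub>D fmu M ?A' ?B') \<cdot>\<^sub>D (fmo M (mor f) \<boxtimes>\<^sub>D fmo M (mor g))"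
    using D.cmp_assoc[OF fmu_hom fmo_hom[OF t] fmo_hom[OF p']] fmo_cmp[OF t p'] fmu_natural[OF h]
      D.cmp_assoc[OF m fmu_hom fmo_hom[OF p']] by simp
  finally show "D.rep (D.fnode (mframe (src f)) (mframe (src g))) (mframe (trg (C.sten f g)))
      (fmo M ?h \<cdot>\<^sub>D (fmo M (C.phi (src f) (src g)) \<cdot>\<^sub>D fmu M ?A ?B)) (D.sten (Phi f) (Phi g))"
    using D.rep_cmp[OF D.rep_ten[OF rep_Phi[OF assms(1)] rep_Phi[OF assms(2)]] rep_phi_mframe] assms by simp
  show "D.rep (D.fnode (mframe (src f)) (mframe (src g))) (mframe (src (C.sten f g)))
      (fmo M (C.phi (src f) (src g)) \<cdot>\<^sub>D fmu M ?A ?B) (D.sid (src f @ src g))"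
    using rep_phi_mframe by simp
  show "fmo M ?h \<in> hom D (src (mframe (src (C.sten f g)))) (src (mframe (trg (C.sten f g))))"
    using fmo_hom[OF s(2)] by simp
qed

lemma Phi_wh: "C.arr f \<Longrightarrow> Phi (C.wh xs f ys) = D.wh xs (Phi f) ys"
  by (simp add: C.wh_def D.wh_def Phi_sten)

lemma Phi_sscl: "C.arr f \<Longrightarrow> Phi (C.sscl a f) = D.sscl a (Phi f)"
  using D.rep_scl[OF rep_Phi] by (intro Phi_eqI) (simp_all add: C.sscl_def C.arr_def fmo_scl C.scl_hom)

lemma Phi_ssum:
  assumes h: "\<And>i. i \<in> A \<Longrightarrow> C.hm (f i) xs ys"
  shows "Phi (C.ssum xs ys A f) = D.ssum xs ys A (\<lambda>i. Phi (f i))"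
proof (rule Phi_eqI)
  have "fmo M (mor (C.ssum xs ys A f)) = (\<Sum>i\<in>A. fmo M (mor (f i)))"
    unfolding C.ssum_def triple_simps by (rule fmo_sum) (rule C.mor_hom[OF h])
  moreover have "D.rep (mframe xs) (mframe ys) (fmo M (mor (f i))) (Phi (f i))" if "i \<in> A" for i
    using rep_Phi[of "f i"] h[OF that] by simp
  ultimately show "D.rep (mframe (src (C.ssum xs ys A f))) (mframe (trg (C.ssum xs ys A f)))
      (fmo M (mor (C.ssum xs ys A f))) (D.ssum xs ys A (\<lambda>i. Phi (f i)))"
    using D.rep_sum[of "mframe xs" "mframe ys" A "\<lambda>i. fmo M (mor (f i))" "\<lambda>i. Phi (f i)"] by simp
qed (use h in simp)

text \<open>The image of a frame under \<open>M\<close>: where \<open>v\<close> presents an object,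
  this presents its image by the same word. Between such frames \<open>fmu\<close> and
  \<open>fun1\<close> become identities and \<open>fmo M\<close> becomes \<open>Phi\<close>.\<close>

definition ffr :: "'o \<times> 'm \<times> 'o list \<Rightarrow> 'p \<times> 'n \<times> 'o list" where
  "ffr v = (fob M (src v), mor (mframe (trg v)) \<cdot>\<^sub>D fmo M (mor v), trg v)"

lemma ffr_simps [simp]: "src (ffr v) = fob M (src v)" "trg (ffr v) = trg v"
  by (simp_all add: ffr_def)

lemma ffr_frame [simp]: "C.frame v \<Longrightarrow> D.frame (ffr v)"
  using D.iso_cmp[OF fmo_iso, of "src v" "C.ob (trg v)" "mor v"] frame_mframe[of "trg v"]
  by (simp add: C.frame_def D.frame_def ffr_def)

lemma rep_ffr: "C.frame v \<Longrightarrow> D.rep (ffr v) (mframe (trg v)) (fmo M (mor v)) (D.sid (trg v))"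
  using D.rep_sidI[of "ffr v" "mframe (trg v)" "fmo M (mor v)"] fmo_hom[OF C.iso_hom] ffr_frame[of v]
  by (simp add: C.frame_def) (simp add: ffr_def)

lemma rep_fmo:
  assumes "C.rep v w f g" shows "D.rep (ffr v) (ffr w) (fmo M f) (Phi g)"
proof (rule D.rep_cancel_left[OF rep_ffr])
  have g: "C.arr g" "src g = trg v" "trg g = trg w" and fr: "C.frame v" "C.frame w"
    and e: "mor g \<cdot>\<^bsub>C\<^esub> mor v = mor w \<cdot>\<^bsub>C\<^esub> f" using assms by (auto simp: C.rep_def)
  have h: "mor v \<in> hom C (src v) (C.ob (trg v))" "mor w \<in> hom C (src w) (C.ob (trg w))"
    "mor g \<in> hom C (C.ob (trg v)) (C.ob (trg w))"
    using fr g C.iso_hom by (auto simp: C.frame_def C.arr_def)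
  show "C.frame w" by (rule fr)
  show "fmo M f \<in> hom D (src (ffr v)) (src (ffr w))" using fmo_hom[OF C.rep_hom[OF assms]] by simp
  show "D.rep (ffr v) (mframe (trg w)) (fmo M (mor w) \<cdot>\<^sub>D fmo M f) (Phi g)"
    using D.rep_cmp[OF rep_ffr[OF fr(1)] rep_Phi[OF g(1), unfolded g]] g
      fmo_cmp[OF h(1,3)] fmo_cmp[OF C.rep_hom[OF assms] h(2)] e by simp
qed

lemma rep_fmu:
  assumes fr: "C.frame v" "C.frame w" and XY: "X = src v" "Y = src w"
  shows "D.rep (D.fnode (ffr v) (ffr w)) (ffr (C.fnode v w)) (fmu M X Y) (D.sid (trg v @ trg w))"
proof (rule D.rep_cancel_left[OF rep_ffr])
  let ?A = "C.ob (trg v)" and ?B = "C.ob (trg w)"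
  have h: "mor v \<in> hom C X ?A" "mor w \<in> hom C Y ?B" using assms C.iso_hom by (auto simp: C.frame_def)
  note t = C.tmo_hom[OF h] and p = C.phi_hom[of "trg v" "trg w"]
  have m: "fmo M (mor v) \<boxtimes>\<^sub>D fmo M (mor w) \<in> hom D (fob M X \<otimes>\<^sub>D fob M Y) (fob M ?A \<otimes>\<^sub>D fob M ?B)"
    by (rule D.hom_rules fmo_hom h)+
  have "fmo M (mor (C.fnode v w)) \<cdot>\<^sub>D fmu M X Y
      = (fmo M (C.phi (trg v) (trg w)) \<cdot>\<^sub>D fmu M ?A ?B) \<cdot>\<^sub>D (fmo M (mor v) \<boxtimes>\<^sub>D fmo M (mor w))"
    using D.cmp_assoc[OF fmu_hom fmo_hom[OF t] fmo_hom[OF p]] fmo_cmp[OF t p] fmu_natural[OF h]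
      D.cmp_assoc[OF m fmu_hom fmo_hom[OF p]] by (simp add: C.fnode_def)
  then show "D.rep (D.fnode (ffr v) (ffr w)) (mframe (trg (C.fnode v w)))
      (fmo M (mor (C.fnode v w)) \<cdot>\<^sub>D fmu M X Y) (D.sid (trg v @ trg w))"
    using D.rep_cmp[OF D.rep_ten[OF rep_ffr[OF fr(1)] rep_ffr[OF fr(2)]] rep_phi_mframe] by (simp add: D.sten_sid)
  show "fmu M X Y \<in> hom D (src (D.fnode (ffr v) (ffr w))) (src (ffr (C.fnode v w)))" using fmu_hom XY by simp
qed (use fr in simp)

lemma rep_fun1: "D.rep D.funit (ffr C.funit) (fun1 M) (D.sid [])"
  by (rule D.rep_cancel_left[OF rep_ffr[OF C.frame_funit]])
    (use rep_fun1_mframe D.id_left[OF fun1_hom] fun1_hom in \<open>simp_all add: C.funit_def fmo_id\<close>)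

lemma rep_inv_fmu:
  assumes "C.frame v" "C.frame w" "X = src v" "Y = src w"
  shows "D.rep (ffr (C.fnode v w)) (D.fnode (ffr v) (ffr w)) (inv_fmu C D M X Y) (D.sid (trg v @ trg w))"
  unfolding inv_fmu_def
  using D.rep_inv_sid[of "D.fnode (ffr v) (ffr w)" "ffr (C.fnode v w)", OF _ fmu_iso] rep_fmu[OF assms] assms by simp

lemma rep_inv_fun1: "D.rep (ffr C.funit) D.funit (inv_fun1 C D M) (D.sid [])"
  unfolding inv_fun1_def
  using D.rep_inv_sid[of D.funit "ffr C.funit", OF _ fun1_iso] rep_fun1 by simp

end

context words begin

lemma ssum_delta:
  assumes "finite A" "k \<in> A" "hm x xs ys"
  shows "ssum xs ys A (\<lambda>i. sscl (if i = k then 1 else 0) x) = x"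
proof (rule triple_eqI)
  have "(\<Sum>i\<in>A. scl C (if i = k then 1 else 0) (mor x)) = (\<Sum>i\<in>A. if i = k then mor x else 0)"
    by (rule sum.cong) auto
  then show "mor (ssum xs ys A (\<lambda>i. sscl (if i = k then 1 else 0) x)) = mor x"
    using assms by (simp add: ssum_def sscl_def)
qed (use assms in simp_all)

lemma ssum_restrict:
  assumes "finite A" "B \<subseteq> A" "\<And>i. i \<in> A - B \<Longrightarrow> mor (h i) = 0"
  shows "ssum xs ys A h = ssum xs ys B h"
  unfolding ssum_def using sum.mono_neutral_right[OF assms(1,2), of "\<lambda>i. mor (h i)"] assms(3) by simp

lemma mor_zero_scmp:
  assumes "arr f" "arr g" "trg f = src g" shows "mor f = 0 \<Longrightarrow> mor (scmp g f) = 0" "mor g = 0 \<Longrightarrow> mor (scmp g f) = 0"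
  using assms cmp_zero_left[of "mor f"] cmp_zero_right[of "mor g"] by (auto simp: scmp_def arr_def)

lemma zero_eq: "sscl 0 f = f \<Longrightarrow> mor f = 0"
  by (metis scale_zero_left sscl_def triple_simps(2))

end

section \<open>Duals of simple objects and nonvanishing dimensions\<close>

context premodular_simples begin

abbreviation dd where "dd \<equiv> dual C"

text \<open>A decomposition of the dual of \<open>W\<close>, bent around, writes \<open>W\<close> as a sum of duals of simple objects.\<close>

lemma dual_generate:
  assumes e: "hm e [W] ys" "hm e' [W] ys"
    and eq: "\<And>S a. S \<in> I \<Longrightarrow> hm a [dd S] [W] \<Longrightarrow> e \<bullet> a = e' \<bullet> a"
  shows "e = e'"
proof -
  obtain n T c c' where d: "\<And>j. j < (n::nat) \<Longrightarrow> T j \<in> I \<and> hm (c j) [T j] [dd W] \<and> hm (c' j) [dd W] [T j]"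
    and s: "ssum [dd W] [dd W] {..<n} (\<lambda>j. c j \<bullet> c' j) = sid [dd W]"
    using strict_decomposition[of "[dd W]"] unfolding decomposes_def by blast
  \<comment> \<open>\<open>u j\<close> and \<open>v j\<close> are the transposes of
    \<open>c' j\<close> and \<open>c j\<close>, with \<open>W\<close> in the role of a dual of
    \<open>dd W\<close>. Transposition reverses composition, so they resolve the identity of
    \<open>W\<close>.\<close>
  define h where "h j = wh [] (c' j) [W] \<bullet> scoev' W" for j
  define u where "u j = wh [] (sev (T j)) [W] \<bullet> wh [dd (T j)] (h j) []" for j
  define v where "v j = wh [] (sev' W \<bullet> wh [W] (c j) []) [dd (T j)] \<bullet> wh [W] (scoev (T j)) []" for j
  have h: "hm (h j) [] [T j, W]" if "j < n" for j using d[OF that] by (simp add: h_def)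
  have u: "hm (u j) [dd (T j)] [W]" if "j < n" for j using d[OF that] h[OF that] by (simp add: u_def)
  have v: "hm (v j) [W] [dd (T j)]" if "j < n" for j using d[OF that] by (simp add: v_def)
  have uv: "u j \<bullet> v j = wh [] (sev' W) [W] \<bullet> wh [W] (c j \<bullet> c' j) [W] \<bullet> wh [W] (scoev' W) []" if j: "j < n" for j
  proof -
    note [simp] = d[OF j] h[OF j] u[OF j] v[OF j]
    have r: "sev (T j) \<bullet> wh [] (v j) [T j] = sev' W \<bullet> wh [W] (c j) []"
      using rbend_runbend[OF adj_dual[of "T j"], of "sev' W \<bullet> wh [W] (c j) []" "[W]" "[]"] by (simp add: v_def)
    have "u j \<bullet> v j = wh [] (sev (T j)) [W] \<bullet> wh [] (v j) [T j, W] \<bullet> wh [W] (h j) []"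
      using exchange[of "v j" "h j" "[]" "[]" "[]"] by (simp add: u_def scmp_assoc)
    also have "\<dots> = wh [] (sev (T j) \<bullet> wh [] (v j) [T j]) [W] \<bullet> wh [W] (h j) []" by (simp add: wh_scmp scmp_assoc)
    finally show ?thesis unfolding r by (simp add: h_def wh_scmp scmp_assoc)
  qed
  have "ssum [W] [W] {..<n} (\<lambda>j. u j \<bullet> v j)
      = ssum [W] [W] {..<n} (\<lambda>j. wh [] (sev' W) [W] \<bullet> wh [W] (c j \<bullet> c' j) [W] \<bullet> wh [W] (scoev' W) [])"
    by (rule ssum_cong) (simp add: uv)
  also have "\<dots> = wh [] (sev' W) [W] \<bullet> wh [W] (ssum [dd W] [dd W] {..<n} (\<lambda>j. c j \<bullet> c' j)) [W] \<bullet> wh [W] (scoev' W) []"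
    using d by (subst ssum_context) simp_all
  also have "\<dots> = sid [W]" unfolding s using adj_dual'[of W] by (simp add: adj_def)
  finally have i: "ssum [W] [W] {..<n} (\<lambda>j. u j \<bullet> v j) = sid [W]" .
  have "x = ssum [W] ys {..<n} (\<lambda>j. (x \<bullet> u j) \<bullet> v j)" if x: "hm x [W] ys" for x
  proof -
    have "x = x \<bullet> ssum [W] [W] {..<n} (\<lambda>j. u j \<bullet> v j)" using x i by simp
    also have "\<dots> = ssum [W] ys {..<n} (\<lambda>j. x \<bullet> u j \<bullet> v j)"
      using x u v scmp_ssum[of x "{..<n}" "\<lambda>j. u j \<bullet> v j" "[W]"] by simp
    also have "\<dots> = ssum [W] ys {..<n} (\<lambda>j. (x \<bullet> u j) \<bullet> v j)"
      using x u v by (intro ssum_cong) (simp add: scmp_assoc)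
    finally show ?thesis .
  qed
  note x = this[OF e(1)] this[OF e(2)]
  have "ssum [W] ys {..<n} (\<lambda>j. (e \<bullet> u j) \<bullet> v j) = ssum [W] ys {..<n} (\<lambda>j. (e' \<bullet> u j) \<bullet> v j)"
  proof (rule ssum_cong)
    fix j assume "j \<in> {..<n}"
    then have "e \<bullet> u j = e' \<bullet> u j" using eq[of "T j" "u j"] d u by simp
    then show "(e \<bullet> u j) \<bullet> v j = (e' \<bullet> u j) \<bullet> v j" by simp
  qed
  then show ?thesis using x by metis
qed

text \<open>The word \<open>xs\<close> is replaced by the single letter \<open>ob xs\<close> through
  the mutually inverse arrows \<open>m\<close> and \<open>m'\<close>, both of which represent the
  identity of \<open>ob xs\<close>.\<close>

lemma dual_generate_word:
  assumes e: "hm e xs ys" "hm e' xs ys"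
    and eq: "\<And>S a. S \<in> I \<Longrightarrow> hm a [dd S] xs \<Longrightarrow> e \<bullet> a = e' \<bullet> a"
  shows "e = e'"
proof -
  let ?W = "ob xs"
  define m where "m = st (fleaf ?W) (fword xs) (\<iota> ?W)"
  define m' where "m' = st (fword xs) (fleaf ?W) (\<iota> ?W)"
  have r: "rep (fleaf ?W) (fword xs) (\<iota> ?W) m" "rep (fword xs) (fleaf ?W) (\<iota> ?W) m'"
    unfolding m_def m'_def by (auto intro!: rep_st id_hom)
  have m [simp]: "arr m" "src m = [?W]" "trg m = xs" "arr m'" "src m' = xs" "trg m' = [?W]"
    using rep_hm[OF r(1)] rep_hm[OF r(2)] by simp_all
  have mm: "m \<bullet> m' = sid xs"
    using rep_inv(2)[OF r(1) _ r(2)] id_left[OF id_hom] by (simp add: inverses_def id_hom)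
  have "e \<bullet> m = e' \<bullet> m"
    by (rule dual_generate[where W="?W" and ys=ys]) (use e eq in \<open>simp_all add: scmp_assoc\<close>)
  then have "(e \<bullet> m) \<bullet> m' = (e' \<bullet> m) \<bullet> m'" by simp
  then show ?thesis using e mm by (simp add: scmp_assoc)
qed

text \<open>Closing \<open>h\<close> to a theta graph, first along \<open>S\<close> or first along \<open>T\<close>, needs only the interchange law.\<close>

lemma theta:
  assumes h: "hm h [dd S, T] [dd S, T]"
    and l: "wh [] (sev' S) [T] \<bullet> wh [S] h [] \<bullet> wh [] (scoev S) [T] = sscl l (sid [T])"
    and m: "wh [dd S] (sev' T) [] \<bullet> wh [] h [dd T] \<bullet> wh [dd S] (scoev T) [] = sscl m (sid [dd S])"
  shows "l * qdim C T = m * qdim C S"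
proof -
  note [simp] = h
  have "sscl (l * qdim C T) (sid []) = sev' T \<bullet> wh [] (sscl l (sid [T])) [dd T] \<bullet> scoev T"
    by (simp add: wh_sscl sscl_scmp scmp_sscl dim_right)
  also have "\<dots> = sev' T \<bullet> wh [] (sev' S) [T, dd T] \<bullet> wh [S] h [dd T] \<bullet> wh [] (scoev S) [T, dd T] \<bullet> scoev T"
    unfolding l[symmetric] by (simp add: wh_scmp scmp_assoc)
  also have "\<dots> = (sev' T \<bullet> wh [] (sev' S) [T, dd T]) \<bullet> wh [S] h [dd T] \<bullet> wh [S, dd S] (scoev T) [] \<bullet> scoev S"
    using exchange[of "scoev S" "scoev T" "[]" "[]" "[]"] by (simp add: scmp_assoc)
  also have "sev' T \<bullet> wh [] (sev' S) [T, dd T] = sev' S \<bullet> wh [S, dd S] (sev' T) []"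
    using exchange[of "sev' S" "sev' T" "[]" "[]" "[]"] by simp
  also have "(sev' S \<bullet> wh [S, dd S] (sev' T) []) \<bullet> wh [S] h [dd T] \<bullet> wh [S, dd S] (scoev T) [] \<bullet> scoev S
     = sev' S \<bullet> wh [S] (wh [dd S] (sev' T) [] \<bullet> wh [] h [dd T] \<bullet> wh [dd S] (scoev T) []) [] \<bullet> scoev S"
    by (simp add: wh_scmp scmp_assoc)
  also have "\<dots> = sscl (m * qdim C S) (sid [])"
    unfolding m by (simp add: wh_sscl sscl_scmp scmp_sscl dim_right)
  finally show ?thesis using sscl_sid_eqD sid_I_nonzero(2) by blast
qed

text \<open>Schur's lemma for duals of members of \<open>I\<close>, which need not belong to
  \<open>I\<close> themselves: \<open>u\<close> is the transpose of an arrow \<open>v\<close> from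
  \<open>S\<close> to \<open>R\<close>, to which \<open>strict_hom_I\<close> applies.\<close>

lemma dual_hom_I:
  assumes I: "S \<in> I" "R \<in> I" and u: "hm u [dd R] [dd S]"
  shows "S \<noteq> R \<Longrightarrow> mor u = 0" and "S = R \<Longrightarrow> \<exists>a. u = sscl a (sid [dd S])"
proof -
  note [simp] = u
  define g where "g = wh [R] u [] \<bullet> scoev R"
  have g [simp]: "arr g" "src g = []" "trg g = [R, dd S]" by (simp_all add: g_def)
  have gu: "wh [] (sev R) [dd S] \<bullet> wh [dd R] g [] = u"
    using lbend_lunbend[OF adj_dual[of R], of u "[]" "[dd S]"] by (simp add: g_def)
  define v where "v = wh [R] (sev S) [] \<bullet> wh [] g [S]"
  have v [simp]: "arr v" "src v = [S]" "trg v = [R]" by (simp_all add: v_def)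
  have vg: "wh [] v [dd S] \<bullet> scoev S = g"
    using runbend_rbend[OF adj_dual[of S], of g "[]" "[R]"] by (simp add: v_def)
  \<comment> \<open>Transposing back is linear, so a scalar found for \<open>v\<close> is one for
    \<open>u\<close>. The scalar 0 covers vanishing and \<open>v' = sid [S]\<close> covers the
    multiples of the identity.\<close>
  have sc: "u = sscl a u'" if "v = sscl a v'" "arr v'" "src v' = [S]" "trg v' = [R]"
    "u' = wh [] (sev R) [dd S] \<bullet> wh [dd R] (wh [] v' [dd S] \<bullet> scoev S) []" for a v' u'
  proof -
    have "g = sscl a (wh [] v' [dd S] \<bullet> scoev S)"
      using vg that by (simp add: wh_sscl sscl_scmp)
    then show ?thesis using gu that by (simp add: wh_sscl scmp_sscl)
  qed
  show "mor u = 0" if "S \<noteq> R"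
  proof -
    have "mor v = 0" using strict_hom_I(1)[OF I(1,2), of v] that by simp
    then have "v = sscl 0 v" using sscl_zero[of v 0] by simp
    then have "u = sscl 0 u" using sc[of 0 v u] vg gu by simp
    then show ?thesis using zero_eq[of u] by simp
  qed
  show "\<exists>a. u = sscl a (sid [dd S])" if SR: "S = R"
  proof -
    obtain a where "v = sscl a (sid [S])" using strict_hom_I(2)[OF I(1,2), of v] SR by auto
    then have "u = sscl a (wh [] (sev R) [dd S] \<bullet> wh [dd R] (wh [] (sid [S]) [dd S] \<bullet> scoev S) [])"
      using sc[of a "sid [S]"] SR by simp
    also have "\<dots> = sscl a (sid [dd S])" using SR adj_dual[of S] by (simp add: adj_def)
    finally show ?thesis by blast
  qed
qed

text \<open>If the dimension of \<open>S\<close> vanished, every morphism from \<open>[S, dd S]\<close> to the unit, being a multiple of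
  \<open>sev' S\<close>, would kill \<open>scoev S\<close>; by semisimplicity \<open>scoev S\<close> itself would vanish.\<close>

lemma qdim_nonzero:
  assumes S: "S \<in> I" shows "qdim C S \<noteq> 0"
proof
  assume q: "qdim C S = 0"
  \<comment> \<open>The words \<open>[]\<close> and \<open>[\<one>]\<close> differ although both
    stand for the unit. Only the second is a single letter from \<open>I\<close>, to which Schur's
    lemma applies, so \<open>u\<close> and \<open>u'\<close> translate between them.\<close>
  define u where "u = st funit (fleaf \<one>) (\<iota> \<one>)"
  define u' where "u' = st (fleaf \<one>) funit (\<iota> \<one>)"
  have r: "rep funit (fleaf \<one>) (\<iota> \<one>) u" "rep (fleaf \<one>) funit (\<iota> \<one>) u'"
    unfolding u_def u'_def by (auto intro!: rep_st id_hom)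
  have [simp]: "arr u" "src u = []" "trg u = [\<one>]" "arr u'" "src u' = [\<one>]" "trg u' = []"
    using rep_hm[OF r(1)] rep_hm[OF r(2)] by simp_all
  have uu: "u' \<bullet> u = sid []" "u \<bullet> u' = sid [\<one>]"
    using rep_inv[OF r(1) _ r(2)] id_left[OF id_hom] by (simp_all add: inverses_def id_hom)
  have p0: "mor (p \<bullet> scoev S) = 0" if p: "hm p [S, dd S] []" for p
  proof -
    note [simp] = p
    obtain a where a: "wh [] p [S] \<bullet> wh [S] (scoev' S) [] = sscl a (sid [S])"
      using strict_hom_I(2)[OF S S, of "wh [] p [S] \<bullet> wh [S] (scoev' S) []"] by auto
    have "sev' S \<bullet> wh [] (wh [] p [S] \<bullet> wh [S] (scoev' S) []) [dd S] = p"
      using rbend_runbend[OF adj_dual'[of S], of p "[S]" "[]"] by simp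
    then have "p = sscl a (sev' S)" unfolding a by (simp add: wh_sscl scmp_sscl)
    then have "p \<bullet> scoev S = sscl (a * 0) (sid [])" using q by (simp add: sscl_scmp dim_right)
    then show ?thesis by (simp add: sscl_def)
  qed
  obtain n T b b' where d: "\<And>j. j < (n::nat) \<Longrightarrow> T j \<in> I \<and> hm (b j) [T j] [S, dd S] \<and> hm (b' j) [S, dd S] [T j]"
    and s: "ssum [S, dd S] [S, dd S] {..<n} (\<lambda>j. b j \<bullet> b' j) = sid [S, dd S]"
    using strict_decomposition[of "[S, dd S]"] unfolding decomposes_def by blast
  have z: "mor (b' j \<bullet> scoev S) = 0" if j: "j < n" for j
  proof -
    note [simp] = d[OF j]
    show ?thesis
    proof (cases "T j = \<one>")
      case True
      have "b' j \<bullet> scoev S = u \<bullet> (u' \<bullet> b' j) \<bullet> scoev S"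
        using uu True d[OF j] scmp_assoc[of "b' j \<bullet> scoev S" u' u] by (simp add: scmp_assoc)
      moreover have "mor ((u' \<bullet> b' j) \<bullet> scoev S) = 0" using p0[of "u' \<bullet> b' j"] True by simp
      ultimately show ?thesis using mor_zero_scmp(1)[of "(u' \<bullet> b' j) \<bullet> scoev S" u] True by simp
    next
      case False
      have "b' j \<bullet> scoev S = ((b' j \<bullet> scoev S) \<bullet> u') \<bullet> u" using uu by (simp add: scmp_assoc)
      moreover have "mor ((b' j \<bullet> scoev S) \<bullet> u') = 0"
        using strict_hom_I(1)[OF one_I, of "T j" "(b' j \<bullet> scoev S) \<bullet> u'"] False by simp
      ultimately show ?thesis using mor_zero_scmp(2)[of u "(b' j \<bullet> scoev S) \<bullet> u'"] by simp
    qed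
  qed
  have "scoev S = ssum [S, dd S] [S, dd S] {..<n} (\<lambda>j. b j \<bullet> b' j) \<bullet> scoev S" unfolding s by simp
  also have "\<dots> = ssum [] [S, dd S] {..<n} (\<lambda>j. (b j \<bullet> b' j) \<bullet> scoev S)"
    using d ssum_scmp[of "scoev S" "{..<n}" "\<lambda>j. b j \<bullet> b' j" "[S, dd S]"] by simp
  also have "\<dots> = ssum [] [S, dd S] {..<n} (\<lambda>j. b j \<bullet> b' j \<bullet> scoev S)"
    using d by (intro ssum_cong) (simp add: scmp_assoc)
  finally have e: "scoev S = ssum [] [S, dd S] {..<n} (\<lambda>j. b j \<bullet> b' j \<bullet> scoev S)" .
  have "mor (scoev S) = mor (ssum [] [S, dd S] {..<n} (\<lambda>j. b j \<bullet> b' j \<bullet> scoev S))"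
    using arg_cong[OF e, of mor] .
  also have "\<dots> = (\<Sum>j<n. mor (b j \<bullet> b' j \<bullet> scoev S))" by (simp add: ssum_def)
  also have "\<dots> = 0"
  proof (rule sum.neutral, rule ballI)
    fix j assume "j \<in> {..<n}"
    then show "mor (b j \<bullet> b' j \<bullet> scoev S) = 0"
      using d[of j] z[of j] mor_zero_scmp(1)[of "b' j \<bullet> scoev S" "b j"] by simp
  qed
  finally have "scoev S = sscl 0 (scoev S)" using sscl_zero[of "scoev S" 0] by simp
  then have "sid [S] = sscl 0 (wh [S] (sev S) [] \<bullet> wh [] (scoev S) [S])"
    using adj_dual[of S] wh_sscl[of "scoev S" "[]" 0 "[S]"] scmp_sscl[of "wh [] (scoev S) [S]" "wh [S] (sev S) []" 0]
    by (simp add: adj_def)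
  then have "mor (sid [S]) = 0" by (simp add: sscl_def)
  then show False using sid_I_nonzero(1)[OF S] by (simp add: sid_def)
qed

end

section \<open>Rotating dual bases of trivalent vertices\<close>

locale fusion_expansion = premodular_simples C I
  for C :: "('k::alg_closed_field, 'o, 'm::ab_group_add, 'z) brcat_scheme" (structure) and I +
  fixes Z :: 'o and n :: "'o \<Rightarrow> nat" and T :: "'o \<Rightarrow> nat \<Rightarrow> 'o" and b b' :: "'o \<Rightarrow> nat \<Rightarrow> 'o list \<times> 'm \<times> 'o list"
  assumes decomp: "\<And>S. decomposes [S, Z] (n S) (T S) (b S) (b' S)"
begin

lemma dec: "j < n S \<Longrightarrow> T S j \<in> I \<and> hm (b S j) [T S j] [S, Z] \<and> hm (b' S j) [S, Z] [T S j]"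
  and dec_dual: "j < n S \<Longrightarrow> l < n S \<Longrightarrow> T S j = T S l
      \<Longrightarrow> b' S j \<bullet> b S l = sscl (if j = l then 1 else 0) (sid [T S j])"
  and dec_sum: "ssum [S, Z] [S, Z] {..<n S} (\<lambda>j. b S j \<bullet> b' S j) = sid [S, Z]"
  using decomp[of S] unfolding decomposes_def by blast+

text \<open>The rotations of a trivalent vertex. First the leg \<open>S\<close> is bent away, which
  gives arrows between \<open>[dd S, T S j]\<close> and \<open>[Z]\<close>; then the leg
  \<open>T S j\<close> is bent, which gives arrows between \<open>[dd S]\<close> and
  \<open>[Z, dd (T S j)]\<close>.\<close>

definition bend_in where "bend_in S j = wh [] (sev S) [Z] \<bullet> wh [dd S] (b S j) []"
definition bend_out where "bend_out S j = wh [dd S] (b' S j) [] \<bullet> wh [] (scoev' S) [Z]"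
definition dual_in where "dual_in S j = wh [] (bend_in S j) [dd (T S j)] \<bullet> wh [dd S] (scoev (T S j)) []"
definition dual_out where "dual_out S j = wh [dd S] (sev' (T S j)) [] \<bullet> wh [] (bend_out S j) [dd (T S j)]"
definition summands where "summands S R = {j. j < n S \<and> T S j = R}"

lemma dec_arr:
  assumes "S \<in> I" "j < n S"
  shows "arr (b S j)" "src (b S j) = [T S j]" "trg (b S j) = [S, Z]"
    "arr (b' S j)" "trg (b' S j) = [T S j]" "src (b' S j) = [S, Z]"
    "arr (bend_in S j)" "src (bend_in S j) = [dd S, T S j]" "trg (bend_in S j) = [Z]"
    "arr (bend_out S j)" "trg (bend_out S j) = [dd S, T S j]" "src (bend_out S j) = [Z]"
    "arr (dual_in S j)" "src (dual_in S j) = [dd S]" "trg (dual_in S j) = [Z, dd (T S j)]"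
    "arr (dual_out S j)" "trg (dual_out S j) = [dd S]" "src (dual_out S j) = [Z, dd (T S j)]"
  using dec[OF assms(2)] by (simp_all add: bend_in_def bend_out_def dual_in_def dual_out_def)

lemma ev_dual_in: assumes "S \<in> I" "j < n S" shows "wh [Z] (sev (T S j)) [] \<bullet> wh [] (dual_in S j) [T S j] = bend_in S j"
  using rbend_runbend[OF adj_dual[of "T S j"], of "bend_in S j" "[dd S]" "[Z]"] dec_arr[OF assms] by (simp add: dual_in_def)

lemma dual_out_coev: assumes "S \<in> I" "j < n S" shows "wh [] (dual_out S j) [T S j] \<bullet> wh [Z] (scoev' (T S j)) [] = bend_out S j"
  using runbend_rbend[OF adj_dual'[of "T S j"], of "bend_out S j" "[Z]" "[dd S]"] dec_arr[OF assms] by (simp add: dual_out_def)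

text \<open>Rotation keeps the bases dual up to a scalar. Schur's lemma gives some \<open>m\<close>;
  the box \<open>?h\<close> closes to a theta graph worth \<open>m * qdim C S\<close> in one way,
  and \<open>qdim C T\<close> or 0 in the other by duality of the original bases.\<close>

lemma dual_out_dual_in:
  assumes S: "S \<in> I" and i: "i < n S" and j: "j < n S" and T: "T S i = T S j"
  shows "dual_out S i \<bullet> dual_in S j = sscl (if i = j then qdim C (T S j) / qdim C S else 0) (sid [dd S])"
proof -
  let ?T = "T S j" and ?h = "bend_out S i \<bullet> bend_in S j"
  note [simp] = dec_arr[OF S i, unfolded T] dec_arr[OF S j]
  have h: "hm ?h [dd S, ?T] [dd S, ?T]" by simp
  have c: "dual_out S i \<bullet> dual_in S j = wh [dd S] (sev' ?T) [] \<bullet> wh [] ?h [dd ?T] \<bullet> wh [dd S] (scoev ?T) []"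
    by (simp add: dual_in_def dual_out_def T wh_scmp scmp_assoc)
  obtain m where m: "dual_out S i \<bullet> dual_in S j = sscl m (sid [dd S])"
    using dual_hom_I(2)[OF S S, of "dual_out S i \<bullet> dual_in S j"] by (auto simp: T)
  have 1: "wh [] (sev' S) [?T] \<bullet> wh [S] (bend_out S i) [] = b' S i"
    using lbend_lunbend[OF adj_dual'[of S], of "b' S i" "[Z]" "[?T]"] by (simp add: bend_out_def)
  have 2: "wh [S] (bend_in S j) [] \<bullet> wh [] (scoev S) [?T] = b S j"
    using lunbend_lbend[OF adj_dual[of S], of "b S j" "[?T]" "[Z]"] by (simp add: bend_in_def)
  have "wh [] (sev' S) [?T] \<bullet> wh [S] ?h [] \<bullet> wh [] (scoev S) [?T]
      = (wh [] (sev' S) [?T] \<bullet> wh [S] (bend_out S i) []) \<bullet> wh [S] (bend_in S j) [] \<bullet> wh [] (scoev S) [?T]"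
    by (simp add: wh_scmp scmp_assoc)
  also have "\<dots> = sscl (if i = j then 1 else 0) (sid [?T])"
    unfolding 1 2 using dec_dual[OF i j T] T by simp
  finally have "(if i = j then 1 else 0) * qdim C ?T = m * qdim C S"
    using theta[OF h _ m[unfolded c]] by blast
  then have "m = (if i = j then qdim C ?T / qdim C S else 0)"
    using qdim_nonzero[OF S] by (auto simp: field_simps)
  then show ?thesis using m by simp
qed

text \<open>Rotating \<open>\<alpha>\<close> back gives \<open>\<beta>\<close> from
  \<open>T0\<close> to \<open>R Z\<close>. There the original decomposition applies, Schur's lemma
  supplies the coefficients \<open>\<kappa>\<close> and removes the other simple objects, and
  rotating forward is linear.\<close>

lemma dual_in_span:
  assumes R: "R \<in> I" and T0: "T0 \<in> I" and \<alpha>: "hm \<alpha> [dd R] [Z, dd T0]"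
  shows "\<exists>\<kappa>. \<alpha> = ssum [dd R] [Z, dd T0] (summands R T0) (\<lambda>j. sscl (\<kappa> j) (dual_in R j))"
proof -
  note [simp] = \<alpha>
  define \<phi> where "\<phi> = wh [Z] (sev T0) [] \<bullet> wh [] \<alpha> [T0]"
  have [simp]: "arr \<phi>" "src \<phi> = [dd R, T0]" "trg \<phi> = [Z]" by (simp_all add: \<phi>_def)
  have \<alpha>\<phi>: "wh [] \<phi> [dd T0] \<bullet> wh [dd R] (scoev T0) [] = \<alpha>"
    using runbend_rbend[OF adj_dual[of T0], of \<alpha> "[dd R]" "[Z]"] by (simp add: \<phi>_def)
  define \<beta> where "\<beta> = wh [R] \<phi> [] \<bullet> wh [] (scoev R) [T0]"
  have [simp]: "arr \<beta>" "src \<beta> = [T0]" "trg \<beta> = [R, Z]" by (simp_all add: \<beta>_def)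
  have \<phi>\<beta>: "wh [] (sev R) [Z] \<bullet> wh [dd R] \<beta> [] = \<phi>"
    using lbend_lunbend[OF adj_dual[of R], of \<phi> "[T0]" "[Z]"] by (simp add: \<beta>_def)
  note da = dec_arr[OF R]
  have "\<exists>\<kappa>. \<forall>j\<in>summands R T0. b' R j \<bullet> \<beta> = sscl (\<kappa> j) (sid [T0])"
  proof (rule bchoice, rule ballI)
    fix j assume j: "j \<in> summands R T0"
    then show "\<exists>a. b' R j \<bullet> \<beta> = sscl a (sid [T0])"
      using strict_hom_I(2)[OF T0 T0, of "b' R j \<bullet> \<beta>"] da by (simp add: summands_def)
  qed
  then obtain \<kappa> where \<kappa>: "\<And>j. j \<in> summands R T0 \<Longrightarrow> b' R j \<bullet> \<beta> = sscl (\<kappa> j) (sid [T0])" by blast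
  have sub: "summands R T0 \<subseteq> {..<n R}" by (auto simp: summands_def)
  have z: "mor (b R j \<bullet> b' R j \<bullet> \<beta>) = 0" if "j \<in> {..<n R} - summands R T0" for j
  proof -
    have j: "j < n R" "T0 \<noteq> T R j" using that by (auto simp: summands_def)
    have "mor (b' R j \<bullet> \<beta>) = 0"
      using strict_hom_I(1)[OF T0 _ _ j(2), of "b' R j \<bullet> \<beta>"] dec[OF j(1)] by simp
    then show ?thesis using mor_zero_scmp(1)[of "b' R j \<bullet> \<beta>" "b R j"] da[OF j(1)] by simp
  qed
  have "\<beta> = ssum [R, Z] [R, Z] {..<n R} (\<lambda>j. b R j \<bullet> b' R j) \<bullet> \<beta>" unfolding dec_sum by simp
  also have "\<dots> = ssum [T0] [R, Z] {..<n R} (\<lambda>j. (b R j \<bullet> b' R j) \<bullet> \<beta>)"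
    using ssum_scmp[of \<beta> "{..<n R}" "\<lambda>j. b R j \<bullet> b' R j" "[R, Z]"] da by simp
  also have "\<dots> = ssum [T0] [R, Z] {..<n R} (\<lambda>j. b R j \<bullet> b' R j \<bullet> \<beta>)"
    using da by (intro ssum_cong) (simp add: scmp_assoc)
  also have "\<dots> = ssum [T0] [R, Z] (summands R T0) (\<lambda>j. b R j \<bullet> b' R j \<bullet> \<beta>)"
    by (rule ssum_restrict[OF _ sub z]) simp_all
  also have "\<dots> = ssum [T0] [R, Z] (summands R T0) (\<lambda>j. sscl (\<kappa> j) (b R j))"
    using da by (intro ssum_cong) (auto simp: \<kappa> scmp_sscl summands_def)
  finally have \<beta>: "\<beta> = ssum [T0] [R, Z] (summands R T0) (\<lambda>j. sscl (\<kappa> j) (b R j))" .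
  have "\<alpha> = wh [] (sev R) [Z, dd T0] \<bullet> wh [dd R] \<beta> [dd T0] \<bullet> wh [dd R] (scoev T0) []"
    using \<alpha>\<phi> \<phi>\<beta>[symmetric] by (simp add: wh_scmp scmp_assoc)
  also have "\<dots> = ssum [dd R] [Z, dd T0] (summands R T0)
      (\<lambda>j. wh [] (sev R) [Z, dd T0] \<bullet> wh [dd R] (sscl (\<kappa> j) (b R j)) [dd T0] \<bullet> wh [dd R] (scoev T0) [])"
    unfolding \<beta> using da by (subst ssum_context) (auto simp: summands_def)
  also have "\<dots> = ssum [dd R] [Z, dd T0] (summands R T0) (\<lambda>j. sscl (\<kappa> j) (dual_in R j))"
    using da by (intro ssum_cong) (auto simp: dual_in_def bend_in_def wh_sscl sscl_scmp scmp_sscl wh_scmp scmp_assoc summands_def)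
  finally show ?thesis by blast
qed

text \<open>The coefficient is the inverse of the pairing computed in
  \<open>dual_out_dual_in\<close>. It suffices to test on arrows out of \<open>dd R\<close> with
  \<open>R\<close> in \<open>I\<close>, and by \<open>dual_in_span\<close> on the
  \<open>dual_in R j\<close>, each of which meets only its own summand.\<close>

lemma dual_expansion:
  assumes T0: "T0 \<in> I"
  shows "ssum [Z, dd T0] [Z, dd T0] (Sigma I (\<lambda>S. summands S T0))
     (\<lambda>(S, j). sscl (qdim C S / qdim C T0) (dual_in S j \<bullet> dual_out S j)) = sid [Z, dd T0]" (is "?e = _")
proof (rule dual_generate_word[where ys="[Z, dd T0]"])
  let ?A = "Sigma I (\<lambda>S. summands S T0)"
  let ?t = "\<lambda>(S, j). sscl (qdim C S / qdim C T0) (dual_in S j \<bullet> dual_out S j)"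
  have fin: "finite ?A" using finite_I by (auto simp: summands_def)
  have te: "hm (?t p) [Z, dd T0] [Z, dd T0]" if "p \<in> ?A" for p
    using that dec_arr by (auto simp: summands_def)
  then show e: "hm ?e [Z, dd T0] [Z, dd T0]" by simp
  fix R \<alpha> assume R: "R \<in> I" and \<alpha>: "hm \<alpha> [dd R] [Z, dd T0]"
  have ea: "?e \<bullet> dual_in R j = dual_in R j" if j: "j \<in> summands R T0" for j
  proof -
    have j': "j < n R" "T R j = T0" using j by (auto simp: summands_def)
    note [simp] = dec_arr[OF R j'(1), unfolded j'(2)]
    have "?e \<bullet> dual_in R j = ssum [dd R] [Z, dd T0] ?A (\<lambda>p. ?t p \<bullet> dual_in R j)"
      using ssum_scmp[of "dual_in R j" ?A ?t "[Z, dd T0]"] te by simp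
    also have "\<dots> = ssum [dd R] [Z, dd T0] ?A (\<lambda>p. sscl (if p = (R, j) then 1 else 0) (dual_in R j))"
    proof (rule ssum_cong)
      fix p assume "p \<in> ?A"
      then obtain S i where p: "p = (S, i)" and S: "S \<in> I" and i: "i < n S" "T S i = T0" by (auto simp: summands_def)
      note [simp] = dec_arr[OF S i(1), unfolded i(2)]
      have t: "?t p \<bullet> dual_in R j = sscl (qdim C S / qdim C T0) (dual_in S i \<bullet> dual_out S i \<bullet> dual_in R j)"
        by (simp add: p sscl_scmp scmp_assoc)
      show "?t p \<bullet> dual_in R j = sscl (if p = (R, j) then 1 else 0) (dual_in R j)"
      proof (cases "S = R")
        case False
        have "mor (dual_out S i \<bullet> dual_in R j) = 0" using dual_hom_I(1)[OF S R, of "dual_out S i \<bullet> dual_in R j"] False by simp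
        then have "mor (dual_in S i \<bullet> dual_out S i \<bullet> dual_in R j) = 0" using mor_zero_scmp(1)[of "dual_out S i \<bullet> dual_in R j" "dual_in S i"] by simp
        then show ?thesis unfolding t using False by (intro triple_eqI) (simp_all add: p sscl_def)
      next
        case True
        have "dual_out S i \<bullet> dual_in R j = sscl (if i = j then qdim C T0 / qdim C R else 0) (sid [dd R])"
          using dual_out_dual_in[OF R _ j'(1)] i j' True by simp
        then have "?t p \<bullet> dual_in R j = sscl (qdim C R / qdim C T0 * (if i = j then qdim C T0 / qdim C R else 0)) (dual_in R i)"
          unfolding t using True dec_arr[OF R, of i] i by (simp add: scmp_sscl)
        then show ?thesis using True p qdim_nonzero[OF R] qdim_nonzero[OF T0] dec_arr[OF R, of i] i
          by (auto intro!: triple_eqI simp: sscl_def)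
      qed
    qed
    also have "\<dots> = dual_in R j" by (rule ssum_delta[OF fin]) (use R j in simp_all)
    finally show ?thesis .
  qed
  obtain \<kappa> where \<kappa>: "\<alpha> = ssum [dd R] [Z, dd T0] (summands R T0) (\<lambda>j. sscl (\<kappa> j) (dual_in R j))"
    using dual_in_span[OF R T0 \<alpha>] by blast
  have ja: "hm (dual_in R j) [dd R] [Z, dd T0]" if "j \<in> summands R T0" for j using that dec_arr[OF R] by (auto simp: summands_def)
  have "?e \<bullet> \<alpha> = ssum [dd R] [Z, dd T0] (summands R T0) (\<lambda>j. ?e \<bullet> sscl (\<kappa> j) (dual_in R j))"
    unfolding \<kappa> using scmp_ssum[of ?e "summands R T0" "\<lambda>j. sscl (\<kappa> j) (dual_in R j)" "[dd R]"] e ja by simp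
  also have "\<dots> = \<alpha>"
    unfolding \<kappa> using e ja ea by (intro ssum_cong) (simp add: scmp_sscl)
  finally show "?e \<bullet> \<alpha> = sid [Z, dd T0] \<bullet> \<alpha>" using \<alpha> by simp
qed simp_all

end

section \<open>The handle slide\<close>

locale tube_functor = premodular_simples C I + monoidal_functor C D M
  for C :: "('k::alg_closed_field, 'o, 'm::ab_group_add, 'y) brcat_scheme" (structure)
    and I :: "'o set"
    and D :: "('k, 'p, 'n::ab_group_add, 'z) moncat_scheme"
    and M :: "('o, 'm, 'p, 'n) monfun" +
  fixes X Y :: 'o
  assumes dim: "cat_dim C I \<noteq> 0"
begin

lemmas D_simps = D.wh_scmp D.scmp_assoc
lemmas Phi_simps = Phi_scmp Phi_wh

notation scmp (infixr \<open>\<bullet>\<close> 70)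
notation D.scmp (infixr \<open>\<star>\<close> 70)

text \<open>The strand \<open>Z\<close> enters at the left and crosses \<open>X\<close> and
  \<open>Y\<close>; only then does \<open>\<gamma>\<close> close them off. Transparency compares
  this with closing them off at once.\<close>

definition slide where "slide \<gamma> Z = D.wh [] \<gamma> [Z] \<star> Phi (shb X Y Z)"

text \<open>The strict form of the action of \<open>tube_eps\<close> under \<open>TM_mor\<close>, as
  \<open>rep_TM_mor\<close> confirms: the sum of weighted loops \<open>S\<close> around
  \<open>\<gamma>\<close>.\<close>

definition eps_act where "eps_act \<gamma> = D.ssum [X, Y] [] I (\<lambda>S. D.sscl (qdim C S / cat_dim C I)
   (Phi (sev S) \<star> D.wh [dd S] (slide \<gamma> S) [] \<star> D.wh [] (Phi (scoev' S)) [X, Y]))"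

definition transparent where "transparent \<gamma> \<longleftrightarrow> (\<forall>Z. slide \<gamma> Z = D.wh [Z] \<gamma> [])"

lemma slide_hm: assumes "D.hm \<gamma> [X, Y] []" shows "D.hm (slide \<gamma> Z) [Z, X, Y] [Z]"
  using assms by (simp add: slide_def)

lemma eps_act_hm: assumes "D.hm \<gamma> [X, Y] []" shows "D.hm (eps_act \<gamma>) [X, Y] []"
  using slide_hm[OF assms] by (simp add: eps_act_def)

text \<open>A loop \<open>S\<close> freed from \<open>\<gamma>\<close> is worth
  \<open>qdim C S\<close>, and its weight contributes the same factor over
  \<open>cat_dim C I\<close>. The total coefficient is the sum of squared dimensions divided by
  itself, which is 1 by \<open>dim\<close>.\<close>

lemma eps_act_transparent:
  assumes \<gamma>: "D.hm \<gamma> [X, Y] []" and t: "transparent \<gamma>"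
  shows "eps_act \<gamma> = \<gamma>"
proof (rule triple_eqI)
  note [simp] = \<gamma>
  have e: "Phi (sev S) \<star> D.wh [dd S] (slide \<gamma> S) [] \<star> D.wh [] (Phi (scoev' S)) [X, Y] = D.sscl (qdim C S) \<gamma>" for S
  proof -
    have "D.wh [dd S] (slide \<gamma> S) [] \<star> D.wh [] (Phi (scoev' S)) [X, Y] = Phi (scoev' S) \<star> \<gamma>"
      using t D.exchange[of "Phi (scoev' S)" \<gamma> "[]" "[]" "[]"] by (simp add: transparent_def)
    then have "Phi (sev S) \<star> D.wh [dd S] (slide \<gamma> S) [] \<star> D.wh [] (Phi (scoev' S)) [X, Y] = Phi (sev S \<bullet> scoev' S) \<star> \<gamma>"
      by (simp add: D.scmp_assoc Phi_scmp)
    then show ?thesis by (simp add: dim_left Phi_sscl D.sscl_scmp)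
  qed
  have "mor (eps_act \<gamma>) = (\<Sum>S\<in>I. scl D (qdim C S / cat_dim C I * qdim C S) (mor \<gamma>))"
    by (simp add: eps_act_def e D.ssum_def D.sscl_def)
  also have "\<dots> = scl D ((\<Sum>S\<in>I. (qdim C S)\<^sup>2) / cat_dim C I) (mor \<gamma>)"
    by (simp add: D.scale_sum_left[symmetric] sum_divide_distrib power2_eq_square)
  also have "\<dots> = mor \<gamma>" using dim by (simp add: cat_dim_def)
  finally show "mor (eps_act \<gamma>) = mor \<gamma>" .
qed (use eps_act_hm[OF \<gamma>] \<gamma> in simp_all)

text \<open>Sliding \<open>Z\<close> and then \<open>S\<close> past an arbitrary
  \<open>\<gamma>\<close> after the vertex \<open>b\<close> is the same as sliding \<open>T\<close>
  first and splitting it afterwards: the half-braiding is natural and \<open>\<gamma>\<close> does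
  not touch \<open>b\<close>.\<close>

lemma slide_natural:
  assumes \<gamma>: "D.hm \<gamma> [X, Y] []" and b: "hm b [T] [S, Z]"
  shows "(D.wh [] (slide \<gamma> S) [Z] \<star> D.wh [S] (Phi (shb X Y Z)) []) \<star> D.wh [] (Phi b) [X, Y] = Phi b \<star> slide \<gamma> T"
proof -
  note [simp] = \<gamma>
    b
  have "(D.wh [] (slide \<gamma> S) [Z] \<star> D.wh [S] (Phi (shb X Y Z)) []) \<star> D.wh [] (Phi b) [X, Y]
     = D.wh [] \<gamma> [S, Z] \<star> Phi (wh [] (shb X Y S) [Z] \<bullet> wh [S] (shb X Y Z) [] \<bullet> wh [] b [X, Y])"
    by (simp add: slide_def D_simps Phi_simps)
  also have "\<dots> = (D.wh [] \<gamma> [S, Z] \<star> D.wh [X, Y] (Phi b) []) \<star> Phi (shb X Y T)"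
    unfolding shb_natural[OF b] by (simp add: D.scmp_assoc Phi_simps)
  also have "D.wh [] \<gamma> [S, Z] \<star> D.wh [X, Y] (Phi b) [] = Phi b \<star> D.wh [] \<gamma> [T]"
    using D.exchange[of \<gamma> "Phi b" "[]" "[]" "[]"] by simp
  finally show ?thesis by (simp add: slide_def D.scmp_assoc)
qed

text \<open>The handle slide: both sides expand, by a decomposition of \<open>[S, Z]\<close> and the dual decomposition
  of \<open>[Z, dd T]\<close> respectively, into the same sum over \<open>S\<close>, \<open>T\<close>.\<close>

lemma transparent_eps_act:
  assumes \<gamma>: "D.hm \<gamma> [X, Y] []"
  shows "transparent (eps_act \<gamma>)"
  unfolding transparent_def
proof
  fix Z
  note [simp] = \<gamma>
  have F [simp]: "D.arr (slide \<gamma> S)" "src (slide \<gamma> S) = [S, X, Y]" "trg (slide \<gamma> S) = [S]" for S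
    using slide_hm[OF \<gamma>] by simp_all
  let ?c = "cat_dim C I"
  have "\<exists>n T b b'. decomposes [S, Z] n T b b'" for S by (rule strict_decomposition)
  then obtain n T b b' where dec: "\<And>S. decomposes [S, Z] (n S) (T S) (b S) (b' S)" by metis
  interpret fe: fusion_expansion C I Z n T b b'
    by unfold_locales (rule dec)
  \<comment> \<open>The summand common to both expansions: \<open>Z\<close> splits into
    \<open>dd S\<close> and \<open>T S j\<close>, the strand \<open>T S j\<close> slides past
    \<open>\<gamma>\<close>, and the two strands merge to \<open>Z\<close> again.\<close>
  define E where "E S j = Phi (fe.bend_in S j) \<star> D.wh [dd S] (slide \<gamma> (T S j)) [] \<star> D.wh [] (Phi (fe.bend_out S j)) [X, Y]" for S j
  define Q where "Q S = Phi (sev S) \<star> D.wh [dd S] (slide \<gamma> S) [] \<star> D.wh [] (Phi (scoev' S)) [X, Y]" for S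
  have Q [simp]: "D.arr (Q S)" "src (Q S) = [X, Y]" "trg (Q S) = []" for S by (simp_all add: Q_def)
  have PQ: "eps_act \<gamma> = D.ssum [X, Y] [] I (\<lambda>S. D.sscl (qdim C S / ?c) (Q S))" by (simp add: eps_act_def Q_def)
  have L: "D.wh [] (Q S) [Z] \<star> Phi (shb X Y Z) = D.ssum [Z, X, Y] [Z] {..<n S} (E S)" if S: "S \<in> I" for S
  proof -
    let ?F2 = "D.wh [] (slide \<gamma> S) [Z] \<star> D.wh [S] (Phi (shb X Y Z)) []"
    note d = fe.dec_arr[OF S]
    let ?l = "D.wh [] (Phi (sev S)) [Z] \<star> D.wh [dd S] ?F2 []" and ?r = "D.wh [] (Phi (scoev' S)) [Z, X, Y]"
    have "D.wh [] (Q S) [Z] \<star> Phi (shb X Y Z)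
       = D.wh [] (Phi (sev S)) [Z] \<star> D.wh [dd S] (slide \<gamma> S) [Z] \<star> D.wh [] (Phi (scoev' S)) [X, Y, Z] \<star> Phi (shb X Y Z)"
      by (simp add: Q_def D_simps)
    also have "D.wh [] (Phi (scoev' S)) [X, Y, Z] \<star> Phi (shb X Y Z) = D.wh [dd S, S] (Phi (shb X Y Z)) [] \<star> ?r"
      using D.exchange[of "Phi (scoev' S)" "Phi (shb X Y Z)" "[]" "[]" "[]"] by simp
    also have "D.wh [] (Phi (sev S)) [Z] \<star> D.wh [dd S] (slide \<gamma> S) [Z] \<star> D.wh [dd S, S] (Phi (shb X Y Z)) [] \<star> ?r
       = ?l \<star> D.wh [dd S] (Phi (sid [S, Z])) [X, Y] \<star> ?r"
      by (simp add: D_simps)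
    \<comment> \<open>Here the two parallel strands \<open>S\<close> and \<open>Z\<close>, about to
      slide together, are cut open. \<open>slide_natural\<close> then leaves only
      \<open>T S j\<close> to slide.\<close>
    also have "Phi (sid [S, Z]) = D.ssum [S, Z] [S, Z] {..<n S} (\<lambda>j. Phi (b S j \<bullet> b' S j))"
      unfolding fe.dec_sum[symmetric] by (rule Phi_ssum) (use d in simp)
    also have "?l \<star> D.wh [dd S] \<dots> [X, Y] \<star> ?r
       = D.ssum [Z, X, Y] [Z] {..<n S} (\<lambda>j. ?l \<star> D.wh [dd S] (Phi (b S j \<bullet> b' S j)) [X, Y] \<star> ?r)"
      using d by (subst D.ssum_context) simp_all
    also have "\<dots> = D.ssum [Z, X, Y] [Z] {..<n S} (E S)"
    proof (rule D.ssum_cong)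
      fix j assume "j \<in> {..<n S}"
      then have j: "j < n S" by simp
      note [simp] = d[OF j]
      have F2: "?F2 \<star> D.wh [] (Phi (b S j)) [X, Y] = Phi (b S j) \<star> slide \<gamma> (T S j)"
        by (rule slide_natural[OF \<gamma>]) simp
      have "?l \<star> D.wh [dd S] (Phi (b S j \<bullet> b' S j)) [X, Y] \<star> ?r
         = D.wh [] (Phi (sev S)) [Z] \<star> D.wh [dd S] (?F2 \<star> D.wh [] (Phi (b S j)) [X, Y]) []
             \<star> D.wh [dd S] (Phi (b' S j)) [X, Y] \<star> ?r"
        by (simp add: Phi_scmp D_simps)
      then show "?l \<star> D.wh [dd S] (Phi (b S j \<bullet> b' S j)) [X, Y] \<star> ?r = E S j"
        unfolding F2 by (simp add: E_def fe.bend_in_def fe.bend_out_def Phi_simps D_simps)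
    qed
    finally show ?thesis .
  qed
  have R: "D.wh [Z] (Q R) [] = D.ssum [Z, X, Y] [Z] (Sigma I (\<lambda>S. fe.summands S R)) (\<lambda>(S, j). D.sscl (qdim C S / qdim C R) (E S j))"
    if R: "R \<in> I" for R
  proof -
    let ?A = "Sigma I (\<lambda>S. fe.summands S R)" and ?a = "\<lambda>(S, j). sscl (qdim C S / qdim C R) (fe.dual_in S j \<bullet> fe.dual_out S j)"
    let ?l = "D.wh [Z] (Phi (sev R)) []" and ?r = "D.wh [Z, dd R] (slide \<gamma> R) [] \<star> D.wh [Z] (Phi (scoev' R)) [X, Y]"
    have a: "hm (?a p) [Z, dd R] [Z, dd R]" if "p \<in> ?A" for p
      using that fe.dec_arr by (auto simp: fe.summands_def)
    have "D.wh [Z] (Q R) [] = ?l \<star> D.wh [] (Phi (sid [Z, dd R])) [R] \<star> ?r"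
      by (simp add: Q_def D.wh_scmp)
    \<comment> \<open>On this side the cut is made across \<open>Z\<close> and the returning strand
      \<open>dd R\<close> of the circle. The lower half of each vertex is then moved below the slide
      by an exchange.\<close>
    also have "sid [Z, dd R] = ssum [Z, dd R] [Z, dd R] ?A ?a" using fe.dual_expansion[OF R] by simp
    also have "Phi \<dots> = D.ssum [Z, dd R] [Z, dd R] ?A (\<lambda>p. Phi (?a p))" by (rule Phi_ssum) (rule a)
    also have "?l \<star> D.wh [] \<dots> [R] \<star> ?r = D.ssum [Z, X, Y] [Z] ?A (\<lambda>p. ?l \<star> D.wh [] (Phi (?a p)) [R] \<star> ?r)"
      using a by (subst D.ssum_context) simp_all
    also have "\<dots> = D.ssum [Z, X, Y] [Z] ?A (\<lambda>(S, j). D.sscl (qdim C S / qdim C R) (E S j))"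
    proof (rule D.ssum_cong)
      fix p assume "p \<in> ?A"
      then obtain S j where p: "p = (S, j)" and S: "S \<in> I" and j: "j < n S" "T S j = R" by (auto simp: fe.summands_def)
      note [simp] = fe.dec_arr[OF S j(1), unfolded j(2)]
      have "?l \<star> D.wh [] (Phi (fe.dual_in S j \<bullet> fe.dual_out S j)) [R] \<star> ?r
         = Phi (wh [Z] (sev R) [] \<bullet> wh [] (fe.dual_in S j) [R]) \<star> (D.wh [] (Phi (fe.dual_out S j)) [R] \<star> D.wh [Z, dd R] (slide \<gamma> R) [])
             \<star> D.wh [Z] (Phi (scoev' R)) [X, Y]"
        by (simp add: Phi_simps D_simps)
      also have "D.wh [] (Phi (fe.dual_out S j)) [R] \<star> D.wh [Z, dd R] (slide \<gamma> R) [] = D.wh [dd S] (slide \<gamma> R) [] \<star> D.wh [] (Phi (fe.dual_out S j)) [R, X, Y]"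
        using D.exchange[of "Phi (fe.dual_out S j)" "slide \<gamma> R" "[]" "[]" "[]"] by simp
      also have "Phi (wh [Z] (sev R) [] \<bullet> wh [] (fe.dual_in S j) [R]) \<star> (D.wh [dd S] (slide \<gamma> R) [] \<star> D.wh [] (Phi (fe.dual_out S j)) [R, X, Y])
             \<star> D.wh [Z] (Phi (scoev' R)) [X, Y]
         = Phi (wh [Z] (sev R) [] \<bullet> wh [] (fe.dual_in S j) [R]) \<star> D.wh [dd S] (slide \<gamma> R) []
             \<star> D.wh [] (Phi (wh [] (fe.dual_out S j) [R] \<bullet> wh [Z] (scoev' R) [])) [X, Y]"
        by (simp add: Phi_simps D_simps)
      also have "\<dots> = E S j"
        using fe.ev_dual_in[OF S j(1)] fe.dual_out_coev[OF S j(1)] j(2) by (simp add: E_def)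
      finally show "?l \<star> D.wh [] (Phi (?a p)) [R] \<star> ?r = (case p of (S, j) \<Rightarrow> D.sscl (qdim C S / qdim C R) (E S j))"
        by (simp add: p Phi_sscl D.wh_sscl D.sscl_scmp D.scmp_sscl)
    qed
    finally show ?thesis .
  qed
  have q: "D.hm (D.sscl (qdim C S / ?c) (Q S)) [X, Y] []" for S by simp
  let ?x = "\<lambda>(S, j). scl D (qdim C S / ?c) (mor (E S j))"
  have l: "slide (eps_act \<gamma>) Z = D.ssum [Z, X, Y] [Z] I (\<lambda>S. D.sscl (qdim C S / ?c) (D.wh [] (Q S) [Z] \<star> Phi (shb X Y Z)))"
    unfolding slide_def PQ
    using D.wh_ssum[of I "\<lambda>S. D.sscl (qdim C S / ?c) (Q S)" "[X, Y]" "[]" "[]" "[Z]"]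
      D.ssum_scmp[of "Phi (shb X Y Z)" I "\<lambda>S. D.wh [] (D.sscl (qdim C S / ?c) (Q S)) [Z]" "[Z]"]
    by (simp add: D.wh_sscl D.sscl_scmp)
  have "mor (slide (eps_act \<gamma>) Z) = (\<Sum>S\<in>I. scl D (qdim C S / ?c) (\<Sum>j<n S. mor (E S j)))"
    unfolding l by (simp add: D.ssum_def D.sscl_def L)
  also have "\<dots> = (\<Sum>p\<in>Sigma I (\<lambda>S. {..<n S}). ?x p)"
    using finite_I by (simp add: D.scale_sum_right sum.Sigma)
  \<comment> \<open>The left expansion runs over \<open>S\<close> and all summands of
    \<open>[S, Z]\<close>, the right one over the circle colour first. Grouping the summands by
    their simple object \<open>R\<close> matches the two.\<close>
  also have "\<dots> = (\<Sum>R\<in>I. \<Sum>p | p \<in> Sigma I (\<lambda>S. {..<n S}) \<and> (\<lambda>(S, j). T S j) p = R. ?x p)"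
    by (rule sum.group[symmetric]) (use finite_I fe.dec in auto)
  also have "\<dots> = (\<Sum>R\<in>I. \<Sum>p\<in>Sigma I (\<lambda>S. fe.summands S R). ?x p)"
    by (intro sum.cong refl) (auto simp: fe.summands_def)
  also have "\<dots> = (\<Sum>R\<in>I. scl D (qdim C R / ?c) (mor (D.wh [Z] (Q R) [])))"
  proof (rule sum.cong[OF refl])
    fix R' assume R': "R' \<in> I"
    have "scl D (qdim C R' / ?c) (mor (D.wh [Z] (Q R') [])) = (\<Sum>p\<in>Sigma I (\<lambda>S. fe.summands S R').
       scl D (qdim C R' / ?c) (mor (case p of (S, j) \<Rightarrow> D.sscl (qdim C S / qdim C R') (E S j))))"
      unfolding R[OF R'] by (simp add: D.ssum_def D.scale_sum_right)
    also have "\<dots> = (\<Sum>p\<in>Sigma I (\<lambda>S. fe.summands S R'). ?x p)"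
      \<comment> \<open>The weight of the circle \<open>R'\<close> times the factor
        \<open>qdim C S / qdim C R'\<close> of the expansion is the weight of the circle
        \<open>S\<close>.\<close>
      by (rule sum.cong) (use qdim_nonzero[OF R'] in \<open>auto simp: D.sscl_def\<close>)
    finally show "(\<Sum>p\<in>Sigma I (\<lambda>S. fe.summands S R'). ?x p) = scl D (qdim C R' / ?c) (mor (D.wh [Z] (Q R') []))" by simp
  qed
  also have "\<dots> = mor (D.wh [Z] (eps_act \<gamma>) [])"
    unfolding PQ using D.wh_ssum[of I "\<lambda>S. D.sscl (qdim C S / ?c) (Q S)" "[X, Y]" "[]" "[Z]" "[]"]
    by (simp add: D.wh_sscl) (simp add: D.ssum_def D.sscl_def)
  finally have "mor (slide (eps_act \<gamma>) Z) = mor (D.wh [Z] (eps_act \<gamma>) [])" .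
  then show "slide (eps_act \<gamma>) Z = D.wh [Z] (eps_act \<gamma>) []"
    using eps_act_hm[OF \<gamma>] by (intro triple_eqI) (simp_all add: slide_def)
qed

text \<open>A fixed point is its own image under \<open>eps_act\<close>, and every image is
  transparent.\<close>

lemma eps_act_fixed_iff: "D.hm \<gamma> [X, Y] [] \<Longrightarrow> eps_act \<gamma> = \<gamma> \<longleftrightarrow> transparent \<gamma>"
  using transparent_eps_act eps_act_transparent by metis

text \<open>Strict monoidal functors preserve zigzags, so strands in the target category are bent
  with the images of the duality of the source.\<close>

lemma Phi_adj: "adj xs ys \<eta> \<epsilon> \<Longrightarrow> D.adj xs ys (Phi \<eta>) (Phi \<epsilon>)"
  unfolding adj_def D.adj_def
  by (auto simp: Phi_wh[symmetric] Phi_scmp[symmetric])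

definition bar where "bar \<beta> = Phi (sev Y) \<star> D.wh [] \<beta> [Y]"

text \<open>Bending the outgoing \<open>dd Y\<close> down (\<open>K\<close>) and precomposing with
  the crossing of \<open>Z\<close> and \<open>X\<close> (\<open>?u\<close>) both preserve and
  reflect equations. They take the right side to \<open>slide (bar \<beta>) Z\<close>, where
  \<open>braid_ev\<close> is applied, and the left side to \<open>\<gamma> = bar \<beta>\<close>
  beside an idle \<open>Z\<close>.\<close>

lemma transparent_bar:
  assumes \<beta>: "D.hm \<beta> [X] [dd Y]"
  shows "transparent (bar \<beta>) \<longleftrightarrow> (\<forall>Z. D.wh [Z] \<beta> [] \<star> Phi (sib Z X) = Phi (sbr (dd Y) Z) \<star> D.wh [] \<beta> [Z])"
proof -
  note [simp] = \<beta>
  have [simp]: "D.arr (bar \<beta>)" "src (bar \<beta>) = [X, Y]" "trg (bar \<beta>) = []" by (simp_all add: bar_def)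
  note a = Phi_adj[OF adj_dual[of Y]]
  have "slide (bar \<beta>) Z = D.wh [Z] (bar \<beta>) [] \<longleftrightarrow> D.wh [Z] \<beta> [] \<star> Phi (sib Z X) = Phi (sbr (dd Y) Z) \<star> D.wh [] \<beta> [Z]" for Z
  proof -
    define K where "K h = D.wh [Z] (Phi (sev Y)) [] \<star> D.wh [] h [Y]" for h
    let ?l = "D.wh [Z] \<beta> [] \<star> Phi (sib Z X)" and ?r = "Phi (sbr (dd Y) Z) \<star> D.wh [] \<beta> [Z]"
    have k: "D.wh [] (K h) [dd Y] \<star> D.wh [X, Z] (Phi (scoev Y)) [] = h" if "D.hm h [X, Z] [Z, dd Y]" for h
      unfolding K_def by (rule D.runbend_rbend[OF a]) (simp add: that)
    have K: "?l = ?r \<longleftrightarrow> K ?l = K ?r"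
    proof
      assume "K ?l = K ?r"
      then have "D.wh [] (K ?l) [dd Y] \<star> D.wh [X, Z] (Phi (scoev Y)) []
         = D.wh [] (K ?r) [dd Y] \<star> D.wh [X, Z] (Phi (scoev Y)) []" by (rule arg_cong)
      moreover have "D.hm ?l [X, Z] [Z, dd Y]" "D.hm ?r [X, Z] [Z, dd Y]" by simp_all
      ultimately show "?l = ?r" by (simp only: k)
    qed (rule arg_cong)
    have Kl: "K ?l = D.wh [Z] (bar \<beta>) [] \<star> Phi (wh [] (sib Z X) [Y])"
      by (simp add: K_def bar_def D_simps Phi_wh)
    have e: "wh [Z] (sev Y) [] \<bullet> wh [] (sbr (dd Y) Z) [Y] = wh [] (sev Y) [Z] \<bullet> wh [dd Y] (sib Y Z) []"
      unfolding braid_ev[of Y Z] by (simp add: scmp_assoc wh_scmp[symmetric])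
    have "K ?r = Phi (wh [Z] (sev Y) [] \<bullet> wh [] (sbr (dd Y) Z) [Y]) \<star> D.wh [] \<beta> [Z, Y]"
      by (simp add: K_def D_simps Phi_simps)
    also have "\<dots> = D.wh [] (Phi (sev Y)) [Z] \<star> D.wh [dd Y] (Phi (sib Y Z)) [] \<star> D.wh [] \<beta> [Z, Y]"
      unfolding e by (simp add: D.scmp_assoc Phi_simps)
    also have "D.wh [dd Y] (Phi (sib Y Z)) [] \<star> D.wh [] \<beta> [Z, Y] = D.wh [] \<beta> [Y, Z] \<star> D.wh [X] (Phi (sib Y Z)) []"
      using D.exchange[of \<beta> "Phi (sib Y Z)" "[]" "[]" "[]"] by simp
    finally have Kr: "K ?r = D.wh [] (bar \<beta>) [Z] \<star> D.wh [X] (Phi (sib Y Z)) []"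
      by (simp add: bar_def D_simps)
    let ?u = "Phi (wh [] (sbr Z X) [Y])" and ?v = "Phi (wh [] (sib Z X) [Y])"
    have uv: "?u \<star> ?v = D.sid [X, Z, Y]" "?v \<star> ?u = D.sid [Z, X, Y]"
      by (simp_all add: Phi_scmp[symmetric] wh_scmp[symmetric])
    have ru: "K ?r \<star> ?u = slide (bar \<beta>) Z"
      by (simp add: Kr slide_def shb_def D.scmp_assoc Phi_simps)
    have lu: "K ?l \<star> ?u = D.wh [Z] (bar \<beta>) []"
      using uv by (simp add: Kl D.scmp_assoc)
    have "K ?l = K ?r" if "K ?l \<star> ?u = K ?r \<star> ?u"
    proof -
      have "(K ?l \<star> ?u) \<star> ?v = (K ?r \<star> ?u) \<star> ?v" using that by simp
      then show ?thesis using uv by (simp add: Kl Kr D.scmp_assoc)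
    qed
    then show ?thesis using K ru lu by metis
  qed
  then show ?thesis by (simp add: transparent_def)
qed

lemma bar_inj:
  assumes "D.hm \<beta> [X] [dd Y]" "D.hm \<beta>' [X] [dd Y]" "bar \<beta> = bar \<beta>'"
  shows "\<beta> = \<beta>'"
proof -
  have k: "D.wh [] (bar h) [dd Y] \<star> D.wh [X] (Phi (scoev Y)) [] = h" if "D.hm h [X] [dd Y]" for h
    using D.runbend_rbend[OF Phi_adj[OF adj_dual[of Y]], of h "[X]" "[]"] that by (simp add: bar_def)
  show ?thesis using k[OF assms(1)] k[OF assms(2)] unfolding assms(3) by (rule trans[OF sym])
qed

lemma bar_surj:
  assumes "D.hm \<gamma> [X, Y] []" shows "\<exists>\<beta>. D.hm \<beta> [X] [dd Y] \<and> bar \<beta> = \<gamma>"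
  using D.rbend_runbend[OF Phi_adj[OF adj_dual[of Y]], of \<gamma> "[X]" "[]"] assms
  by (intro exI[of _ "D.wh [] \<gamma> [dd Y] \<star> D.wh [X] (Phi (scoev Y)) []"]) (simp add: bar_def)

end

section \<open>Return from strict arrows to the original categories\<close>

context tube_functor begin

abbreviation "fX \<equiv> fleaf X"
abbreviation "fY \<equiv> fleaf Y"

lemmas functor_rep_rules = D.rep_rules rep_inv_fmu rep_fmu rep_inv_fun1 rep_fmo rep_rules

lemma hom_sigma_iff:
  assumes \<beta>: "D.rep (ffr fX) (ffr (fleaf (dd Y))) \<beta> \<beta>s"
  shows "\<beta> \<in> hom_sigma C D M X (dd Y) \<longleftrightarrow> transparent (bar \<beta>s)"
proof -
  have [simp]: "D.arr \<beta>s" "src \<beta>s = [X]" "trg \<beta>s = [dd Y]" using D.rep_hm[OF \<beta>] by simp_all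
  have "(\<iota>\<^sub>D (fob M Z) \<boxtimes>\<^sub>D \<beta>) \<cdot>\<^sub>D fmo2 C D M X Z Z X (inv_brd C Z X)
       = fmo2 C D M (dd Y) Z Z (dd Y) (brd C (dd Y) Z) \<cdot>\<^sub>D (\<beta> \<boxtimes>\<^sub>D \<iota>\<^sub>D (fob M Z))
     \<longleftrightarrow> D.wh [Z] \<beta>s [] \<star> Phi (sib Z X) = Phi (sbr (dd Y) Z) \<star> D.wh [] \<beta>s [Z]" (is "?l = ?r \<longleftrightarrow> ?L = ?R") for Z
  proof -
    let ?u = "D.fnode (ffr fX) (ffr (fleaf Z))" and ?v = "D.fnode (ffr (fleaf Z)) (ffr (fleaf (dd Y)))"
    have "D.rep ?u ?v ?l ?L"
      unfolding fmo2_def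
      by (rule D.rep_eq, (rule functor_rep_rules \<beta> rep_inv_brd refl | simp)+, simp add: D.sten_sid_wh)
    moreover have "D.rep ?u ?v ?r ?R"
      unfolding fmo2_def
      by (rule D.rep_eq, (rule functor_rep_rules \<beta> rep_brd refl | simp)+, simp add: D.sten_sid_wh)
    ultimately have "D.rep ?u ?v ?l ?L" "D.rep ?u ?v ?r ?R" by blast+
    then show ?thesis using D.rep_unique D.rep_inj by metis
  qed
  moreover have "\<beta> \<in> hom D (fob M X) (fob M (dd Y))" using D.rep_hom[OF \<beta>] by simp
  ultimately show ?thesis unfolding hom_sigma_def using transparent_bar[of \<beta>s] by simp
qed

lemma rep_tube_eps:
  assumes "S \<in> I"
  shows "rep (fnode (fleaf S) (fnode fX fY)) (fnode (fnode fX fY) (fleaf S)) (tube_eps C I X Y S)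
    (sscl (qdim C S / cat_dim C I) (shb X Y S))"
proof -
  have "rep (fnode (fleaf S) (fnode fX fY)) (fnode (fnode fX fY) (fleaf S))
      (inv_mor C ((X \<otimes> Y) \<otimes> S) (X \<otimes> (Y \<otimes> S)) (asc C X Y S)
       \<cdot> (\<iota> X \<boxtimes> inv_brd C Y S) \<cdot> asc C X S Y \<cdot> (brd C S X \<boxtimes> \<iota> Y)
       \<cdot> inv_mor C ((S \<otimes> X) \<otimes> Y) (S \<otimes> (X \<otimes> Y)) (asc C S X Y)) (shb X Y S)"
    by (rule rep_eq, (rule rep_rules rep_brd rep_inv_brd refl | simp)+,
      simp add: shb_def sten_sid_wh)
  then show ?thesis using assms by (auto simp: tube_eps_def intro: rep_scl)
qed

text \<open>All associators, unitors and structure maps in \<open>TM_gen\<close> are represented by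
  identities. Only the evaluation, \<open>\<gamma>\<close>, the half-braiding and the coevaluation
  survive.\<close>

lemma rep_TM_gen:
  assumes \<alpha>: "D.rep (ffr (fnode fX fY)) D.funit \<alpha> \<gamma>" and S: "S \<in> I"
  shows "D.rep (ffr (fnode fX fY)) D.funit (TM_gen C D M S (X \<otimes> Y) (X \<otimes> Y) (tube_eps C I X Y S) \<alpha>)
    (D.sscl (qdim C S / cat_dim C I) (Phi (sev S) \<star> D.wh [dd S] (slide \<gamma> S) [] \<star> D.wh [] (Phi (scoev' S)) [X, Y]))"
proof -
  have [simp]: "D.arr \<gamma>" "src \<gamma> = [X, Y]" "trg \<gamma> = []" using D.rep_hm[OF \<alpha>] by simp_all
  have "D.rep (ffr (fnode fX fY)) D.funit (TM_gen C D M S (X \<otimes> Y) (X \<otimes> Y) (tube_eps C I X Y S) \<alpha>) (D.sscl (qdim C S / cat_dim C I) (Phi (sev S) \<star> D.wh [dd S] (slide \<gamma> S) [] \<star> D.wh [] (Phi (scoev' S)) [X, Y]))"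
    unfolding TM_gen_def
    by (rule D.rep_eq, (rule functor_rep_rules \<alpha> rep_ev rep_coev' rep_tube_eps[OF S] refl | simp)+,
      simp add: slide_def sten_sid_wh D.sten_sid_wh Phi_simps Phi_sscl Phi_sten
        D_simps wh_sscl D.wh_sscl D.scmp_sscl D.sscl_scmp)
  then show ?thesis by blast
qed

lemma rep_TM_mor:
  assumes "D.rep (ffr (fnode fX fY)) D.funit \<alpha> \<gamma>"
  shows "D.rep (ffr (fnode fX fY)) D.funit (TM_mor C I D M (X \<otimes> Y) (X \<otimes> Y) (tube_eps C I X Y) \<alpha>) (eps_act \<gamma>)"
  unfolding TM_mor_def eps_act_def using rep_TM_gen[OF assms] by (intro D.rep_sum) simp_all

lemma TM_eps_iff:
  assumes \<alpha>: "D.rep (ffr (fnode fX fY)) D.funit \<alpha> \<gamma>"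
  shows "\<alpha> \<in> TM_eps C I D M X Y \<longleftrightarrow> transparent \<gamma>"
proof -
  have \<gamma>: "D.hm \<gamma> [X, Y] []" using D.rep_hm[OF \<alpha>] by simp
  have "TM_mor C I D M (X \<otimes> Y) (X \<otimes> Y) (tube_eps C I X Y) \<alpha> = \<alpha> \<longleftrightarrow> eps_act \<gamma> = \<gamma>"
    using \<alpha> rep_TM_mor[OF \<alpha>] D.rep_unique D.rep_inj by metis
  moreover have "\<alpha> \<in> TM_ob D M (X \<otimes> Y)" using D.rep_hom[OF \<alpha>] by (simp add: TM_ob_def)
  ultimately show ?thesis using eps_act_fixed_iff[OF \<gamma>] by (simp add: TM_eps_def)
qed

text \<open>The counterpart of \<open>bar\<close> on the actual Hom spaces, since the isomorphism
  has to be a map between these. The bracketing isolates the factor depending on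
  \<open>\<beta>\<close>, so that linearity can be read off.\<close>

definition cap :: "'n \<Rightarrow> 'n" where
  "cap \<beta> = inv_fun1 C D M \<cdot>\<^sub>D (fmo M (ev C Y) \<cdot>\<^sub>D fmu M (dd Y) Y) \<cdot>\<^sub>D ((\<beta> \<boxtimes>\<^sub>D \<iota>\<^sub>D (fob M Y)) \<cdot>\<^sub>D inv_fmu C D M X Y)"

lemma rep_cap:
  assumes \<beta>: "D.rep (ffr fX) (ffr (fleaf (dd Y))) \<beta> \<beta>s"
  shows "D.rep (ffr (fnode fX fY)) D.funit (cap \<beta>) (bar \<beta>s)"
proof -
  have [simp]: "D.arr \<beta>s" "src \<beta>s = [X]" "trg \<beta>s = [dd Y]" using D.rep_hm[OF \<beta>] by simp_all
  have "D.rep (ffr (fnode fX fY)) D.funit (cap \<beta>) (bar \<beta>s)"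
    unfolding cap_def
    by (rule D.rep_eq, (rule functor_rep_rules \<beta> rep_ev refl | simp)+,
      simp add: bar_def D.sten_sid_wh D.scmp_assoc)
  then show ?thesis by blast
qed

lemma ex_rep_beta: "\<beta> \<in> hom D (fob M X) (fob M (dd Y)) \<Longrightarrow> \<exists>\<beta>s. D.rep (ffr fX) (ffr (fleaf (dd Y))) \<beta> \<beta>s"
  by (rule D.rep_ex) simp_all

lemma hom_sigma_hom: "\<beta> \<in> hom_sigma C D M X (dd Y) \<Longrightarrow> \<beta> \<in> hom D (fob M X) (fob M (dd Y))"
  by (simp add: hom_sigma_def)

text \<open>Membership on both sides amounts to transparency of the same strict arrow, so
  bijectivity reduces to that of bending.\<close>

lemma cap_bij: "bij_betw cap (hom_sigma C D M X (dd Y)) (TM_eps C I D M X Y)"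
proof (rule bij_betw_imageI)
  show "inj_on cap (hom_sigma C D M X (dd Y))"
  proof (rule inj_onI)
    fix \<beta> \<beta>' assume a: "\<beta> \<in> hom_sigma C D M X (dd Y)" "\<beta>' \<in> hom_sigma C D M X (dd Y)" "cap \<beta> = cap \<beta>'"
    obtain s s' where s: "D.rep (ffr fX) (ffr (fleaf (dd Y))) \<beta> s" "D.rep (ffr fX) (ffr (fleaf (dd Y))) \<beta>' s'"
      using ex_rep_beta hom_sigma_hom a by meson
    have "bar s = bar s'" using D.rep_unique[OF rep_cap[OF s(1)]] rep_cap[OF s(2)] a(3) by simp
    then have "s = s'" using bar_inj[of s s'] D.rep_hm[OF s(1)] D.rep_hm[OF s(2)] by simp
    then show "\<beta> = \<beta>'" using D.rep_inj s by blast
  qed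
  show "cap ` hom_sigma C D M X (dd Y) = TM_eps C I D M X Y"
  proof (intro equalityI subsetI)
    fix \<alpha> assume "\<alpha> \<in> cap ` hom_sigma C D M X (dd Y)"
    then obtain \<beta> where \<beta>: "\<beta> \<in> hom_sigma C D M X (dd Y)" "\<alpha> = cap \<beta>" by blast
    then obtain s where s: "D.rep (ffr fX) (ffr (fleaf (dd Y))) \<beta> s" using ex_rep_beta hom_sigma_hom by meson
    then show "\<alpha> \<in> TM_eps C I D M X Y" using \<beta> hom_sigma_iff[OF s] TM_eps_iff[OF rep_cap[OF s]] by simp
  next
    fix \<alpha> assume \<alpha>: "\<alpha> \<in> TM_eps C I D M X Y"
    then have "\<alpha> \<in> hom D (fob M (X \<otimes> Y)) \<one>\<^sub>D" by (simp add: TM_eps_def TM_ob_def)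
    then obtain \<gamma> where \<gamma>: "D.rep (ffr (fnode fX fY)) D.funit \<alpha> \<gamma>"
      using D.rep_ex[of "ffr (fnode fX fY)" D.funit \<alpha>] by auto
    then obtain s where s: "D.hm s [X] [dd Y]" "bar s = \<gamma>" using bar_surj[of \<gamma>] D.rep_hm[OF \<gamma>] by auto
    then obtain \<beta> where \<beta>: "D.rep (ffr fX) (ffr (fleaf (dd Y))) \<beta> s"
      using D.rep_ex'[of "ffr fX" "ffr (fleaf (dd Y))" s] by auto
    have "cap \<beta> = \<alpha>" using rep_cap[OF \<beta>] \<gamma> s(2) D.rep_inj by blast
    moreover have "\<beta> \<in> hom_sigma C D M X (dd Y)" using hom_sigma_iff[OF \<beta>] TM_eps_iff[OF \<gamma>] \<alpha> s(2) by simp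
    ultimately show "\<alpha> \<in> cap ` hom_sigma C D M X (dd Y)" by blast
  qed
qed

lemma cap_linear:
  assumes "\<beta> \<in> hom D (fob M X) (fob M (dd Y))" "\<beta>' \<in> hom D (fob M X) (fob M (dd Y))"
  shows "cap (\<beta> + \<beta>') = cap \<beta> + cap \<beta>'" "cap (scl D a \<beta>) = scl D a (cap \<beta>)"
proof -
  let ?i = "\<iota>\<^sub>D (fob M Y)" and ?f = "inv_fmu C D M X Y"
    and ?g = "inv_fun1 C D M \<cdot>\<^sub>D (fmo M (ev C Y) \<cdot>\<^sub>D fmu M (dd Y) Y)"
  have f: "?f \<in> hom D (fob M (X \<otimes> Y)) (fob M X \<otimes>\<^sub>D fob M Y)"
    using D.inv_mor_inverses[OF fmu_iso, of X Y] by (simp add: inv_fmu_def inverses_def)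
  have i: "inv_fun1 C D M \<in> hom D (fob M \<one>) \<one>\<^sub>D"
    using D.inv_mor_inverses[OF fun1_iso] by (simp add: inv_fun1_def inverses_def)
  have g: "?g \<in> hom D (fob M (dd Y) \<otimes>\<^sub>D fob M Y) \<one>\<^sub>D"
    by (rule D.cmp_hom[OF D.cmp_hom[OF fmu_hom fmo_hom[OF ev_hom]] i])
  have b: "x \<boxtimes>\<^sub>D ?i \<in> hom D (fob M X \<otimes>\<^sub>D fob M Y) (fob M (dd Y) \<otimes>\<^sub>D fob M Y)"
    if "x \<in> hom D (fob M X) (fob M (dd Y))" for x by (rule D.tmo_hom[OF that D.id_hom])
  show "cap (\<beta> + \<beta>') = cap \<beta> + cap \<beta>'"
    unfolding cap_def D.tmo_add_left[OF assms D.id_hom] D.cmp_add_left[OF f b[OF assms(1)] b[OF assms(2)]]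
    by (rule D.cmp_add_right[OF D.cmp_hom[OF f b[OF assms(1)]] D.cmp_hom[OF f b[OF assms(2)]] g])
  show "cap (scl D a \<beta>) = scl D a (cap \<beta>)"
    unfolding cap_def D.tmo_scl_left[OF assms(1) D.id_hom] D.cmp_scl_left[OF f b[OF assms(1)]]
    by (rule D.cmp_scl_right[OF D.cmp_hom[OF f b[OF assms(1)]] g])
qed

lemma hom_sigma_subspace: "D.subspace (hom_sigma C D M X (dd Y))"
proof -
  let ?H = "hom D (fob M X) (fob M (dd Y))"
  let ?l = "\<lambda>Z. fmo2 C D M X Z Z X (inv_brd C Z X)" and ?r = "\<lambda>Z. fmo2 C D M (dd Y) Z Z (dd Y) (brd C (dd Y) Z)"
  let ?i = "\<lambda>Z. \<iota>\<^sub>D (fob M Z)"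
  have fi: "inv_fmu C D M A B \<in> hom D (fob M (A \<otimes> B)) (fob M A \<otimes>\<^sub>D fob M B)" for A B
    using D.inv_mor_inverses[OF fmu_iso, of A B] by (simp add: inv_fmu_def inverses_def)
  have ib: "inv_brd C A B \<in> hom C (B \<otimes> A) (A \<otimes> B)" for A B
    using inv_mor_inverses[OF brd_iso, of A B] by (simp add: inv_brd_def inverses_def)
  have l: "?l Z \<in> hom D (fob M X \<otimes>\<^sub>D fob M Z) (fob M Z \<otimes>\<^sub>D fob M X)" for Z
    unfolding fmo2_def by (rule D.cmp_hom[OF fmu_hom D.cmp_hom[OF fmo_hom[OF ib] fi]])
  have r: "?r Z \<in> hom D (fob M (dd Y) \<otimes>\<^sub>D fob M Z) (fob M Z \<otimes>\<^sub>D fob M (dd Y))" for Z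
    unfolding fmo2_def by (rule D.cmp_hom[OF fmu_hom D.cmp_hom[OF fmo_hom[OF iso_hom[OF brd_iso]] fi]])
  note il = D.tmo_hom[OF D.id_hom, of _ "fob M X" "fob M (dd Y)"] and ir = D.tmo_hom[OF _ D.id_hom, of _ "fob M X" "fob M (dd Y)"]
  show ?thesis
  proof (rule D.subspaceI)
    show "0 \<in> hom_sigma C D M X (dd Y)"
      using D.cmp_zero_left[OF l] D.cmp_zero_right[OF r] D.tmo_zero_left[OF D.id_hom] D.tmo_zero_right[OF D.id_hom]
      by (simp add: hom_sigma_def D.zero_hom)
  next
    fix x y assume a: "x \<in> hom_sigma C D M X (dd Y)" "y \<in> hom_sigma C D M X (dd Y)"
    then have h: "x \<in> ?H" "y \<in> ?H" by (simp_all add: hom_sigma_def)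
    have "(?i Z \<boxtimes>\<^sub>D (x + y)) \<cdot>\<^sub>D ?l Z = ?r Z \<cdot>\<^sub>D ((x + y) \<boxtimes>\<^sub>D ?i Z)" for Z
      using a D.tmo_add_right[OF D.id_hom h] D.tmo_add_left[OF h D.id_hom]
        D.cmp_add_left[OF l il[OF h(1)] il[OF h(2)]] D.cmp_add_right[OF ir[OF h(1)] ir[OF h(2)] r]
      by (simp add: hom_sigma_def)
    then show "x + y \<in> hom_sigma C D M X (dd Y)" using D.add_hom[OF h] by (simp add: hom_sigma_def)
  next
    fix c x assume a: "x \<in> hom_sigma C D M X (dd Y)"
    then have h: "x \<in> ?H" by (simp add: hom_sigma_def)
    have "(?i Z \<boxtimes>\<^sub>D scl D c x) \<cdot>\<^sub>D ?l Z = ?r Z \<cdot>\<^sub>D (scl D c x \<boxtimes>\<^sub>D ?i Z)" for Z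
      using a D.tmo_scl_right[OF D.id_hom h] D.tmo_scl_left[OF h D.id_hom]
        D.cmp_scl_left[OF l il[OF h]] D.cmp_scl_right[OF ir[OF h] r]
      by (simp add: hom_sigma_def)
    then show "scl D c x \<in> hom_sigma C D M X (dd Y)" using D.scl_hom[OF h] by (simp add: hom_sigma_def)
  qed
qed

lemma hom_sigma_isomorphic: "subspaces_isomorphic (scl D) (hom_sigma C D M X (dd Y)) (TM_eps C I D M X Y)"
proof -
  let ?V = "hom_sigma C D M X (dd Y)" and ?W = "TM_eps C I D M X Y"
  have W: "?W = cap ` ?V" using cap_bij by (simp add: bij_betw_def)
  have add: "cap (v + w) = cap v + cap w" if "v \<in> ?V" "w \<in> ?V" for v w
    using cap_linear(1) hom_sigma_hom that by blast
  have scl: "cap (scl D a v) = scl D a (cap v)" if "v \<in> ?V" for a v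
    using cap_linear(2) hom_sigma_hom that by blast
  note V = hom_sigma_subspace
  \<comment> \<open>\<open>?W\<close> is the image of a subspace under the linear
    \<open>cap\<close>, so closure is inherited.\<close>
  have "D.subspace ?W"
  proof (rule D.subspaceI)
    show "0 \<in> ?W" unfolding W using scl[OF D.subspace_0[OF V], of 0] D.subspace_0[OF V] by (auto simp: image_iff intro!: bexI[of _ 0])
  next
    fix x y assume "x \<in> ?W" "y \<in> ?W"
    then show "x + y \<in> ?W" unfolding W by (auto simp: add[symmetric] intro!: imageI D.subspace_add[OF V])
  next
    fix c x assume "x \<in> ?W"
    then show "scl D c x \<in> ?W" unfolding W by (auto simp: scl[symmetric] intro!: imageI D.subspace_scale[OF V])
  qed
  then show ?thesis unfolding subspaces_isomorphic_def using V cap_bij add scl by blast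
qed

end

theorem theorem7p4:
  fixes C :: "('k::alg_closed_field, 'o, 'm::ab_group_add, 'y) brcat_scheme"
    and D :: "('k, 'p, 'n::ab_group_add, 'z) pivcat_scheme"
    and M :: "('o, 'm, 'p, 'n) monfun"
    and I :: "'o set"
  assumes "premodular_category C"
    and "pivotal_category D"
    and "pivotal_monoidal_functor C D M"
    and "complete_simples C I"
    and "cat_dim C I \<noteq> 0"
  shows "\<forall>X Y. subspaces_isomorphic (scl D) (hom_sigma C D M X (dual C Y)) (TM_eps C I D M X Y)"
proof (intro allI)
  fix X Y
  have "premodular_simples C I"
    by (intro premodular_simples.intro premodular_simples_axioms.intro assms)
  moreover have "monoidal_functor C D M"
    using assms(3) by (rule pivotal_monoidal_functor.axioms)
  ultimately interpret tube_functor C I D M X Y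
    by (intro tube_functor.intro tube_functor_axioms.intro assms)
  show "subspaces_isomorphic (scl D) (hom_sigma C D M X (dual C Y)) (TM_eps C I D M X Y)"
    by (rule hom_sigma_isomorphic)
qed

end
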